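(* Let $d\in\{2,3\}$, $T>0$, $\lambda>0$, $D=[0,2]^d$, $\Omega=D\times[0,T]$. Let $u\in C^6(\overline D\times[0,T];\mathbb{R}^d)$ be the classical ($D$-periodic) solution of the Kuramoto-Sivashinsky equation $\partial_tu+(u\cdot\nabla)u+\lambda\Delta u+\Delta^2u=0$, let $u^*=u_\theta\in C^6(\overline D\times[0,T];\mathbb{R}^d)$ be the PINN-generated solution, and put $\hat u=u^*-u$. Then, with the training errors defined in the context, $$\|u^*-u\|_{L^2(\Omega)}^2\le C_3(M)\big(T+C_2T^2e^{C_2T}\big)=\mathcal{O}\Big(E_T(S)+M_t^{-2/d}+M_{\mathrm{int}}^{-1/(d+1)}+\sum_{i=1}^4M_{sb,i}^{-1/d}\Big),$$ where $$C_2=C_1\Big(\|\hat u\|_{L^\infty(\Omega)}^2+\|u\|_{L^\infty(\Omega)}^2+\|\nabla u\|_{L^2(\Omega)}^2+1\Big)$$ with $C_1>0$ a constant arising from Young's inequality, and $$C_3(M)=E_T^t(S_t)^2+C_tM_t^{-2/d}+E_T^{\mathrm{PDE}}(\theta,S_{\mathrm{int}})^2+C_{\mathrm{PDE}}M_{\mathrm{int}}^{-2/(d+1)}+CT^{1/2}\sum_{i=1}^4\Big[E_T^{sb,i}(\theta,S_{sb,i})+C_{sb,i}M_{sb,i}^{-1/d}\Big],$$ and where $$C\lesssim\|u\|_{C^4}+\|\hat u\|_{C^4}\lesssim\|u\|_{C^4}+16^{4L}(d+1)^8\big(4^4e^2W^3R^4\|\sigma\|_{C^4}\big)^{4L},$$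 $$C_t\lesssim\|u\|_{C^2}^2+\|\hat u\|_{C^2}^2\lesssim\|u\|_{C^2}^2+\big(e^22^6W^3R^2\|\sigma\|_{C^2}\big)^{2L},$$ $$C_{\mathrm{PDE}}^2\lesssim\|\hat u_j\|_{C^6}^2\lesssim\big(e^26^4W^3R^6\|\sigma\|_{C^6}\big)^{6L},$$ $$C_{sb,1}^2\lesssim\|\hat u_j\|_{C^2}^2\lesssim\big(e^22^4W^3R^2\|\sigma\|_{C^2}\big)^{2L},\qquad C_{sb,2}^2\lesssim\|\hat u_j\|_{C^3}^2\lesssim\big(e^23^4W^3R^3\|\sigma\|_{C^3}\big)^{3L},$$ $$C_{sb,3}^2\lesssim\|\hat u_j\|_{C^4}^2\lesssim\big(e^24^4W^3R^4\|\sigma\|_{C^4}\big)^{4L},\qquad C_{sb,4}^2\lesssim\|\hat u_j\|_{C^5}^2\lesssim\big(e^25^4W^3R^5\|\sigma\|_{C^5}\big)^{5L}.$$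
   Context: $D=[0,2]^d$ is regarded as a periodic cell: $u$ and its derivatives take equal values at corresponding points of opposite faces. $n$ is the unit normal to $\partial D$; for $x\in\partial D$, $x+2$ denotes the corresponding point on the opposite face; $\partial_n$ is the derivative in direction $n$. Neural network: $u_\theta:\mathbb{R}^{d+1}\to\mathbb{R}^d$, $u_\theta=A_L\circ(\sigma\circ A_{L-1})\circ\cdots\circ(\sigma\circ A_1)$, with affine maps $A_j(y)=W_jy+b_j$ between spaces of dimension at most $W$, all entries of $W_j,b_j$ in $[-R,R]$, and $\sigma:\mathbb{R}\to\mathbb{R}$ a sufficiently smooth activation function applied componentwise; so $L$ is the number of layers (at most $L$), $W$ the maximal width, and $R$ the bound on the weights. $\hat u_j$ denotes a component of $\hat u$. Residuals of $u^*$: $\mathcal{R}_{\mathrm{PDE}}=u^*_t+(u^*\cdot\nabla)u^*+\lambda\Delta u^*+\Delta^2u^*$ on $D\times(0,T)$; on $\partial D\times(0,T)$: $\mathcal{R}_{sb}^1=u^*(x)-u^*(x+2)$, $\mathcal{R}_{sb}^2=\partial_n(u^*(x)-u^*(x+2))$, $\mathcal{R}_{sb}^3=\Delta u^*(x)-\Delta u^*(x+2)$, $\mathcal{R}_{sb}^4=\partial_n(\Delta u^*(x)-\Delta u^*(x+2))$; and $\mathcal{R}_t=u^*(t=0)-u(t=0)$ on $D$. Quadrature: for a domain $\Lambda$ of dimension $d'$, partitioned into $M$ congruent cubes (cells) with midpoints $y_1,\dots,y_M$, the midpoint rule is $Q_M^\Lambda[g]=\frac{|\Lambda|}{M}\sum_{m=1}^Mg(y_m)$;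 it satisfies $|\int_\Lambda g-Q_M^\Lambda[g]|\le C_gM^{-2/d'}$ with $C_g\lesssim\|g\|_{C^2}$. Training errors: with quadrature point sets $S=(S_{\mathrm{int}},S_{sb,1},\dots,S_{sb,4},S_t)$ consisting of the midpoint nodes, of cardinalities $M_{\mathrm{int}}$ (in $D\times[0,T]$), $M_{sb,i}$ (in $\partial D\times[0,T]$), $M_t$ (in $D$), put $E_T^{\mathrm{PDE}}(\theta,S_{\mathrm{int}})^2=Q_{M_{\mathrm{int}}}[|\mathcal{R}_{\mathrm{PDE}}|^2]$, $E_T^{sb,i}(\theta,S_{sb,i})^2=Q_{M_{sb,i}}[|\mathcal{R}_{sb}^i|^2]$, $E_T^t(S_t)^2=Q_{M_t}[|\mathcal{R}_t|^2]$, and $E_T(S)^2=E_T(\theta,S)^2$ is the sum of these six squared errors. $A\lesssim B$ means $A\le cB$ with an unspecified constant $c>0$ independent of the training set and of the numbers of quadrature points. The constants $C,C_t,C_{\mathrm{PDE}},C_{sb,i}$ are positive constants, independent of the numbers of quadrature points, satisfying the displayed bounds.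
   Formalization: R > 0 is assumed and σ is C^6, not identically zero, with finite C^6 norm on the real line (for σ = 0 or R = 0 the bounds fail); if û = 0 the constants C, C_t, C_PDE, C_sb,i are only nonnegative, since the bounds then force C_PDE = 0. *)

theory Defs
  imports "HOL-Analysis.Analysis"
begin

(* C^k functions and norms on a set S. Derivatives are taken within S, so on the boundary
   of the closed boxes used below they are the one-sided ones (they are unique there). *)

definition pder :: "'a::euclidean_space set \<Rightarrow> 'a \<Rightarrow> ('a \<Rightarrow> 'b::real_normed_vector) \<Rightarrow> 'a \<Rightarrow> 'b" where
  "pder S b f z = frechet_derivative f (at z within S) b"

fun pders :: "'a::euclidean_space set \<Rightarrow> 'a list \<Rightarrow> ('a \<Rightarrow> 'b::real_normed_vector) \<Rightarrow> 'a \<Rightarrow> 'b" where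
  "pders S [] f = f"
| "pders S (b # bs) f = pder S b (pders S bs f)"

fun Ck_on :: "nat \<Rightarrow> 'a::euclidean_space set \<Rightarrow> ('a \<Rightarrow> 'b::real_normed_vector) \<Rightarrow> bool" where
  "Ck_on 0 S f \<longleftrightarrow> continuous_on S f"
| "Ck_on (Suc k) S f \<longleftrightarrow> f differentiable_on S \<and> (\<forall>b\<in>Basis. Ck_on k S (pder S b f))"

definition Ck_values :: "nat \<Rightarrow> 'a::euclidean_space set \<Rightarrow> ('a \<Rightarrow> 'b::real_normed_vector) \<Rightarrow> real set" where
  "Ck_values k S f = {norm (pders S bs f z) | bs z. set bs \<subseteq> Basis \<and> length bs \<le> k \<and> z \<in> S}"

definition Ck_norm :: "nat \<Rightarrow> 'a::euclidean_space set \<Rightarrow> ('a \<Rightarrow> 'b::real_normed_vector) \<Rightarrow> real" where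
  "Ck_norm k S f = Sup (Ck_values k S f)"

definition L2_on :: "'a::euclidean_space set \<Rightarrow> ('a \<Rightarrow> 'b::real_normed_vector) \<Rightarrow> real" where
  "L2_on S f = sqrt (LINT z|lebesgue_on S. (norm (f z))\<^sup>2)"

definition Linf_on :: "'a::euclidean_space set \<Rightarrow> ('a \<Rightarrow> 'b::real_normed_vector) \<Rightarrow> real" where
  "Linf_on S f = Inf {a. 0 \<le> a \<and> (AE z in lebesgue_on S. norm (f z) \<le> a)}"

(* Space-time points are pairs (x, t); the dimension d is CARD('n). *)

type_synonym 'n spacetime = "(real ^ 'n) \<times> real"
type_synonym 'n vfield = "'n spacetime \<Rightarrow> real ^ 'n"

definition cell :: "(real ^ 'n::finite) set" where
  "cell = {x. \<forall>i. 0 \<le> x $ i \<and> x $ i \<le> 2}"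

definition Om :: "real \<Rightarrow> 'n::finite spacetime set" where
  "Om T = cell \<times> {0..T}"

(* max over j of the C^k norm of the component f_j *)
definition comp_norm :: "nat \<Rightarrow> real \<Rightarrow> 'n::finite vfield \<Rightarrow> real" where
  "comp_norm k T f = (MAX j. Ck_norm k (Om T) (\<lambda>z. f z $ j))"

definition dt :: "real \<Rightarrow> 'n::finite vfield \<Rightarrow> 'n vfield" where
  "dt T f = pder (Om T) (0, 1) f"

definition dx :: "real \<Rightarrow> 'n::finite \<Rightarrow> 'n vfield \<Rightarrow> 'n vfield" where
  "dx T j f = pder (Om T) (axis j 1, 0) f"

definition lap :: "real \<Rightarrow> 'n::finite vfield \<Rightarrow> 'n vfield" where
  "lap T f z = (\<Sum>j\<in>UNIV. dx T j (dx T j f) z)"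

(* L^2(Om) norm of the spatial gradient, with the Frobenius norm pointwise *)
definition grad_L2 :: "real \<Rightarrow> 'n::finite vfield \<Rightarrow> real" where
  "grad_L2 T f = L2_on (Om T) (\<lambda>z. sqrt (\<Sum>j\<in>UNIV. (norm (dx T j f z))\<^sup>2))"

definition res_pde :: "real \<Rightarrow> real \<Rightarrow> 'n::finite vfield \<Rightarrow> 'n vfield" where
  "res_pde lam T v z =
     dt T v z + (\<Sum>j\<in>UNIV. (v z $ j) *\<^sub>R dx T j v z) + lam *\<^sub>R lap T v z + lap T (lap T v) z"

(* A derivative operator of order at most 6 is a list bs of basis directions. *)
definition cell_periodic :: "real \<Rightarrow> 'n::finite vfield \<Rightarrow> bool" where
  "cell_periodic T u \<longleftrightarrow>
     (\<forall>bs i x. \<forall>t\<in>{0..T}. set bs \<subseteq> Basis \<and> length bs \<le> 6 \<and> x \<in> cell \<and> x $ i = 0 \<longrightarrow>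
        pders (Om T) bs u (x, t) = pders (Om T) bs u (x + axis i 2, t))"

definition ks_solution :: "real \<Rightarrow> real \<Rightarrow> 'n::finite vfield \<Rightarrow> bool" where
  "ks_solution lam T u \<longleftrightarrow> Ck_on 6 (Om T) u \<and> cell_periodic T u \<and>
     (\<forall>x\<in>cell. \<forall>t\<in>{0<..<T}. res_pde lam T u (x, t) = 0)"

(* For x in the relative interior of a face (all quadrature nodes are of this kind), opp x is the
   corresponding point of the opposite face and outer_normal x the outward unit normal at x. *)

definition opp :: "real ^ 'n::finite \<Rightarrow> real ^ 'n" where
  "opp x = (\<chi> i. if x $ i = 0 then 2 else if x $ i = 2 then 0 else x $ i)"

definition outer_normal :: "real ^ 'n::finite \<Rightarrow> real ^ 'n" where
  "outer_normal x = (\<chi> i. if x $ i = 0 then -1 else if x $ i = 2 then 1 else 0)"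

definition jump :: "'n::finite vfield \<Rightarrow> 'n vfield" where
  "jump f = (\<lambda>(x, t). f (x, t) - f (opp x, t))"

(* The normal direction n = n(x) is the same for both terms. *)
definition normal_jump :: "real \<Rightarrow> 'n::finite vfield \<Rightarrow> 'n vfield" where
  "normal_jump T f = (\<lambda>(x, t). \<Sum>j\<in>UNIV. (outer_normal x $ j) *\<^sub>R jump (dx T j f) (x, t))"

definition res_sb :: "real \<Rightarrow> nat \<Rightarrow> 'n::finite vfield \<Rightarrow> 'n vfield" where
  "res_sb T i v =
     (if i = 1 then jump v
      else if i = 2 then normal_jump T v
      else if i = 3 then jump (lap T v)
      else normal_jump T (lap T v))"

definition res_t :: "'n::finite vfield \<Rightarrow> 'n vfield \<Rightarrow> real ^ 'n \<Rightarrow> real ^ 'n" where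
  "res_t v u x = v (x, 0) - u (x, 0)"

(* Midpoint quadrature *)

definition quad :: "real \<Rightarrow> 'a set \<Rightarrow> ('a \<Rightarrow> real) \<Rightarrow> real" where
  "quad vol S g = vol / real (card S) * (\<Sum>y\<in>S. g y)"

(* midpoints of N equal subintervals of [0, l] *)
definition mids :: "real \<Rightarrow> nat \<Rightarrow> real set" where
  "mids l N = {(real k + 1 / 2) * l / real N | k. k < N}"

record ('n::finite) training_set =
  S_int :: "'n spacetime set"
  S_sb :: "nat \<Rightarrow> 'n spacetime set"
  S_t :: "(real ^ 'n) set"

(* N cells along each spatial axis and K along the time axis. For kap = 1 the cells are cubes;
   since [0,2]^d x [0,T] has no partition into cubes unless T is a rational number, congruent boxes
   whose edges differ at most by a factor kap are admitted. *)
definition near_cubes :: "real \<Rightarrow> real \<Rightarrow> nat \<Rightarrow> nat \<Rightarrow> bool" where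
  "near_cubes kap T N K \<longleftrightarrow>
     0 < N \<and> 0 < K \<and> 2 / real N \<le> kap * (T / real K) \<and> T / real K \<le> kap * (2 / real N)"

definition midpoint_set :: "real \<Rightarrow> real \<Rightarrow> 'n::finite training_set \<Rightarrow> bool" where
  "midpoint_set kap T S \<longleftrightarrow>
     (\<exists>N K. near_cubes kap T N K \<and>
        S_int S = {x. \<forall>i. x $ i \<in> mids 2 N} \<times> mids T K) \<and>
     (\<forall>l\<in>{1..4}. \<exists>N K. near_cubes kap T N K \<and>
        S_sb S l = {x. \<exists>i. x $ i \<in> {0, 2} \<and> (\<forall>j. j \<noteq> i \<longrightarrow> x $ j \<in> mids 2 N)} \<times> mids T K) \<and>
     (\<exists>N>0. S_t S = {x. \<forall>i. x $ i \<in> mids 2 N})"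

definition M_int :: "'n::finite training_set \<Rightarrow> real" where "M_int S = real (card (S_int S))"
definition M_sb :: "nat \<Rightarrow> 'n::finite training_set \<Rightarrow> real" where "M_sb i S = real (card (S_sb S i))"
definition M_t :: "'n::finite training_set \<Rightarrow> real" where "M_t S = real (card (S_t S))"

definition E_pde :: "real \<Rightarrow> real \<Rightarrow> 'n::finite vfield \<Rightarrow> 'n training_set \<Rightarrow> real" where
  "E_pde lam T v S =
     sqrt (quad (measure lebesgue (Om T :: 'n spacetime set)) (S_int S) (\<lambda>z. (norm (res_pde lam T v z))\<^sup>2))"

(* The boundary of the cell consists of 2 * CARD('n) faces of measure 2 ^ (CARD('n) - 1). *)
definition E_sb :: "real \<Rightarrow> nat \<Rightarrow> 'n::finite vfield \<Rightarrow> 'n training_set \<Rightarrow> real" where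
  "E_sb T i v S =
     sqrt (quad (2 * real CARD('n) * 2 ^ (CARD('n) - 1) * T) (S_sb S i) (\<lambda>z. (norm (res_sb T i v z))\<^sup>2))"

definition E_t :: "'n::finite vfield \<Rightarrow> 'n vfield \<Rightarrow> 'n training_set \<Rightarrow> real" where
  "E_t v u S =
     sqrt (quad (measure lebesgue (cell :: (real ^ 'n) set)) (S_t S) (\<lambda>x. (norm (res_t v u x))\<^sup>2))"

definition E_total :: "real \<Rightarrow> real \<Rightarrow> 'n::finite vfield \<Rightarrow> 'n vfield \<Rightarrow>
    'n training_set \<Rightarrow> real" where
  "E_total lam T v u S =
     sqrt ((E_pde lam T v S)\<^sup>2 + (\<Sum>i=1..4. (E_sb T i v S)\<^sup>2) + (E_t v u S)\<^sup>2)"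

(* Neural networks. Vectors of variable dimension n are functions nat => real, of which only the
   values at indices below n matter. *)

record layer =
  in_dim :: nat
  out_dim :: nat
  weight :: "nat \<Rightarrow> nat \<Rightarrow> real"
  bias :: "nat \<Rightarrow> real"

definition affine_map :: "layer \<Rightarrow> (nat \<Rightarrow> real) \<Rightarrow> nat \<Rightarrow> real" where
  "affine_map A y i = (\<Sum>j<in_dim A. weight A i j * y j) + bias A i"

fun nn_eval :: "(real \<Rightarrow> real) \<Rightarrow> layer list \<Rightarrow> (nat \<Rightarrow> real) \<Rightarrow> nat \<Rightarrow> real" where
  "nn_eval \<sigma> [] y = y"
| "nn_eval \<sigma> [A] y = affine_map A y"
| "nn_eval \<sigma> (A # B # As) y = nn_eval \<sigma> (B # As) (\<lambda>i. \<sigma> (affine_map A y i))"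

(* Parameters of the networks from R^(d+1) to R^d with at most L layers, width at most W and
   weights bounded by R; the first layer is the head of the list. *)
definition networks :: "nat \<Rightarrow> nat \<Rightarrow> nat \<Rightarrow> real \<Rightarrow> layer list set" where
  "networks d L W R = {\<theta>. \<theta> \<noteq> [] \<and> length \<theta> \<le> L \<and>
     in_dim (hd \<theta>) = d + 1 \<and> out_dim (last \<theta>) = d \<and>
     (\<forall>k. Suc k < length \<theta> \<longrightarrow> out_dim (\<theta> ! k) = in_dim (\<theta> ! Suc k)) \<and>
     (\<forall>A\<in>set \<theta>. in_dim A \<le> W \<and> out_dim A \<le> W \<and>
        (\<forall>i<out_dim A. \<bar>bias A i\<bar> \<le> R \<and> (\<forall>j<in_dim A. \<bar>weight A i j\<bar> \<le> R)))}"

(* The coordinates of real ^ 'n are numbered by the bijection to_nat_on UNIV onto {..<CARD('n)};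
   the time coordinate has number CARD('n). *)
definition nn_fun :: "(real \<Rightarrow> real) \<Rightarrow> layer list \<Rightarrow> 'n::finite vfield" where
  "nn_fun \<sigma> \<theta> = (\<lambda>(x, t). \<chi> j. nn_eval \<sigma> \<theta>
     (\<lambda>i. if i < CARD('n) then x $ from_nat_into UNIV i else t) (to_nat_on UNIV j))"

(* The norms of \<sigma> are taken over the whole real line, hence finiteness up to order 6 is required.
   For \<sigma> = 0 every bound of the form const * norm of \<sigma> would be 0. *)
definition activation :: "(real \<Rightarrow> real) \<Rightarrow> bool" where
  "activation \<sigma> \<longleftrightarrow> Ck_on 6 UNIV \<sigma> \<and> bdd_above (Ck_values 6 UNIV \<sigma>) \<and> (\<exists>s. \<sigma> s \<noteq> 0)"

definition C2_const :: "real \<Rightarrow> real \<Rightarrow> 'n::finite vfield \<Rightarrow> 'n vfield \<Rightarrow> real" where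
  "C2_const C1 T v u =
     C1 * ((Linf_on (Om T) (\<lambda>z. v z - u z))\<^sup>2 + (Linf_on (Om T) u)\<^sup>2 + (grad_L2 T u)\<^sup>2 + 1)"

definition C3_const :: "real \<Rightarrow> real \<Rightarrow> real \<Rightarrow> real \<Rightarrow> real \<Rightarrow> (nat \<Rightarrow> real) \<Rightarrow>
    'n::finite vfield \<Rightarrow> 'n vfield \<Rightarrow> 'n training_set \<Rightarrow> real" where
  "C3_const lam T C Ct Cpde Csb v u S =
     (E_t v u S)\<^sup>2 + Ct * M_t S powr (- 2 / real CARD('n)) +
     (E_pde lam T v S)\<^sup>2 + Cpde * M_int S powr (- 2 / (real CARD('n) + 1)) +
     C * T powr (1 / 2) *
       (\<Sum>i=1..4. E_sb T i v S + Csb i * M_sb i S powr (- 1 / real CARD('n)))"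

end

theory Submission
  imports Defs
begin

text \<open>Let \<open>e\<close> be the error. Testing its equation with \<open>e\<close> and integrating by parts gives an energy
  inequality. The gradient in the term \<open>(e \<cdot> \<nabla>)u \<cdot> e\<close> is moved off \<open>u\<close>, so that only sup norms enter; the
  bilaplacian contributes the square of the Laplacian of \<open>e\<close>, which together with
  \<open>\<integral>|\<nabla>e|\<^sup>2 = - \<integral>e \<cdot> \<Delta>e + boundary terms\<close> absorbs all lower-order terms. Since \<open>u\<close> is periodic, each
  boundary term contains the jump of \<open>e\<close>, \<open>\<partial>\<^sub>n e\<close>, \<open>\<Delta>e\<close> or \<open>\<partial>\<^sub>n \<Delta>e\<close> as a factor, and these jumps are
  the boundary residuals. Gronwall's inequality then bounds the error by the \<open>L\<^sup>2\<close> norms of the residuals.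
  The initial residual must be compared with its quadrature with constant 1, which requires the second-order
  midpoint rule. For the other residuals a piecewise constant comparison suffices: Young's inequality leaves
  a factor 1/2 in front of the PDE residual, and the boundary residuals enter without squares.
  The \<open>C\<^sup>k\<close> norms of networks are estimated layer by layer.\<close>

section \<open>Functions of class \<open>C\<^sup>k\<close> and bounds on their derivatives\<close>

text \<open>The form of \<open>C2_const\<close> shapes the energy argument: C1 is fixed before
  \<open>T\<close>, \<open>u\<close> and the network, and the gradient of \<open>u\<close> occurs
  only in L^2, so no pointwise bound on that gradient may enter the Gronwall exponent. The C^6 norm
  of \<open>u\<close> enters only through constants chosen after \<open>u\<close>. The required
  bounds on \<open>Cpde\<close> are linear in a norm of the error, whereas the squared PDE residual
  is quadratic in it: one factor is kept, the others are bounded in terms of \<open>W\<close> and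
  \<open>R\<close>. In the same way squared training errors become linear ones in the final
  estimate. The layerwise bound for a network is a power of \<open>W * R\<close>; it is brought to
  the shape \<open>W ^ 3 * R ^ k\<close> at the cost of a constant depending on \<open>L\<close>,
  \<sigma> and a lower bound \<open>R0\<close> for \<open>R\<close>. Surface measure is avoided: a
  face is represented by functions on the whole cylinder that do not depend on one coordinate, and
  the interior midpoint grid projects onto the grids of the faces.\<close>

definition thick :: "'a::euclidean_space set \<Rightarrow> bool" where
  "thick S \<longleftrightarrow> (\<forall>x\<in>S. \<forall>i\<in>Basis. \<forall>e>0. \<exists>d. 0 < \<bar>d\<bar> \<and> \<bar>d\<bar> < e \<and> x + d *\<^sub>R i \<in> S)"

lemma thick_cbox:
  fixes a b :: "'a::euclidean_space"
  assumes "\<And>i. i \<in> Basis \<Longrightarrow> a \<bullet> i < b \<bullet> i"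
  shows "thick (cbox a b)"
  unfolding thick_def
proof (intro ballI allI impI)
  fix x i :: 'a and e :: real assume x: "x \<in> cbox a b" and i: "i \<in> Basis" and "e > 0"
  show "\<exists>d. 0 < \<bar>d\<bar> \<and> \<bar>d\<bar> < e \<and> x + d *\<^sub>R i \<in> cbox a b"
  \<comment> \<open>From the lower face the step goes inwards, from any other point down towards
    that face, by half of what the box and \<open>e\<close> allow.\<close>
  proof (cases "x \<bullet> i = a \<bullet> i")
    case True
    with assms[of i] \<open>e>0\<close> x i show ?thesis
      by (intro exI[of _ "(min (b\<bullet>i - a\<bullet>i) e) / 2"])
         (auto simp add: mem_box field_simps inner_simps inner_Basis)
  next
    case False
    moreover have "a \<bullet> i < x \<bullet> i"
      using False i mem_box(2) x by force
    moreover have "a \<bullet> i * 2 + min (x \<bullet> i - a \<bullet> i) e \<le> a\<bullet>i *2 + x\<bullet>i - a\<bullet>i" by auto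
    moreover have "x \<bullet> i * 2 - min (x \<bullet> i - a \<bullet> i) e \<le> b \<bullet> i * 2"
      using x i by (smt (verit) \<open>0 < e\<close> calculation(2) mem_box(2))
    ultimately show ?thesis
      using x i \<open>e > 0\<close>
      by (intro exI[of _ "- (min (x\<bullet>i - a\<bullet>i) e) / 2"])
         (auto simp add: mem_box field_simps inner_simps inner_Basis)
  qed
qed

text \<open>\<open>pder\<close> refers to a chosen derivative within \<open>S\<close>;
  \<open>thick\<close> makes that derivative unique, since \<open>S\<close> then has points close to
  \<open>z\<close> along every coordinate axis. The algebraic rules for \<open>pder\<close> come
  from here.\<close>

lemma pder_eqI:
  assumes "thick S" "z \<in> S" "(f has_derivative f') (at z within S)"
  shows "pder S b f z = f' b"
proof -
  have "(f has_derivative frechet_derivative f (at z within S)) (at z within S)"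
    using assms(3) frechet_derivative_works differentiable_def by blast
  then have "frechet_derivative f (at z within S) = f'"
    using assms by (intro frechet_derivative_unique_within[OF _ assms(3)]) (auto simp: thick_def)
  then show ?thesis by (simp add: pder_def)
qed

lemma has_derivative_frechet:
  assumes "f differentiable_on S" "z \<in> S"
  shows "(f has_derivative frechet_derivative f (at z within S)) (at z within S)"
  using assms by (simp add: differentiable_on_def frechet_derivative_works)

lemma differentiable_on_cong:
  assumes "\<And>z. z \<in> S \<Longrightarrow> f z = g z"
  shows "f differentiable_on S \<longleftrightarrow> g differentiable_on S"
  unfolding differentiable_on_def differentiable_def
  using assms by (metis has_derivative_transform)

text \<open>Differentiability is not an issue: \<open>frechet_derivative\<close> is a choice among
  the derivatives within \<open>S\<close>, and which maps are such derivatives depends only on the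
  values on \<open>S\<close>.\<close>

lemma pder_cong:
  assumes "\<And>z. z \<in> S \<Longrightarrow> f z = g z" "z \<in> S"
  shows "pder S b f z = pder S b g z"
proof -
  have "(f has_derivative D) (at z within S) \<longleftrightarrow> (g has_derivative D) (at z within S)" for D
    using assms by (metis has_derivative_transform)
  then show ?thesis by (simp add: pder_def frechet_derivative_def)
qed

lemma pder_add:
  assumes "thick S" "f differentiable_on S" "g differentiable_on S" "z \<in> S"
  shows "pder S b (\<lambda>z. f z + g z) z = pder S b f z + pder S b g z"
  using pder_eqI[OF assms(1,4) has_derivative_add[OF assms(2,3)[THEN has_derivative_frechet[OF _ assms(4)]]]]
  by (simp add: pder_def)

lemma pder_diff:
  assumes "thick S" "f differentiable_on S" "g differentiable_on S" "z \<in> S"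
  shows "pder S b (\<lambda>z. f z - g z) z = pder S b f z - pder S b g z"
  using pder_eqI[OF assms(1,4) has_derivative_diff[OF assms(2,3)[THEN has_derivative_frechet[OF _ assms(4)]]]]
  by (simp add: pder_def)

lemma pder_linear:
  assumes "thick S" "bounded_linear h" "f differentiable_on S" "z \<in> S"
  shows "pder S b (\<lambda>z. h (f z)) z = h (pder S b f z)"
  using pder_eqI[OF assms(1,4) bounded_linear.has_derivative[OF assms(2) has_derivative_frechet[OF assms(3,4)]]]
  by (simp add: pder_def)

lemma pder_bilinear:
  assumes "thick S" "bounded_bilinear p" "f differentiable_on S" "g differentiable_on S" "z \<in> S"
  shows "pder S b (\<lambda>z. p (f z) (g z)) z = p (f z) (pder S b g z) + p (pder S b f z) (g z)"
  using pder_eqI[OF assms(1,5) bounded_bilinear.FDERIV[OF assms(2) assms(3,4)[THEN has_derivative_frechet[OF _ assms(5)]]]]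
  by (simp add: pder_def)

lemma differentiable_on_linear:
  assumes "bounded_linear h" "f differentiable_on S"
  shows "(\<lambda>z. h (f z)) differentiable_on S"
  using bounded_linear.has_derivative[OF assms(1) has_derivative_frechet[OF assms(2)]]
  unfolding differentiable_on_def differentiable_def by blast

lemma differentiable_on_bilinear:
  assumes "bounded_bilinear p" "f differentiable_on S" "g differentiable_on S"
  shows "(\<lambda>z. p (f z) (g z)) differentiable_on S"
  using bounded_bilinear.FDERIV[OF assms(1) assms(2,3)[THEN has_derivative_frechet]]
  unfolding differentiable_on_def differentiable_def by blast

lemma compose_real:
  fixes \<sigma> :: "real \<Rightarrow> real"
  assumes "thick S" "\<sigma> differentiable_on UNIV" "f differentiable_on S" "z \<in> S"
  shows "pder S b (\<lambda>z. \<sigma> (f z)) z = pder UNIV 1 \<sigma> (f z) * pder S b f z"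
    and "(\<lambda>z. \<sigma> (f z)) differentiable at z within S"
proof -
  let ?D = "frechet_derivative \<sigma> (at (f z))"
  have D: "(\<sigma> has_derivative ?D) (at (f z))"
    using has_derivative_frechet[OF assms(2), of "f z"] by simp
  have *: "((\<lambda>z. \<sigma> (f z)) has_derivative (\<lambda>h. ?D (frechet_derivative f (at z within S) h))) (at z within S)"
    by (rule has_derivative_compose[OF has_derivative_frechet[OF assms(3,4)] D])
  then show "(\<lambda>z. \<sigma> (f z)) differentiable at z within S"
    by (rule differentiableI)
  interpret bounded_linear ?D using has_derivative_bounded_linear[OF D] .
  have "?D x = x * ?D 1" for x
    using scale[of x 1] by simp
  from pder_eqI[OF assms(1,4) *, unfolded this[of "frechet_derivative f _ _"]] show "pder S b (\<lambda>z. \<sigma> (f z)) z = pder UNIV 1 \<sigma> (f z) * pder S b f z"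
    by (simp add: pder_def)
qed

text \<open>All derivatives of \<open>f\<close> of order \<open>m \<le> k\<close> are bounded by \<open>X * G ^ m\<close>. The rate \<open>G\<close> is what makes the
  bounds for a composition of layers multiplicative.\<close>

fun Ck_bound :: "nat \<Rightarrow> 'a::euclidean_space set \<Rightarrow> ('a \<Rightarrow> 'b::real_normed_vector) \<Rightarrow> real \<Rightarrow> real \<Rightarrow> bool" where
  "Ck_bound 0 S f X G \<longleftrightarrow> continuous_on S f \<and> (\<forall>z\<in>S. norm (f z) \<le> X)"
| "Ck_bound (Suc k) S f X G \<longleftrightarrow> f differentiable_on S \<and> (\<forall>z\<in>S. norm (f z) \<le> X) \<and>
     (\<forall>b\<in>Basis. Ck_bound k S (pder S b f) (X * G) G)"

text \<open>The formulas for derivatives of sums, products and compositions hold on \<open>S\<close>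
  only, not as equations between functions; this is what allows them to be substituted under
  \<open>Ck_bound\<close>.\<close>

lemma Ck_bound_cong:
  assumes "\<And>z. z \<in> S \<Longrightarrow> f z = g z"
  shows "Ck_bound k S f X G \<longleftrightarrow> Ck_bound k S g X G"
  using assms
proof (induction k arbitrary: f g X)
  case 0
  then show ?case by (auto cong: continuous_on_cong)
next
  case (Suc k)
  have "Ck_bound k S (pder S b f) (X * G) G \<longleftrightarrow> Ck_bound k S (pder S b g) (X * G) G" for b
    by (rule Suc.IH) (rule pder_cong[OF Suc.prems])
  then show ?case using Suc.prems differentiable_on_cong[of S f g] by simp
qed

lemma Ck_bound_norm: "Ck_bound k S f X G \<Longrightarrow> z \<in> S \<Longrightarrow> norm (f z) \<le> X"
  by (cases k) auto

lemma Ck_bound_continuous: "Ck_bound k S f X G \<Longrightarrow> continuous_on S f"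
  by (cases k) (auto intro: differentiable_imp_continuous_on)

lemma Ck_bound_le: "j \<le> k \<Longrightarrow> Ck_bound k S f X G \<Longrightarrow> Ck_bound j S f X G"
proof (induction k arbitrary: j f X)
  case (Suc k)
  show ?case
  proof (cases j)
    case 0
    then show ?thesis using Suc.prems by (auto intro: differentiable_imp_continuous_on)
  next
    case (Suc i)
    then show ?thesis using Suc.prems Suc.IH[of i] by auto
  qed
qed simp

lemma Ck_bound_mono:
  assumes "Ck_bound k S f X G" "X \<le> Y" "G \<le> H" "0 \<le> X" "0 \<le> G"
  shows "Ck_bound k S f Y H"
  using assms
proof (induction k arbitrary: f X Y)
  case (Suc k)
  have "X * G \<le> Y * H" "0 \<le> X * G"
    using Suc.prems by (auto intro: mult_mono)
  then show ?case using Suc.IH[of _ "X * G" "Y * H"] Suc.prems by force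
qed force

lemma Ck_bound_add:
  assumes "thick S" "Ck_bound k S f X G" "Ck_bound k S g Y G"
  shows "Ck_bound k S (\<lambda>z. f z + g z) (X + Y) G"
  using assms(2,3)
proof (induction k arbitrary: f g X Y)
  case 0
  then show ?case by (fastforce intro: continuous_intros norm_triangle_mono)
next
  case (Suc k)
  have "Ck_bound k S (pder S b (\<lambda>z. f z + g z)) ((X + Y) * G) G" if "b \<in> Basis" for b
  proof -
    have "Ck_bound k S (\<lambda>z. pder S b f z + pder S b g z) (X * G + Y * G) G"
      using Suc that by auto
    then show ?thesis
      using Suc.prems by (subst Ck_bound_cong[OF pder_add[OF assms(1)]]) (auto simp: distrib_right)
  qed
  then show ?case using Suc.prems by (fastforce intro: differentiable_on_add norm_triangle_mono)
qed

lemma Ck_bound_linear: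
  assumes "thick S" "bounded_linear h" "\<And>a. norm (h a) \<le> norm a * B" "0 \<le> B" "Ck_bound k S f X G"
  shows "Ck_bound k S (\<lambda>z. h (f z)) (X * B) G"
  using assms(5)
proof (induction k arbitrary: f X)
  case 0
  then show ?case
    by (auto intro!: continuous_on_compose2[OF linear_continuous_on[OF assms(2), of UNIV]] order_trans[OF assms(3)]
        mult_right_mono assms(4))
next
  case (Suc k)
  have "Ck_bound k S (pder S b (\<lambda>z. h (f z))) (X * B * G) G" if "b \<in> Basis" for b
  proof -
    have "Ck_bound k S (\<lambda>z. h (pder S b f z)) (X * G * B) G"
      using Suc that by auto
    then show ?thesis
      using Suc.prems by (subst Ck_bound_cong[OF pder_linear[OF assms(1,2)]]) (auto simp: mult_ac)
  qed
  then show ?case using Suc.prems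
    by (auto intro!: differentiable_on_linear[OF assms(2)] order_trans[OF assms(3)] mult_right_mono assms(4))
qed

lemma Ck_bound_zero: "thick S \<Longrightarrow> 0 \<le> X \<Longrightarrow> 0 \<le> G \<Longrightarrow> Ck_bound k S (\<lambda>z. 0 :: 'b::real_normed_vector) X G"
proof (induction k arbitrary: X)
  case (Suc k)
  have "Ck_bound k S (pder S b (\<lambda>z. 0 :: 'b)) (X * G) G" for b
    using Suc.IH[of "X * G"] Suc.prems
    by (subst Ck_bound_cong[OF pder_eqI[OF Suc.prems(1) _ has_derivative_const]]) auto
  then show ?case using Suc by simp
qed simp

lemma Ck_bound_const:
  assumes "thick S" "norm c \<le> X" "0 \<le> G"
  shows "Ck_bound k S (\<lambda>z. c) X G"
proof (cases k)
  case 0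
  then show ?thesis using assms by simp
next
  case (Suc j)
  have "0 \<le> X" using assms(2) norm_ge_zero order_trans by blast
  then have "Ck_bound j S (pder S b (\<lambda>z. c)) (X * G) G" for b
    using Ck_bound_zero[of S "X * G" G j] assms
    by (subst Ck_bound_cong[OF pder_eqI[OF assms(1) _ has_derivative_const]]) auto
  then show ?thesis using Suc assms by simp
qed

lemma Ck_bound_sum:
  assumes "thick S" "finite I" "\<And>i. i \<in> I \<Longrightarrow> Ck_bound k S (f i) (X i) G" "0 \<le> G"
  shows "Ck_bound k S (\<lambda>z. \<Sum>i\<in>I. f i z) (\<Sum>i\<in>I. X i) G"
  using assms(2,3)
proof (induction I rule: finite_induct)
  case empty
  then show ?case using Ck_bound_zero assms by auto
next
  case (insert i I)
  then show ?case using Ck_bound_add[OF assms(1), of k "f i"] by auto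
qed

text \<open>Each differentiation splits a product in two, whence \<open>2 ^ k\<close>. The common
  rate survives because \<open>G\<close> is gained once per derivative, whichever factor is
  differentiated.\<close>

lemma Ck_bound_bilinear:
  assumes "thick S" "bounded_bilinear p" "\<And>a b. norm (p a b) \<le> norm a * norm b"
    "Ck_bound k S f X G" "Ck_bound k S g Y G" "0 \<le> X" "0 \<le> Y" "0 \<le> G"
  shows "Ck_bound k S (\<lambda>z. p (f z) (g z)) (2 ^ k * X * Y) G"
  using assms(4-8)
proof (induction k arbitrary: f g X Y)
  case 0
  have "norm (p (f z) (g z)) \<le> X * Y" if "z \<in> S" for z
    using order_trans[OF assms(3) mult_mono[of "norm (f z)" X "norm (g z)" Y]] 0 that by auto
  then show ?case using bounded_bilinear.continuous_on[OF assms(2)] 0 by auto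
next
  case (Suc k)
  have "Ck_bound k S (pder S b (\<lambda>z. p (f z) (g z))) (2 ^ Suc k * X * Y * G) G" if "b \<in> Basis" for b
  proof -
    have "Ck_bound k S (\<lambda>z. p (f z) (pder S b g z)) (2 ^ k * X * (Y * G)) G"
      by (rule Suc.IH) (use Suc.prems that Ck_bound_le[of k "Suc k"] in auto)
    moreover have "Ck_bound k S (\<lambda>z. p (pder S b f z) (g z)) (2 ^ k * (X * G) * Y) G"
      by (rule Suc.IH) (use Suc.prems that Ck_bound_le[of k "Suc k"] in auto)
    ultimately have "Ck_bound k S (\<lambda>z. p (f z) (pder S b g z) + p (pder S b f z) (g z))
       (2 ^ k * X * (Y * G) + 2 ^ k * (X * G) * Y) G"
      using Ck_bound_add[OF assms(1)] by blast
    then show ?thesis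
      using Suc.prems by (subst Ck_bound_cong[OF pder_bilinear[OF assms(1,2)]]) (auto simp: mult_ac)
  qed
  moreover have "norm (p (f z) (g z)) \<le> 2 ^ Suc k * X * Y" if "z \<in> S" for z
  proof -
    have "norm (p (f z) (g z)) \<le> X * Y"
      using order_trans[OF assms(3) mult_mono[of "norm (f z)" X "norm (g z)" Y]] Suc.prems that by auto
    also have "\<dots> \<le> 2 ^ Suc k * (X * Y)"
      using mult_right_mono[of 1 "2 ^ Suc k" "X * Y"] Suc.prems
      by (metis mult_1 mult_nonneg_nonneg one_le_numeral one_le_power)
    finally show ?thesis by (simp add: mult_ac)
  qed
  ultimately show ?case using Suc.prems differentiable_on_bilinear[OF assms(2)] by auto
qed

text \<open>By the chain rule every derivative brings in a derivative of \<open>f\<close>, of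
  amplitude \<open>Y * G\<close>, and this becomes the rate of the composition. The amplitude sees
  only the bound \<open>s\<close> on \<sigma>. Since \<open>1 \<le> Y\<close>, the old rate
  \<open>G\<close> is at most the new one.\<close>

lemma Ck_bound_compose:
  fixes \<sigma> :: "real \<Rightarrow> real"
  assumes "thick S" "Ck_bound k UNIV \<sigma> s 1" "0 \<le> s" "Ck_bound k S f Y G" "1 \<le> Y" "1 \<le> G"
  shows "Ck_bound k S (\<lambda>z. \<sigma> (f z)) (2 ^ (k * k) * s) (Y * G)"
  using assms(2-4)
proof (induction k arbitrary: \<sigma> s)
  case 0
  then show ?case by (auto intro: continuous_on_compose2)
next
  case (Suc k)
  have YG: "0 \<le> Y * G" "G \<le> Y * G" "0 \<le> G" using assms by auto
  have "Ck_bound k S (pder S b (\<lambda>z. \<sigma> (f z))) (2 ^ (Suc k * Suc k) * s * (Y * G)) (Y * G)" if b: "b \<in> Basis" for b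
  proof -
    have "Ck_bound k S (\<lambda>z. pder UNIV 1 \<sigma> (f z)) (2 ^ (k * k) * s) (Y * G)"
      by (rule Suc.IH) (use Suc.prems Ck_bound_le[of k "Suc k" S f] in auto)
    moreover have "Ck_bound k S (pder S b f) (Y * G) (Y * G)"
      by (rule Ck_bound_mono[of k S _ "Y * G" G]) (use Suc.prems b YG in auto)
    ultimately have *: "Ck_bound k S (\<lambda>z. pder UNIV 1 \<sigma> (f z) * pder S b f z) (2 ^ k * (2 ^ (k * k) * s) * (Y * G)) (Y * G)"
      using Suc.prems YG by (intro Ck_bound_bilinear[OF assms(1) bounded_bilinear_mult]) (auto simp: abs_mult)
    \<comment> \<open>The product rule costs \<open>2 ^ k\<close> at this order; as
      \<open>k + k * k\<close> is at most \<open>Suc k * Suc k\<close>, the crude exponent survives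
      the induction.\<close>
    have "2 ^ k * (2 ^ (k * k) * s) = 2 ^ (k + k * k) * s" by (simp add: power_add)
    also have "\<dots> \<le> 2 ^ (Suc k * Suc k) * s"
      by (intro mult_right_mono power_increasing) (use Suc.prems in auto)
    finally have "2 ^ k * (2 ^ (k * k) * s) * (Y * G) \<le> 2 ^ (Suc k * Suc k) * s * (Y * G)"
      using YG(1) by (rule mult_right_mono)
    from Ck_bound_mono[OF * this] Suc.prems YG
    show ?thesis
      by (subst Ck_bound_cong[OF compose_real(1)[OF assms(1)]]) (simp_all del: mult_Suc mult_Suc_right)
  qed
  moreover have "norm (\<sigma> (f z)) \<le> 2 ^ (Suc k * Suc k) * s" for z
  proof -
    have "norm (\<sigma> (f z)) \<le> 1 * s" using Suc.prems by simp
    also have "\<dots> \<le> 2 ^ (Suc k * Suc k) * s"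
      using Suc.prems by (intro mult_right_mono one_le_power) auto
    finally show ?thesis .
  qed
  ultimately show ?case using Suc.prems compose_real(2)[OF assms(1), of \<sigma> f]
    by (simp add: differentiable_on_def del: mult_Suc mult_Suc_right)
qed

section \<open>Iterated partial derivatives and the C^k norm\<close>

lemma Ck_bound_imp_Ck_on: "Ck_bound k S f X G \<Longrightarrow> Ck_on k S f"
  by (induction k arbitrary: f X) auto

text \<open>\<open>pders\<close> peels off the outermost derivative, \<open>Ck_on\<close> and
  \<open>Ck_bound\<close> the innermost one. This reconciles the two recursions and is the reason
  for splitting lists at their end below.\<close>

lemma pders_snoc: "pders S (bs @ [b]) f = pders S bs (pder S b f)"
  by (induction bs) auto

lemma Ck_bound_pders:
  "Ck_bound k S f X G \<Longrightarrow> set bs \<subseteq> Basis \<Longrightarrow> length bs \<le> k \<Longrightarrow> z \<in> S \<Longrightarrow>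
    norm (pders S bs f z) \<le> X * G ^ length bs"
proof (induction k arbitrary: f X bs)
  case (Suc k)
  show ?case
  proof (cases bs rule: rev_exhaust)
    case Nil
    then show ?thesis using Suc.prems by simp
  next
    case (snoc cs b)
    then have "norm (pders S cs (pder S b f) z) \<le> X * G * G ^ length cs"
      using Suc by auto
    then show ?thesis using snoc by (simp add: pders_snoc mult_ac)
  qed
qed simp

lemma Ck_on_pders_continuous:
  "Ck_on k S f \<Longrightarrow> set bs \<subseteq> Basis \<Longrightarrow> length bs \<le> k \<Longrightarrow> continuous_on S (pders S bs f)"
proof (induction k arbitrary: f bs)
  case (Suc k)
  show ?case
  proof (cases bs rule: rev_exhaust)
    case Nil
    then show ?thesis using Suc.prems by (simp add: differentiable_imp_continuous_on)
  next
    case (snoc cs b)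
    then show ?thesis using Suc by (simp add: pders_snoc)
  qed
qed simp

lemma Ck_boundI:
  "Ck_on k S f \<Longrightarrow> (\<And>bs z. set bs \<subseteq> Basis \<Longrightarrow> length bs \<le> k \<Longrightarrow> z \<in> S \<Longrightarrow> norm (pders S bs f z) \<le> X)
    \<Longrightarrow> Ck_bound k S f X 1"
proof (induction k arbitrary: f)
  case 0
  then show ?case using 0(2)[of "[]"] by simp
next
  case (Suc k)
  have "norm (f z) \<le> X" if "z \<in> S" for z using Suc.prems(2)[of "[]"] that by simp
  moreover have "norm (pders S bs (pder S b f) z) \<le> X"
    if "b \<in> Basis" "set bs \<subseteq> Basis" "length bs \<le> k" "z \<in> S" for b bs z
    using Suc.prems(2)[of "bs @ [b]"] that by (simp add: pders_snoc)
  ultimately show ?case using Suc.prems(1) Suc.IH by auto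
qed

text \<open>\<open>Ck_norm\<close> is a \<open>Sup\<close> of reals and means something only for
  sets bounded above. On a compact set there are finitely many lists \<open>bs\<close>, each giving
  a continuous function; for \<sigma> on the whole line boundedness is part of
  \<open>activation\<close>.\<close>

lemma bdd_above_Ck_values:
  fixes f :: "'a::euclidean_space \<Rightarrow> 'b::real_normed_vector"
  assumes "compact S" "Ck_on k S f"
  shows "bdd_above (Ck_values k S f)"
proof -
  let ?I = "{bs::'a list. set bs \<subseteq> Basis \<and> length bs \<le> k}"
  have eq: "Ck_values k S f = (\<Union>bs\<in>?I. (\<lambda>z. norm (pders S bs f z)) ` S)"
    by (auto simp: Ck_values_def)
  have "bdd_above ((\<lambda>z. norm (pders S bs f z)) ` S)" if "bs \<in> ?I" for bs
    using that assms Ck_on_pders_continuous[OF assms(2), of bs]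
    by (intro bounded_imp_bdd_above compact_imp_bounded compact_continuous_image continuous_on_norm) auto
  then show ?thesis unfolding eq by (subst bdd_above_UN) (auto intro: finite_lists_length_le)
qed

lemma Ck_bound_Ck_norm:
  fixes f :: "'a::euclidean_space \<Rightarrow> 'b::real_normed_vector"
  assumes "Ck_on k S f" "bdd_above (Ck_values k S f)"
  shows "Ck_bound k S f (Ck_norm k S f) 1"
proof (rule Ck_boundI[OF assms(1)])
  fix bs :: "'a list" and z assume "set bs \<subseteq> Basis" "length bs \<le> k" "z \<in> S"
  then have "norm (pders S bs f z) \<in> Ck_values k S f" by (auto simp: Ck_values_def)
  then show "norm (pders S bs f z) \<le> Ck_norm k S f"
    unfolding Ck_norm_def using assms(2) by (rule cSup_upper)
qed

lemma Ck_bound_compact: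
  assumes "compact S" "Ck_on k S f" "j \<le> k"
  shows "Ck_bound j S f (Ck_norm j S f) 1"
proof -
  have "Ck_on j S f"
    using assms(2,3) by (metis Ck_boundI Ck_bound_imp_Ck_on Ck_bound_le Ck_bound_Ck_norm bdd_above_Ck_values assms(1))
  then show ?thesis using bdd_above_Ck_values[OF assms(1)] Ck_bound_Ck_norm by blast
qed

lemma Ck_norm_le:
  assumes "Ck_bound k S f X G" "1 \<le> G" "0 \<le> X" "S \<noteq> {}"
  shows "Ck_norm k S f \<le> X * G ^ k"
  unfolding Ck_norm_def
proof (rule cSup_least)
  have "(norm (f (SOME z. z \<in> S))) \<in> Ck_values k S f"
    using assms(4) unfolding Ck_values_def
    by (intro CollectI exI[of _ "[]"] exI[of _ "SOME z. z \<in> S"]) (auto simp: some_in_eq)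
  then show "Ck_values k S f \<noteq> {}" by blast
next
  fix x assume "x \<in> Ck_values k S f"
  then obtain bs z where *: "x = norm (pders S bs f z)" "set bs \<subseteq> Basis" "length bs \<le> k" "z \<in> S"
    by (auto simp: Ck_values_def)
  have "x \<le> X * G ^ length bs" using Ck_bound_pders[OF assms(1)] * by simp
  also have "\<dots> \<le> X * G ^ k" using assms * by (intro mult_left_mono power_increasing) auto
  finally show "x \<le> X * G ^ k" .
qed

section \<open>Neural networks\<close>

lemma cell_eq_cbox: "(cell :: (real ^ 'n::finite) set) = cbox 0 (\<chi> i. 2)"
  by (auto simp: cell_def mem_box_cart)

lemma Om_eq_cbox: "(Om T :: 'n::finite spacetime set) = cbox (0, 0) (\<chi> i. 2, T)"
  by (simp add: Om_def cell_eq_cbox cbox_Pair_eq)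

lemma compact_Om: "compact (Om T)" and convex_Om: "convex (Om T)"
  by (simp_all add: Om_eq_cbox compact_cbox convex_box)

lemma Om_nonempty: "0 < T \<Longrightarrow> Om T \<noteq> ({} :: 'n::finite spacetime set)"
proof -
  assume "0 < T"
  then have "(0, 0) \<in> (Om T :: 'n spacetime set)" by (simp add: Om_def cell_def)
  then show ?thesis by blast
qed

lemma thick_Om: "0 < T \<Longrightarrow> thick (Om T :: 'n::finite spacetime set)"
  unfolding Om_eq_cbox by (rule thick_cbox) (auto simp: Basis_prod_def Basis_vec_def inner_axis)

lemma Ck_bound_diff:
  assumes "thick S" "Ck_bound k S f X G" "Ck_bound k S g Y G"
  shows "Ck_bound k S (\<lambda>z. f z - g z) (X + Y) G"
proof -
  have "Ck_bound k S (\<lambda>z. - g z) (Y * 1) G"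
    using Ck_bound_linear[OF assms(1) bounded_linear_minus[OF bounded_linear_ident], of 1] assms(3) by auto
  from Ck_bound_add[OF assms(1,2) this] show ?thesis by simp
qed

lemma Ck_bound_component:
  fixes f :: "'a::euclidean_space \<Rightarrow> real ^ 'n"
  assumes "thick S" "Ck_bound k S f X G"
  shows "Ck_bound k S (\<lambda>z. f z $ j) X G"
  using Ck_bound_linear[OF assms(1) bounded_linear_vec_nth[of j] _ _ assms(2), of 1]
  by (simp add: component_le_norm_cart)

lemma Ck_bound_vector:
  fixes f :: "'a::euclidean_space \<Rightarrow> real ^ 'n::finite"
  assumes "thick S" "\<And>j. Ck_bound k S (\<lambda>z. f z $ j) X G" "0 \<le> G"
  shows "Ck_bound k S f (real CARD('n) * X) G"
proof -
  have "Ck_bound k S (\<lambda>z. (f z $ j) *\<^sub>R axis j 1 :: real ^ 'n) (X * 1) G" for j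
    by (rule Ck_bound_linear[OF assms(1) bounded_linear_scaleR_left _ _ assms(2)]) (auto simp: norm_axis_1)
  then have "Ck_bound k S (\<lambda>z. \<Sum>j\<in>UNIV. (f z $ j) *\<^sub>R axis j 1 :: real ^ 'n) (\<Sum>j\<in>(UNIV::'n set). X) G"
    using assms by (intro Ck_bound_sum) auto
  moreover have "(\<Sum>j\<in>UNIV. (v $ j) *\<^sub>R axis j 1) = v" for v :: "real ^ 'n"
    using basis_expansion[of v] by (simp add: scalar_mult_eq_scaleR)
  ultimately show ?thesis by simp
qed

lemma Ck_bound_linear_function:
  fixes h :: "'a::euclidean_space \<Rightarrow> 'b::real_normed_vector"
  assumes "thick S" "bounded_linear h" "\<And>z. z \<in> S \<Longrightarrow> norm (h z) \<le> X" "\<And>b. b \<in> Basis \<Longrightarrow> norm (h b) \<le> X"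
  shows "Ck_bound k S h X 1"
proof (cases k)
  case 0
  then show ?thesis using assms linear_continuous_on by auto
next
  case (Suc j)
  have "Ck_bound j S (pder S b h) (X * 1) 1" if "b \<in> Basis" for b
    using that assms
    by (subst Ck_bound_cong[OF pder_eqI[OF assms(1) _ bounded_linear.has_derivative[OF assms(2) has_derivative_ident]]])
      (auto intro: Ck_bound_const)
  moreover have "h differentiable_on S"
    using bounded_linear.has_derivative[OF assms(2) has_derivative_ident]
    by (auto simp: differentiable_on_def differentiable_def)
  ultimately show ?thesis using Suc assms by simp
qed

lemma Ck_bound_affine_map:
  assumes "thick S" "\<And>i. i < in_dim A \<Longrightarrow> Ck_bound k S (y i) X G" "0 \<le> X" "0 \<le> G"
    and "in_dim A \<le> W" "\<bar>bias A i\<bar> \<le> R" "\<And>j. j < in_dim A \<Longrightarrow> \<bar>weight A i j\<bar> \<le> R"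
  shows "Ck_bound k S (\<lambda>z. affine_map A (\<lambda>i. y i z) i) (real W * R * X + R) G"
proof -
  have R: "0 \<le> R" using assms(6) by linarith
  have "Ck_bound k S (\<lambda>z. weight A i j * y j z) (X * R) G" if "j < in_dim A" for j
    using that assms R
    by (intro Ck_bound_linear[OF assms(1) bounded_linear_mult_right])
      (auto simp: abs_mult mult.commute[of "\<bar>weight A i j\<bar>"] intro!: mult_left_mono)
  then have "Ck_bound k S (\<lambda>z. \<Sum>j<in_dim A. weight A i j * y j z) (\<Sum>j<in_dim A. X * R) G"
    using assms by (intro Ck_bound_sum) auto
  then have "Ck_bound k S (\<lambda>z. affine_map A (\<lambda>i. y i z) i) (real (in_dim A) * (X * R) + R) G"
    unfolding affine_map_def using assms by (intro Ck_bound_add Ck_bound_const) auto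
  moreover have "real (in_dim A) * (X * R) \<le> real W * (X * R)"
    using assms R by (intro mult_right_mono) auto
  ultimately show ?thesis
    using assms(3,4) R by (elim Ck_bound_mono) (auto simp: mult_ac)
qed

text \<open>Each layer multiplies the rate by \<open>P\<close>; the amplitude is reset to \<open>X\<close> because \<open>\<sigma>\<close> is bounded.\<close>

lemma Ck_bound_nn_eval:
  fixes \<sigma> :: "real \<Rightarrow> real"
  assumes S: "thick S" and \<sigma>: "Ck_bound k UNIV \<sigma> s 1" "0 \<le> s"
    and X: "2 ^ (k * k) * s \<le> X" "0 \<le> X" and P: "real W * R * X + R \<le> P" "1 \<le> P" and "0 \<le> R"
  shows "\<theta> \<noteq> [] \<Longrightarrow> (\<forall>k. Suc k < length \<theta> \<longrightarrow> out_dim (\<theta> ! k) = in_dim (\<theta> ! Suc k)) \<Longrightarrow>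
    (\<forall>A\<in>set \<theta>. in_dim A \<le> W \<and> out_dim A \<le> W \<and>
        (\<forall>i<out_dim A. \<bar>bias A i\<bar> \<le> R \<and> (\<forall>j<in_dim A. \<bar>weight A i j\<bar> \<le> R))) \<Longrightarrow>
    (\<And>i. i < in_dim (hd \<theta>) \<Longrightarrow> Ck_bound k S (y i) X G) \<Longrightarrow> 1 \<le> G \<Longrightarrow> j < out_dim (last \<theta>) \<Longrightarrow>
    Ck_bound k S (\<lambda>z. nn_eval \<sigma> \<theta> (\<lambda>i. y i z) j) P (P ^ (length \<theta> - 1) * G)"
proof (induction \<theta> arbitrary: y G)
  case (Cons A As)
  have layer: "Ck_bound k S (\<lambda>z. affine_map A (\<lambda>i. y i z) i) P G" if "i < out_dim A" for i
    by (rule Ck_bound_mono[OF Ck_bound_affine_map[OF S, where X = X and R = R and W = W and G = G]])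
      (use that Cons.prems X P \<open>0 \<le> R\<close> in auto)
  show ?case
  proof (cases As)
    case Nil
    then show ?thesis using layer Cons.prems by simp
  next
    case (Cons B Bs)
    let ?y = "\<lambda>i z. \<sigma> (affine_map A (\<lambda>i. y i z) i)"
    have act: "Ck_bound k S (?y i) X (P * G)" if "i < out_dim A" for i
      by (rule Ck_bound_mono[OF Ck_bound_compose[OF S \<sigma> layer[OF that]]])
        (use X P \<sigma> Cons.prems in auto)
    have *: "out_dim A = in_dim B"
      using Cons.prems(2) \<open>As = B # Bs\<close> by (metis Suc_less_eq length_Cons nth_Cons_0 nth_Cons_Suc zero_less_Suc)
    have "1 * 1 \<le> P * G" using P Cons.prems by (intro mult_mono) auto
    then have "Ck_bound k S (\<lambda>z. nn_eval \<sigma> As (\<lambda>i. ?y i z) j) P (P ^ (length As - 1) * (P * G))"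
      using act Cons.prems \<open>As = B # Bs\<close> * by (intro Cons.IH) auto
    then show ?thesis using \<open>As = B # Bs\<close> by (simp add: mult_ac)
  qed
qed simp

text \<open>\<open>?X\<close> dominates the inputs, whose coordinates on \<open>Om T\<close> are at
  most 2 or \<open>T\<close>, and the output of every activated layer. An affine layer turns
  amplitude \<open>?X\<close> into \<open>W * R * ?X + R\<close>; in \<open>P\<close> the factor 2
  pays for the bias and \<open>max 1 R\<close> ensures \<open>1 \<le> P\<close>. The width is
  positive because the input dimension is \<open>d + 1\<close>.\<close>

lemma networks_Ck_bound:
  fixes \<sigma> :: "real \<Rightarrow> real" and T s R :: real
  assumes "0 < T" "Ck_bound k UNIV \<sigma> s 1" "0 \<le> s" "\<theta> \<in> networks CARD('n::finite) L W R" "0 < R"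
  defines "P \<equiv> 2 * real W * max 1 R * max (max 2 T) (2 ^ (k * k) * s)"
  shows "Ck_bound k (Om T) (nn_fun \<sigma> \<theta> :: 'n vfield) (real CARD('n) * P) (P ^ (L - 1))"
    and "1 \<le> W" and "1 \<le> L" and "1 \<le> P"
proof -
  let ?X = "max (max 2 T) (2 ^ (k * k) * s)" and ?R = "max 1 R"
  have \<theta>: "\<theta> \<noteq> []" "length \<theta> \<le> L" "in_dim (hd \<theta>) = CARD('n) + 1" "out_dim (last \<theta>) = CARD('n)"
    "\<forall>k. Suc k < length \<theta> \<longrightarrow> out_dim (\<theta> ! k) = in_dim (\<theta> ! Suc k)"
    "\<forall>A\<in>set \<theta>. in_dim A \<le> W \<and> out_dim A \<le> W \<and>
        (\<forall>i<out_dim A. \<bar>bias A i\<bar> \<le> R \<and> (\<forall>j<in_dim A. \<bar>weight A i j\<bar> \<le> R))"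
    using assms(4) by (auto simp: networks_def)
  have "hd \<theta> \<in> set \<theta>" using \<theta>(1) by simp
  then have "in_dim (hd \<theta>) \<le> W" using \<theta>(6) by blast
  then show W: "1 \<le> W" using \<theta> by simp
  show "1 \<le> L" using \<theta> by (cases \<theta>) auto
  have "1 * 1 * 1 \<le> real W * ?R * ?X" using W by (intro mult_mono) auto
  then show P: "1 \<le> P" by (simp add: P_def)
  have "?R * 1 \<le> ?R * (real W * ?X)"
  proof (rule mult_left_mono)
    have "1 * 1 \<le> real W * ?X" using W by (intro mult_mono) auto
    then show "1 \<le> real W * ?X" by simp
  qed auto
  then have P2: "real W * ?R * ?X + ?R \<le> P" by (simp add: P_def algebra_simps)
  let ?y = "\<lambda>i (z::'n spacetime). if i < CARD('n) then fst z $ from_nat_into UNIV i else snd z"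
  have lin: "bounded_linear (?y i)" for i
    by (cases "i < CARD('n)")
      (auto intro: bounded_linear_snd bounded_linear_compose[OF bounded_linear_vec_nth bounded_linear_fst])
  have coord: "Ck_bound k (Om T) (?y i) ?X 1" for i
  proof (rule Ck_bound_linear_function[OF thick_Om[OF assms(1)] lin])
    show "norm (?y i z) \<le> ?X" if "z \<in> Om T" for z
      using that by (auto simp: Om_def cell_def le_max_iff_disj)
    show "norm (?y i b) \<le> ?X" if "b \<in> Basis" for b
      using that component_le_norm_cart[of "fst b" "from_nat_into UNIV i"]
      by (auto simp: Basis_prod_def le_max_iff_disj)
  qed
  have "Ck_bound k (Om T) (\<lambda>z. (nn_fun \<sigma> \<theta> :: 'n vfield) z $ j) P (P ^ (L - 1))" for j
  proof -
    have "to_nat_on UNIV j < CARD('n)"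
      using bij_betwE[OF to_nat_on_finite[OF finite]] by blast
    then have "Ck_bound k (Om T) (\<lambda>z. nn_eval \<sigma> \<theta> (\<lambda>i. ?y i z) (to_nat_on UNIV j)) P (P ^ (length \<theta> - 1) * 1)"
      using \<theta> P P2 coord assms(2,3)
      by (intro Ck_bound_nn_eval[OF thick_Om[OF assms(1)], where X = ?X and R = ?R and W = W]) (fastforce simp: le_max_iff_disj)+
    \<comment> \<open>A network may have fewer than \<open>L\<close> layers; since
      \<open>1 \<le> P\<close> the exponent can be raised.\<close>
    moreover have "P ^ (length \<theta> - 1) \<le> P ^ (L - 1)"
      using P \<theta> by (intro power_increasing) auto
    ultimately have "Ck_bound k (Om T) (\<lambda>z. nn_eval \<sigma> \<theta> (\<lambda>i. ?y i z) (to_nat_on UNIV j)) P (P ^ (L - 1))"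
      using P by (elim Ck_bound_mono) auto
    then show ?thesis by (simp add: nn_fun_def split_beta)
  qed
  then show "Ck_bound k (Om T) (nn_fun \<sigma> \<theta> :: 'n vfield) (real CARD('n) * P) (P ^ (L - 1))"
    using P by (intro Ck_bound_vector thick_Om[OF assms(1)]) auto
qed

section \<open>Norms of networks, differences and components\<close>

lemma Ck_norm_nonneg:
  assumes "Ck_bound k S f (Ck_norm k S f) 1" "S \<noteq> {}"
  shows "0 \<le> Ck_norm k S f"
  using assms Ck_bound_norm[OF assms(1)] by (metis equals0I norm_ge_zero order_trans)

text \<open>Amplitude \<open>P\<close> and rate \<open>P ^ (L - 1)\<close> give \<open>P\<close> to
  the power \<open>1 + (L - 1) * k\<close> for a derivative of order \<open>k\<close>; this exponent
  is at most \<open>k * L\<close> since \<open>1 \<le> k\<close>.\<close>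

lemma networks_Ck_norm:
  fixes \<sigma> :: "real \<Rightarrow> real" and T s R :: real
  assumes "0 < T" "Ck_bound k UNIV \<sigma> s 1" "0 \<le> s" "\<theta> \<in> networks CARD('n::finite) L W R" "0 < R" "1 \<le> k"
  defines "P \<equiv> 2 * real W * max 1 R * max (max 2 T) (2 ^ (k * k) * s)"
  shows "Ck_norm k (Om T) (nn_fun \<sigma> \<theta> :: 'n vfield) \<le> real CARD('n) * P ^ (k * L)"
proof -
  note N = networks_Ck_bound[OF assms(1-5), folded P_def]
  have "Ck_norm k (Om T) (nn_fun \<sigma> \<theta> :: 'n vfield) \<le> real CARD('n) * P * (P ^ (L - 1)) ^ k"
    by (rule Ck_norm_le[OF N(1)]) (use N Om_nonempty[OF assms(1)] in auto)
  also have "\<dots> = real CARD('n) * P ^ (1 + (L - 1) * k)"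
    by (simp add: power_mult)
  also have "\<dots> \<le> real CARD('n) * P ^ (k * L)"
  proof -
    have "1 + (L - 1) * k \<le> k * L"
      using N(3) assms(6) by (cases L) (auto simp: algebra_simps)
    then show ?thesis using N(4) by (intro mult_left_mono power_increasing) auto
  qed
  finally show ?thesis .
qed

lemma Ck_norm_mono_order:
  assumes "compact S" "S \<noteq> {}" "Ck_on k S f" "j \<le> k"
  shows "Ck_norm j S f \<le> Ck_norm k S f"
  using Ck_norm_le[OF Ck_bound_le[OF assms(4) Ck_bound_compact[OF assms(1,3)]]] assms
    Ck_norm_nonneg[OF Ck_bound_compact[OF assms(1,3)]] by simp

lemma Ck_norm_diff_le:
  assumes "compact S" "S \<noteq> {}" "thick S" "Ck_on k S f" "Ck_on k S g"
  shows "Ck_norm k S (\<lambda>z. f z - g z) \<le> Ck_norm k S f + Ck_norm k S g"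
  using Ck_norm_le[OF Ck_bound_diff[OF assms(3) Ck_bound_compact[OF assms(1,4)] Ck_bound_compact[OF assms(1,5)]]]
    Ck_norm_nonneg[OF Ck_bound_compact[OF assms(1,4)]] Ck_norm_nonneg[OF Ck_bound_compact[OF assms(1,5)]] assms(2)
  by simp

lemma Ck_on_diff:
  assumes "compact S" "thick S" "Ck_on k S f" "Ck_on k S g"
  shows "Ck_on k S (\<lambda>z. f z - g z)"
  using Ck_bound_imp_Ck_on[OF Ck_bound_diff[OF assms(2) Ck_bound_compact[OF assms(1,3)] Ck_bound_compact[OF assms(1,4)]]]
  by simp

lemma Ck_bound_component_norm:
  fixes f :: "'n::finite vfield"
  assumes "0 < T" "Ck_on k (Om T) f"
  shows "Ck_bound k (Om T) (\<lambda>z. f z $ j) (Ck_norm k (Om T) (\<lambda>z. f z $ j)) 1"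
  using Ck_bound_compact[OF compact_Om Ck_bound_imp_Ck_on[OF Ck_bound_component[OF thick_Om[OF assms(1)]
    Ck_bound_compact[OF compact_Om assms(2)]]]] by blast

lemma comp_norm_le:
  fixes f :: "'n::finite vfield"
  assumes "0 < T" "Ck_on k (Om T) f"
  shows "comp_norm k T f \<le> Ck_norm k (Om T) f"
proof -
  note B = Ck_bound_compact[OF compact_Om assms(2) order_refl]
  have "Ck_norm k (Om T) (\<lambda>z. f z $ j) \<le> Ck_norm k (Om T) f" for j
    using Ck_norm_le[OF Ck_bound_component[OF thick_Om[OF assms(1)] B]] Om_nonempty[OF assms(1)]
      Ck_norm_nonneg[OF B] by auto
  then show ?thesis unfolding comp_norm_def by (subst Max_le_iff) auto
qed

lemma Ck_norm_component_le: "Ck_norm k (Om T) (\<lambda>z. f z $ j) \<le> comp_norm k T f"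
  unfolding comp_norm_def by (rule Max_ge) auto

lemma comp_norm_nonneg:
  fixes f :: "'n::finite vfield"
  assumes "0 < T" "Ck_on k (Om T) f"
  shows "0 \<le> comp_norm k T f"
  using Ck_norm_nonneg[OF Ck_bound_component_norm[OF assms]] Om_nonempty[OF assms(1)]
    Ck_norm_component_le order_trans by metis

text \<open>The theorem measures some constants by norms of components, the energy argument uses
  norms of vector fields; up to the factor \<open>d\<close> they are interchangeable.\<close>

lemma Ck_norm_le_comp_norm:
  fixes f :: "'n::finite vfield"
  assumes "0 < T" "Ck_on k (Om T) f"
  shows "Ck_norm k (Om T) f \<le> real CARD('n) * comp_norm k T f"
proof -
  have "0 \<le> Ck_norm k (Om T) (\<lambda>z. f z $ j)" for j
    using Ck_norm_nonneg[OF Ck_bound_component_norm[OF assms] Om_nonempty[OF assms(1)]] .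
  then have "Ck_bound k (Om T) (\<lambda>z. f z $ j) (comp_norm k T f) 1" for j
    using Ck_bound_mono[OF Ck_bound_component_norm[OF assms] Ck_norm_component_le] by simp
  then have "Ck_bound k (Om T) f (real CARD('n) * comp_norm k T f) 1"
    by (intro Ck_bound_vector thick_Om[OF assms(1)]) auto
  from Ck_norm_le[OF this] show ?thesis using comp_norm_nonneg[OF assms] Om_nonempty[OF assms(1)] by simp
qed

text \<open>Converts the layerwise bound into the required shape by W^2 \<le> W^3 and R^2 * R0^(k-2)
  \<le> R^k. The lower bound \<open>R0\<close> pays for the surplus powers of \<open>R\<close>;
  \<open>a\<close> stands for the numerical factors and the norm of \<sigma>.\<close>

lemma power_bound_WR:
  fixes c1 a R0 :: real
  assumes "0 < c1" "0 < a" "0 < R0" "2 \<le> k"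
  shows "\<exists>c>0. \<forall>W::nat. \<forall>R\<ge>R0. 1 \<le> W \<longrightarrow> (c1 * real W * R) ^ (2 * (k * L)) \<le> c * (a * real W ^ 3 * R ^ k) ^ (k * L)"
proof (intro exI[of _ "(c1\<^sup>2 / (a * R0 ^ (k - 2))) ^ (k * L)"] conjI allI impI)
  show "0 < (c1\<^sup>2 / (a * R0 ^ (k - 2))) ^ (k * L)" using assms by simp
  fix W :: nat and R :: real assume "R0 \<le> R" "1 \<le> W"
  have "real W ^ 2 \<le> real W ^ 3" using \<open>1 \<le> W\<close> by (intro power_increasing) auto
  moreover have "R ^ 2 * R0 ^ (k - 2) \<le> R ^ k"
  proof -
    have "R ^ 2 * R0 ^ (k - 2) \<le> R ^ 2 * R ^ (k - 2)"
      using \<open>R0 \<le> R\<close> assms by (intro mult_left_mono power_mono) auto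
    also have "\<dots> = R ^ k"
      using le_add_diff_inverse[OF assms(4)] by (metis power_add)
    finally show ?thesis .
  qed
  ultimately have "real W ^ 2 * (R ^ 2 * R0 ^ (k - 2)) \<le> real W ^ 3 * R ^ k"
    using assms \<open>R0 \<le> R\<close> by (intro mult_mono) auto
  then have "(c1 * real W * R)\<^sup>2 * (a * R0 ^ (k - 2)) \<le> c1\<^sup>2 * (a * real W ^ 3 * R ^ k)"
    using mult_left_mono[of _ _ "c1\<^sup>2 * a"] assms by (simp add: power_mult_distrib mult_ac)
  then have "(c1 * real W * R)\<^sup>2 \<le> c1\<^sup>2 / (a * R0 ^ (k - 2)) * (a * real W ^ 3 * R ^ k)"
    using assms by (simp add: pos_le_divide_eq mult_ac)
  then have "((c1 * real W * R)\<^sup>2) ^ (k * L) \<le> (c1\<^sup>2 / (a * R0 ^ (k - 2)) * (a * real W ^ 3 * R ^ k)) ^ (k * L)"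
    by (rule power_mono) auto
  then show "(c1 * real W * R) ^ (2 * (k * L)) \<le> (c1\<^sup>2 / (a * R0 ^ (k - 2))) ^ (k * L) * (a * real W ^ 3 * R ^ k) ^ (k * L)"
    unfolding power_mult[of _ 2] power_mult_distrib[symmetric] .
qed

section \<open>Integration on boxes\<close>

definition coord_upd :: "'a::euclidean_space \<Rightarrow> real \<Rightarrow> 'a \<Rightarrow> 'a" where
  "coord_upd b v z = z + (v - z \<bullet> b) *\<^sub>R b"

lemma inner_coord_upd:
  "b \<in> Basis \<Longrightarrow> i \<in> Basis \<Longrightarrow> coord_upd b v z \<bullet> i = (if i = b then v else z \<bullet> i)"
  by (auto simp: coord_upd_def inner_simps inner_Basis)

lemma coord_upd_in_cbox:
  assumes "b \<in> Basis" "z \<in> cbox l u" "l \<bullet> b \<le> v" "v \<le> u \<bullet> b"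
  shows "coord_upd b v z \<in> cbox l u"
  using assms by (auto simp: mem_box inner_coord_upd)

lemma continuous_on_coord_upd [continuous_intros]:
  assumes "continuous_on S f" "continuous_on S g"
  shows "continuous_on S (\<lambda>x. coord_upd b (f x) (g x))"
  unfolding coord_upd_def by (intro continuous_intros assms)

lemma prod_Basis_Pair:
  fixes l u :: "'a::euclidean_space" and l' u' :: real
  shows "(\<Prod>B\<in>Basis. ((u, u') - (l, l')) \<bullet> B) = (\<Prod>i\<in>Basis. (u - l) \<bullet> i) * (u' - l')"
proof -
  have "(\<Prod>B\<in>Basis. ((u, u') - (l, l')) \<bullet> B) =
    (\<Prod>B\<in>(\<lambda>i. (i, 0)) ` Basis. ((u, u') - (l, l')) \<bullet> B) * (\<Prod>B\<in>(\<lambda>i. (0, i)) ` Basis. ((u, u') - (l, l')) \<bullet> B)"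
    unfolding Basis_prod_def by (intro prod.union_disjoint) auto
  also have "\<dots> = (\<Prod>i\<in>Basis. (u - l) \<bullet> i) * (u' - l')"
    by (subst (1 2) prod.reindex) (auto simp: inj_on_def)
  finally show ?thesis .
qed

text \<open>Exchanging one coordinate with an extra real variable preserves the measure. This replaces
  Fubini's theorem in a single coordinate of an abstract Euclidean space.\<close>

lemma distr_lborel_exchange:
  fixes b :: "'a::euclidean_space"
  assumes b: "b \<in> Basis"
  shows "distr lborel borel (\<lambda>p::'a \<times> real. (coord_upd b (snd p) (fst p), fst p \<bullet> b)) = lborel"
proof (rule lborel_eqI[symmetric])
  let ?T = "\<lambda>p::'a \<times> real. (coord_upd b (snd p) (fst p), fst p \<bullet> b)"
  fix L U :: "'a \<times> real" assume le: "\<And>i. i \<in> Basis \<Longrightarrow> L \<bullet> i \<le> U \<bullet> i"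
  obtain l l' u u' where LU: "L = (l, l')" "U = (u, u')" by (metis surj_pair)
  have le1: "l \<bullet> i \<le> u \<bullet> i" if "i \<in> Basis" for i using le[of "(i, 0)"] that by (simp add: LU Basis_prod_def)
  have le2: "l' \<le> u'" using le[of "(0, 1)"] by (simp add: LU Basis_prod_def)
  have [measurable]: "?T \<in> borel \<rightarrow>\<^sub>M borel"
    by (intro borel_measurable_continuous_onI continuous_intros)
  \<comment> \<open>The exchange swaps the \<open>b\<close>-edge with the edge of the extra
    variable, so a box pulls back to a box of the same volume.\<close>
  have eq: "?T -` box L U = box (coord_upd b l' l, l \<bullet> b) (coord_upd b u' u, u \<bullet> b)"
    using b unfolding LU by (auto simp: mem_box Basis_prod_def inner_coord_upd split: if_splits)
  have pr: "(\<Prod>i\<in>Basis. (coord_upd b u' u - coord_upd b l' l) \<bullet> i) * (u \<bullet> b - l \<bullet> b)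
      = (\<Prod>i\<in>Basis. (u - l) \<bullet> i) * (u' - l')"
  proof -
    have "(\<Prod>i\<in>Basis - {b}. (coord_upd b u' u - coord_upd b l' l) \<bullet> i) = (\<Prod>i\<in>Basis - {b}. (u - l) \<bullet> i)"
      using b by (intro prod.cong) (auto simp: inner_diff_left inner_coord_upd)
    then show ?thesis
      using b by (simp add: prod.remove[OF finite_Basis b] inner_diff_left inner_coord_upd)
  qed
  have "emeasure (distr lborel borel ?T) (box L U) = emeasure lborel (?T -` box L U)"
    by (simp add: emeasure_distr)
  also have "\<dots> = ennreal (\<Prod>i\<in>Basis. ((coord_upd b u' u, u \<bullet> b) - (coord_upd b l' l, l \<bullet> b)) \<bullet> i)"
    unfolding eq
    by (rule emeasure_lborel_box)
      (use b le1 le2 in \<open>auto simp: Basis_prod_def inner_coord_upd\<close>)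
  also have "\<dots> = ennreal (\<Prod>i\<in>Basis. (U - L) \<bullet> i)"
    unfolding LU prod_Basis_Pair pr ..
  finally show "emeasure (distr lborel borel ?T) (box L U) = ennreal (\<Prod>i\<in>Basis. (U - L) \<bullet> i)" .
qed simp

lemma integral_cbox_lborel:
  fixes h :: "'a::euclidean_space \<Rightarrow> real"
  assumes "continuous_on (cbox l u) h"
  shows "integral (cbox l u) h = (\<integral>z. indicator (cbox l u) z *\<^sub>R h z \<partial>lborel)"
  using set_borel_integral_eq_integral(2)[of "cbox l u" h] borel_integrable_compact[OF compact_cbox assms]
  by (simp add: set_integrable_def set_lebesgue_integral_def)

text \<open>Let the extra variable range over the \<open>b\<close>-edge itself: the exchange then
  maps \<open>?B\<close> onto itself. Integrating the extra variable out before the exchange gives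
  the left side, after it the right side.\<close>

lemma integral_average_coord:
  fixes h :: "'a::euclidean_space \<Rightarrow> real"
  assumes b: "b \<in> Basis" and h: "continuous_on (cbox l u) h" and le: "l \<bullet> b \<le> u \<bullet> b"
  shows "(u \<bullet> b - l \<bullet> b) * integral (cbox l u) h =
    integral (cbox l u) (\<lambda>z. integral {l \<bullet> b..u \<bullet> b} (\<lambda>s. h (coord_upd b s z)))"
proof -
  let ?T = "\<lambda>p::'a \<times> real. (coord_upd b (snd p) (fst p), fst p \<bullet> b)"
  let ?B = "cbox (l, l \<bullet> b) (u, u \<bullet> b)"
  have cont1: "continuous_on ?B (\<lambda>p. h (fst p))"
    by (rule continuous_on_compose2[OF h]) (auto intro: continuous_intros simp: cbox_Pair_eq)
  have cont2: "continuous_on ?B (\<lambda>p. h (coord_upd b (snd p) (fst p)))"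
    by (rule continuous_on_compose2[OF h])
      (auto intro!: continuous_intros coord_upd_in_cbox[OF b] simp: cbox_Pair_eq)
  have [measurable]: "?T \<in> borel \<rightarrow>\<^sub>M borel"
    by (intro borel_measurable_continuous_onI continuous_intros)
  have meas: "(\<lambda>p. indicator ?B p *\<^sub>R h (fst p)) \<in> borel_measurable borel"
    by (rule borel_measurable_continuous_on_indicator[OF _ cont1]) simp
  have "(u \<bullet> b - l \<bullet> b) * integral (cbox l u) h = integral (cbox l u) (\<lambda>z. integral (cbox (l \<bullet> b) (u \<bullet> b)) (\<lambda>s. h z))"
    using le by (simp add: integral_mult_left mult.commute)
  also have "\<dots> = integral ?B (\<lambda>p. h (fst p))"
    using integral_prod_continuous[OF cont1] by simp
  also have "\<dots> = (\<integral>p. indicator ?B p *\<^sub>R h (fst p) \<partial>lborel)"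
    by (rule integral_cbox_lborel[OF cont1])
  also have "\<dots> = (\<integral>p. indicator ?B p *\<^sub>R h (fst p) \<partial>distr lborel borel ?T)"
    by (simp add: distr_lborel_exchange[OF b])
  also have "\<dots> = (\<integral>p. indicator ?B (?T p) *\<^sub>R h (fst (?T p)) \<partial>lborel)"
    by (rule integral_distr[OF _ meas]) simp
  also have "\<dots> = (\<integral>p. indicator ?B p *\<^sub>R h (coord_upd b (snd p) (fst p)) \<partial>lborel)"
  proof (rule Bochner_Integration.integral_cong[OF refl])
    fix p :: "'a \<times> real"
    have "?T p \<in> ?B \<longleftrightarrow> p \<in> ?B"
      using b by (cases p) (auto simp: cbox_Pair_eq mem_box inner_coord_upd split: if_splits)
    then show "indicator ?B (?T p) *\<^sub>R h (fst (?T p)) = indicator ?B p *\<^sub>R h (coord_upd b (snd p) (fst p))"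
      by (simp add: indicator_def)
  qed
  also have "\<dots> = integral ?B (\<lambda>p. h (coord_upd b (snd p) (fst p)))"
    by (rule integral_cbox_lborel[OF cont2, symmetric])
  also have "\<dots> = integral (cbox l u) (\<lambda>z. integral (cbox (l \<bullet> b) (u \<bullet> b)) (\<lambda>s. h (coord_upd b s z)))"
    using integral_prod_continuous[OF cont2] by simp
  finally show ?thesis by simp
qed

text \<open>After averaging, the inner integrals run along lines in direction \<open>b\<close>,
  where the fundamental theorem of calculus applies. The boundary values stay functions on the whole
  box that are constant in direction \<open>b\<close>; the edge length on the left compensates for
  this.\<close>

lemma integral_partial_derivative:
  fixes p :: "'a::euclidean_space \<Rightarrow> real"
  assumes b: "b \<in> Basis" and le: "l \<bullet> b \<le> u \<bullet> b"
    and D: "\<And>z. z \<in> cbox l u \<Longrightarrow> (p has_derivative D z) (at z within cbox l u)"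
    and c: "continuous_on (cbox l u) (\<lambda>z. D z b)"
  shows "(u \<bullet> b - l \<bullet> b) * integral (cbox l u) (\<lambda>z. D z b) =
    integral (cbox l u) (\<lambda>z. p (coord_upd b (u \<bullet> b) z) - p (coord_upd b (l \<bullet> b) z))"
proof -
  have "((\<lambda>s. D (coord_upd b s z) b) has_integral p (coord_upd b (u \<bullet> b) z) - p (coord_upd b (l \<bullet> b) z)) {l \<bullet> b..u \<bullet> b}"
    if z: "z \<in> cbox l u" for z
  proof (rule fundamental_theorem_of_calculus[OF le])
    fix s assume s: "s \<in> {l \<bullet> b..u \<bullet> b}"
    have 1: "((\<lambda>s. coord_upd b s z) has_derivative (\<lambda>h. h *\<^sub>R b)) (at s within {l \<bullet> b..u \<bullet> b})"
      unfolding coord_upd_def by (auto intro!: derivative_eq_intros)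
    have 2: "(p has_derivative D (coord_upd b s z)) (at (coord_upd b s z) within (\<lambda>s. coord_upd b s z) ` {l \<bullet> b..u \<bullet> b})"
      using coord_upd_in_cbox[OF b z] s by (intro has_derivative_subset[OF D]) auto
    have "((\<lambda>s. p (coord_upd b s z)) has_derivative (\<lambda>h. D (coord_upd b s z) (h *\<^sub>R b))) (at s within {l \<bullet> b..u \<bullet> b})"
      using diff_chain_within[OF 1 2] by (simp add: o_def)
    then show "((\<lambda>s. p (coord_upd b s z)) has_vector_derivative D (coord_upd b s z) b) (at s within {l \<bullet> b..u \<bullet> b})"
      unfolding has_vector_derivative_def
      using linear_scale[OF has_derivative_linear[OF 2]] by (simp add: mult.commute)
  qed
  then have "integral {l \<bullet> b..u \<bullet> b} (\<lambda>s. D (coord_upd b s z) b) = p (coord_upd b (u \<bullet> b) z) - p (coord_upd b (l \<bullet> b) z)"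
    if "z \<in> cbox l u" for z
    using that integral_unique by blast
  then show ?thesis
    unfolding integral_average_coord[OF b c le] by (intro Henstock_Kurzweil_Integration.integral_cong) auto
qed

text \<open>Stands in for the surface measure: the integral over \<open>Om T\<close> of a function
  of \<open>side j v z\<close> is 2, the edge length, times its integral over the face.\<close>

definition side :: "'n \<Rightarrow> real \<Rightarrow> 'n::finite spacetime \<Rightarrow> 'n spacetime" where
  "side j v z = (\<chi> i. if i = j then v else fst z $ i, snd z)"

lemma coord_upd_axis: "coord_upd (axis j 1, 0) v z = side j v z"
proof -
  have "(fst z + (v - fst z $ j) *\<^sub>R axis j 1) $ i = (if i = j then v else fst z $ i)" for i
    by (simp add: axis_def)
  then show ?thesis
    by (cases z) (auto simp: coord_upd_def side_def vec_eq_iff inner_axis)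
qed

lemma coord_upd_time: "coord_upd (0, 1) v z = (fst z, v)"
  by (cases z) (auto simp: coord_upd_def)

lemma side_in_Om: "z \<in> Om T \<Longrightarrow> v \<in> {0..2} \<Longrightarrow> side j v z \<in> Om T"
  by (auto simp: side_def Om_def cell_def)

lemma continuous_on_side: "continuous_on S (side j v)"
  unfolding coord_upd_axis[symmetric] by (intro continuous_intros)

lemma continuous_on_comp_side:
  "continuous_on (Om T) f \<Longrightarrow> v \<in> {0..2} \<Longrightarrow> continuous_on (Om T) (\<lambda>z. f (side j v z))"
  by (rule continuous_on_compose2[OF _ continuous_on_side]) (blast intro: side_in_Om)+

lemma Om_mono: "s \<le> T \<Longrightarrow> Om s \<subseteq> Om T"
  by (auto simp: Om_def)

lemma axis_Basis: "(axis j 1 :: real ^ 'n::finite, 0::real) \<in> Basis"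
  by (auto simp: Basis_prod_def Basis_vec_def)

lemma time_Basis: "(0 :: real ^ 'n::finite, 1::real) \<in> Basis"
  by (auto simp: Basis_prod_def)

lemma integrable_Om:
  fixes f :: "'n::finite spacetime \<Rightarrow> 'b::banach"
  assumes "continuous_on (Om T) f" "s \<le> T"
  shows "f integrable_on (Om s)"
  using continuous_on_subset[OF assms(1) Om_mono[OF assms(2)]] unfolding Om_eq_cbox[of s]
  by (rule integrable_continuous)

lemma has_derivative_inner_dx:
  fixes f g :: "'n::finite vfield"
  assumes "f differentiable_on Om T" "g differentiable_on Om T" "z \<in> Om T"
  shows "((\<lambda>z. f z \<bullet> g z) has_derivative
     (\<lambda>h. f z \<bullet> frechet_derivative g (at z within Om T) h + frechet_derivative f (at z within Om T) h \<bullet> g z))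
     (at z within Om T)"
  by (intro has_derivative_inner has_derivative_frechet assms)

text \<open>The divisor 2 is the edge length of the cell. Derivatives within \<open>Om T\<close> may
  be integrated over the shorter \<open>Om s\<close>, since a derivative within a set is also one
  within its subsets.\<close>

lemma integration_by_parts:
  fixes f g :: "'n::finite vfield"
  assumes T: "0 < s" "s \<le> T" and f: "f differentiable_on Om T" and g: "g differentiable_on Om T"
    and df: "continuous_on (Om T) (dx T j f)" and dg: "continuous_on (Om T) (dx T j g)"
  shows "integral (Om s) (\<lambda>z. f z \<bullet> dx T j g z) =
    integral (Om s) (\<lambda>z. (f (side j 2 z) \<bullet> g (side j 2 z) - f (side j 0 z) \<bullet> g (side j 0 z)) / 2)
    - integral (Om s) (\<lambda>z. dx T j f z \<bullet> g z)"
proof -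
  let ?D = "\<lambda>z h. f z \<bullet> frechet_derivative g (at z within Om T) h + frechet_derivative f (at z within Om T) h \<bullet> g z"
  let ?b = "(axis j 1 :: real ^ 'n, 0::real)" and ?u = "(\<chi> i. 2, s) :: 'n spacetime"
  have D: "?D z ?b = f z \<bullet> dx T j g z + dx T j f z \<bullet> g z" for z
    by (simp add: dx_def pder_def)
  note cont = differentiable_imp_continuous_on[OF f] differentiable_imp_continuous_on[OF g] df dg
  have c: "continuous_on (Om s) (\<lambda>z. ?D z ?b)"
    unfolding D using cont Om_mono[OF T(2)]
    by (intro continuous_intros) (auto intro: continuous_on_subset)
  have "((\<lambda>z. f z \<bullet> g z) has_derivative ?D z) (at z within Om s)" if "z \<in> Om s" for z
    using that Om_mono[OF T(2)] by (intro has_derivative_subset[OF has_derivative_inner_dx[OF f g]]) auto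
  from integral_partial_derivative[of ?b "(0, 0)" ?u "\<lambda>z. f z \<bullet> g z", OF axis_Basis _ this[unfolded Om_eq_cbox[of s]] c[unfolded Om_eq_cbox[of s]]]
  have "2 * integral (Om s) (\<lambda>z. f z \<bullet> dx T j g z + dx T j f z \<bullet> g z) =
     integral (Om s) (\<lambda>z. f (side j 2 z) \<bullet> g (side j 2 z) - f (side j 0 z) \<bullet> g (side j 0 z))"
    by (simp add: D Om_eq_cbox[of s] coord_upd_axis inner_axis)
  moreover have "integral (Om s) (\<lambda>z. f z \<bullet> dx T j g z + dx T j f z \<bullet> g z) =
     integral (Om s) (\<lambda>z. f z \<bullet> dx T j g z) + integral (Om s) (\<lambda>z. dx T j f z \<bullet> g z)"
    by (intro Henstock_Kurzweil_Integration.integral_add integrable_Om[OF _ T(2)] continuous_intros cont)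
  ultimately show ?thesis by simp
qed

definition energy :: "'n::finite vfield \<Rightarrow> real \<Rightarrow> real" where
  "energy e t = integral cell (\<lambda>x. (norm (e (x, t)))\<^sup>2)"

lemma energy_continuous:
  fixes e :: "'n::finite vfield"
  assumes "continuous_on (Om T) e"
  shows "continuous_on {0..T} (energy e)"
proof -
  have "continuous_on ({0..T} \<times> cell) (\<lambda>q. e (snd q, fst q))"
    by (rule continuous_on_compose2[OF assms]) (auto intro!: continuous_intros simp: Om_def)
  then have "continuous_on ({0..T} \<times> cbox 0 (\<chi> i. 2)) (\<lambda>(t, x). (norm (e (x, t)))\<^sup>2)"
    unfolding cell_eq_cbox case_prod_beta by (intro continuous_intros)
  from integral_continuous_on_param[OF this] show ?thesis by (simp add: energy_def[abs_def] cell_eq_cbox)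
qed

lemma integral_energy:
  fixes e :: "'n::finite vfield"
  assumes "continuous_on (Om T) e"
  shows "integral (Om T) (\<lambda>z. (norm (e z))\<^sup>2) = integral {0..T} (energy e)"
proof -
  have c: "continuous_on (Om T) (\<lambda>z. (norm (e z))\<^sup>2)" by (intro continuous_intros assms)
  then have c2: "continuous_on (cbox (0, 0) (\<chi> i. 2, T)) (\<lambda>(x, t). (norm (e (x, t)))\<^sup>2)"
    by (simp add: Om_eq_cbox)
  show ?thesis
    using integral_prod_continuous[OF c[unfolded Om_eq_cbox]] integral_swap_continuous[OF c2]
    by (simp add: Om_eq_cbox energy_def[abs_def] cell_eq_cbox)
qed

lemma integral_time_independent:
  fixes q :: "real ^ 'n::finite \<Rightarrow> real"
  assumes "continuous_on cell q" "0 \<le> s"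
  shows "integral (Om s) (\<lambda>z. q (fst z)) = s * integral cell q"
proof -
  have "continuous_on (cbox (0, 0) (\<chi> i. 2, s)) (\<lambda>z. q (fst z))"
    by (rule continuous_on_compose2[OF assms(1)]) (auto intro: continuous_intros simp: cbox_Pair_eq cell_eq_cbox)
  from integral_prod_continuous[OF this] show ?thesis
    using assms(2) by (simp add: Om_eq_cbox cell_eq_cbox mult.commute)
qed

text \<open>The same formula in the time direction, with edge length \<open>s\<close>. Its boundary
  integrands do not depend on time, so integrating them produces a second factor \<open>s\<close>,
  which cancels.\<close>

lemma energy_difference:
  fixes e :: "'n::finite vfield"
  assumes T: "0 < s" "s \<le> T" and e: "e differentiable_on Om T" and de: "continuous_on (Om T) (dt T e)"
  shows "2 * integral (Om s) (\<lambda>z. e z \<bullet> dt T e z) = energy e s - energy e 0"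
proof -
  let ?D = "\<lambda>z h. e z \<bullet> frechet_derivative e (at z within Om T) h + frechet_derivative e (at z within Om T) h \<bullet> e z"
  let ?b = "(0 :: real ^ 'n, 1::real)" and ?u = "(\<chi> i. 2, s) :: 'n spacetime"
  have D: "?D z ?b = 2 * (e z \<bullet> dt T e z)" for z
    by (simp add: dt_def pder_def inner_commute)
  note cont = differentiable_imp_continuous_on[OF e] de
  have c: "continuous_on (Om s) (\<lambda>z. ?D z ?b)"
    unfolding D using cont Om_mono[OF T(2)]
    by (intro continuous_intros) (auto intro: continuous_on_subset)
  have "((\<lambda>z. e z \<bullet> e z) has_derivative ?D z) (at z within Om s)" if "z \<in> Om s" for z
    using that Om_mono[OF T(2)] by (intro has_derivative_subset[OF has_derivative_inner_dx[OF e e]]) auto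
  from integral_partial_derivative[of ?b "(0, 0)" ?u "\<lambda>z. e z \<bullet> e z", OF time_Basis _ this[unfolded Om_eq_cbox[of s]] c[unfolded Om_eq_cbox[of s]]] T
  have 1: "s * (2 * integral (Om s) (\<lambda>z. e z \<bullet> dt T e z)) =
     integral (Om s) (\<lambda>z. (norm (e (fst z, s)))\<^sup>2 - (norm (e (fst z, 0)))\<^sup>2)"
    by (simp add: D Om_eq_cbox[of s] coord_upd_time power2_norm_eq_inner)
  have c': "continuous_on cell (\<lambda>x. (norm (e (x, t)))\<^sup>2)" if "t \<in> {0..T}" for t
    by (intro continuous_intros continuous_on_compose2[OF cont(1)]) (use that in \<open>auto simp: Om_def\<close>)
  have int: "(\<lambda>x. (norm (e (x, t)))\<^sup>2) integrable_on cell" if "t \<in> {0..T}" for t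
    using c'[OF that] by (simp add: cell_eq_cbox integrable_continuous)
  have "integral (Om s) (\<lambda>z. (norm (e (fst z, s)))\<^sup>2 - (norm (e (fst z, 0)))\<^sup>2) =
      s * integral cell (\<lambda>x. (norm (e (x, s)))\<^sup>2 - (norm (e (x, 0)))\<^sup>2)"
    using T by (intro integral_time_independent continuous_intros c') auto
  also have "\<dots> = s * (energy e s - energy e 0)"
    unfolding energy_def using T by (subst Henstock_Kurzweil_Integration.integral_diff[OF int int]) auto
  finally show ?thesis using 1 T by simp
qed

text \<open>The hypothesis says that \<open>(?\<Phi> t + a / k) * exp (- k * t)\<close> has a
  nonpositive derivative at positive times; one application of the mean value theorem compares its
  values at 0 and \<open>T\<close>.\<close>

lemma gronwall_integral:
  fixes E :: "real \<Rightarrow> real"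
  assumes "0 < T" "0 < k" "0 \<le> a" and E: "continuous_on {0..T} E"
    and le: "\<And>t. t \<in> {0<..T} \<Longrightarrow> E t \<le> a + k * integral {0..t} E"
  shows "integral {0..T} E \<le> a * (T + k * T\<^sup>2 * exp (k * T))"
proof -
  let ?\<Phi> = "\<lambda>t. integral {0..t} E"
  let ?f = "\<lambda>t. (?\<Phi> t + a / k) * exp (- k * t)"
  have d\<Phi>: "(?\<Phi> has_real_derivative E t) (at t within {0..T})" if "t \<in> {0..T}" for t
    using integral_has_real_derivative[OF E that] .
  let ?f' = "\<lambda>t. E t * exp (- k * t) + (?\<Phi> t + a / k) * (exp (- k * t) * - k)"
  have "(?f has_real_derivative ?f' t) (at t within {0..T})" if "t \<in> {0..T}" for t
    using d\<Phi>[OF that] by (auto intro!: derivative_eq_intros)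
  then have "\<exists>t\<in>{0<..<T}. ?f T - ?f 0 = ?f' t * (T - 0)"
    by (intro mvt_simple[OF assms(1)]) (auto simp: has_field_derivative_def)
  then obtain t where t: "0 < t" "t < T" "?f T - ?f 0 = T * ?f' t"
    by (metis diff_zero greaterThanLessThan_iff mult.commute)
  have "E t + (?\<Phi> t + a / k) * - k = E t - (a + k * ?\<Phi> t)"
    using assms(2) by (simp add: field_simps)
  also have "\<dots> \<le> 0" using le[of t] t by auto
  finally have "exp (- k * t) * (E t + (?\<Phi> t + a / k) * - k) \<le> 0"
    by (simp add: mult_nonneg_nonpos)
  then have "T * (exp (- k * t) * (E t + (?\<Phi> t + a / k) * - k)) \<le> 0"
    using assms(1) by (simp add: mult_nonneg_nonpos)
  then have "?f T - ?f 0 \<le> 0" unfolding t(3) by (simp only: algebra_simps)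
  then have "?f T \<le> a / k" by simp
  then have "(?\<Phi> T + a / k) * exp (- k * T) * exp (k * T) \<le> a / k * exp (k * T)"
    by (intro mult_right_mono) auto
  then have "?\<Phi> T + a / k \<le> a / k * exp (k * T)"
    by (simp add: mult.assoc flip: exp_add)
  \<comment> \<open>From 1 - x \<le> exp (- x) follows exp x \<le> 1 + x * exp x; inserted into
    itself this gives exp x \<le> 1 + x + x^2 * exp x. With \<open>x = k * T\<close> it has the form
    stated in the conclusion.\<close>
  moreover have "a / k * exp (k * T) \<le> a / k + a * (T + k * T\<^sup>2 * exp (k * T))"
  proof -
    have "exp (k * T) * (1 - k * T) \<le> exp (k * T) * exp (- (k * T))"
      using exp_ge_add_one_self[of "- (k * T)"] by (intro mult_left_mono) auto
    then have "exp (k * T) \<le> 1 + k * T * exp (k * T)"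
      by (simp add: algebra_simps flip: exp_add)
    moreover from this have "k * T * exp (k * T) \<le> k * T * (1 + k * T * exp (k * T))"
      using assms by (intro mult_left_mono) auto
    ultimately have "exp (k * T) \<le> 1 + k * T * (1 + k * T * exp (k * T))"
      by linarith
    from mult_left_mono[OF this, of "a / k"] show ?thesis
      using assms by (simp add: field_simps power2_eq_square)
  qed
  ultimately show ?thesis by linarith
qed

section \<open>The energy inequality\<close>

lemma Ck_bound_dx:
  "Ck_bound (Suc k) (Om T) f X 1 \<Longrightarrow> Ck_bound k (Om T) (dx T j f) X 1"
  using axis_Basis[of j] by (simp add: dx_def)

lemma Ck_bound_dt:
  "Ck_bound (Suc k) (Om T) f X 1 \<Longrightarrow> Ck_bound k (Om T) (dt T f) X 1"
  for f :: "'n::finite vfield"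
  using time_Basis[where 'n = 'n] by (simp add: dt_def)

lemma Ck_bound_lap:
  fixes f :: "'n::finite vfield"
  assumes "0 < T" "Ck_bound (Suc (Suc k)) (Om T) f X 1"
  shows "Ck_bound k (Om T) (lap T f) (real CARD('n) * X) 1"
proof -
  have "Ck_bound k (Om T) (\<lambda>z. \<Sum>j\<in>UNIV. dx T j (dx T j f) z) (\<Sum>j\<in>(UNIV::'n set). X) 1"
    by (intro Ck_bound_sum thick_Om[OF assms(1)] Ck_bound_dx assms(2)) auto
  then show ?thesis by (simp add: lap_def[abs_def])
qed

lemma Ck_bound_differentiable: "Ck_bound (Suc k) S f X G \<Longrightarrow> f differentiable_on S"
  by simp

lemma dx_diff:
  fixes f g :: "'n::finite vfield"
  assumes "0 < T" "f differentiable_on Om T" "g differentiable_on Om T" "z \<in> Om T"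
  shows "dx T j (\<lambda>z. f z - g z) z = dx T j f z - dx T j g z"
  unfolding dx_def by (rule pder_diff[OF thick_Om[OF assms(1)] assms(2-)])

lemma dt_diff:
  fixes f g :: "'n::finite vfield"
  assumes "0 < T" "f differentiable_on Om T" "g differentiable_on Om T" "z \<in> Om T"
  shows "dt T (\<lambda>z. f z - g z) z = dt T f z - dt T g z"
  unfolding dt_def by (rule pder_diff[OF thick_Om[OF assms(1)] assms(2-)])

lemma dx_cong:
  assumes "\<And>z. z \<in> Om T \<Longrightarrow> f z = g z" "z \<in> Om T"
  shows "dx T j f z = dx T j g z"
  unfolding dx_def using assms by (rule pder_cong)

lemma lap_diff:
  fixes f g :: "'n::finite vfield"
  assumes "0 < T" "Ck_bound 2 (Om T) f X 1" "Ck_bound 2 (Om T) g Y 1" "z \<in> Om T"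
  shows "lap T (\<lambda>z. f z - g z) z = lap T f z - lap T g z"
proof -
  have B: "Ck_bound (Suc 1) (Om T) f X 1" "Ck_bound (Suc 1) (Om T) g Y 1"
    using assms by (simp_all add: numeral_2_eq_2)
  have "dx T j (dx T j (\<lambda>z. f z - g z)) z = dx T j (dx T j f) z - dx T j (dx T j g) z" for j
  proof -
    have "dx T j (dx T j (\<lambda>z. f z - g z)) z = dx T j (\<lambda>z. dx T j f z - dx T j g z) z"
      by (intro dx_cong dx_diff assms Ck_bound_differentiable[OF B(1)] Ck_bound_differentiable[OF B(2)])
    also have "\<dots> = dx T j (dx T j f) z - dx T j (dx T j g) z"
      using Ck_bound_dx[OF B(1), of j] Ck_bound_dx[OF B(2), of j] assms by (intro dx_diff) auto
    finally show ?thesis .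
  qed
  then show ?thesis by (simp add: lap_def sum_subtractf)
qed

lemma lap_cong:
  assumes "\<And>z. z \<in> Om T \<Longrightarrow> f z = g z" "z \<in> Om T"
  shows "lap T f z = lap T g z"
  unfolding lap_def by (intro sum.cong refl dx_cong assms)

definition face_jump :: "'n \<Rightarrow> 'n::finite vfield \<Rightarrow> 'n vfield" where
  "face_jump j f z = f (side j 2 z) - f (side j 0 z)"

lemma face_jump_continuous:
  "continuous_on (Om T) f \<Longrightarrow> continuous_on (Om T) (face_jump j f)"
  unfolding face_jump_def[abs_def] by (intro continuous_intros continuous_on_comp_side) auto

text \<open>The quantities whose periodicity is penalised by \<open>res_sb T i\<close>; on the faces orthogonal to
  axis \<open>j\<close> the normal derivative is \<open>dx T j\<close> up to sign.\<close>

definition trace_op :: "real \<Rightarrow> nat \<Rightarrow> 'n \<Rightarrow> 'n::finite vfield \<Rightarrow> 'n vfield" where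
  "trace_op T i j f = (if i = 1 then f else if i = 2 then dx T j f else if i = 3 then lap T f else dx T j (lap T f))"

text \<open>\<open>trace_op T i j\<close> has order \<open>i - 1\<close>, so \<open>k + i\<close>
  derivatives of \<open>f\<close> leave \<open>Suc k\<close>. The factor \<open>d\<close> counts the
  summands of the Laplacian.\<close>

lemma Ck_bound_trace_op:
  fixes f :: "'n::finite vfield"
  assumes "0 < T" "Ck_bound (k + i) (Om T) f X 1" "i \<in> {1..4}" "0 \<le> X"
  shows "Ck_bound (Suc k) (Om T) (trace_op T i j f) (real CARD('n) * X) 1"
proof -
  have dX: "1 * X \<le> real CARD('n) * X"
    using assms(4) by (intro mult_right_mono) (auto simp: Suc_le_eq)
  have le: "Ck_bound m (Om T) f X 1" if "m \<le> k + i" for m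
    using Ck_bound_le[OF that assms(2)] .
  consider "i = 1" | "i = 2" | "i = 3" | "i = 4" using assms(3) by force
  then show ?thesis
  proof cases
    case 1
    then show ?thesis using Ck_bound_mono[OF le[of "Suc k"] dX[unfolded mult_1] order_refl] assms(4)
      by (simp add: trace_op_def)
  next
    case 2
    then show ?thesis
      using Ck_bound_mono[OF Ck_bound_dx[OF le[of "Suc (Suc k)"]] dX[unfolded mult_1] order_refl] assms(4)
      by (simp add: trace_op_def)
  next
    case 3
    then show ?thesis
      using Ck_bound_lap[OF assms(1) le[of "Suc (Suc (Suc k))"]] by (simp add: trace_op_def)
  next
    case 4
    then show ?thesis
      using Ck_bound_dx[OF Ck_bound_lap[OF assms(1) le[of "Suc (Suc (Suc (Suc k)))"]], of j] by (simp add: trace_op_def)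
  qed
qed

text \<open>The boundary term of \<open>integration_by_parts\<close>: the difference of the
  integrals of \<open>f \<bullet> g\<close> over the two faces orthogonal to axis
  \<open>j\<close>.\<close>

definition face_pairing :: "real \<Rightarrow> 'n \<Rightarrow> 'n::finite vfield \<Rightarrow> 'n vfield \<Rightarrow> real" where
  "face_pairing s j f g = integral (Om s) (\<lambda>z. (f (side j 2 z) \<bullet> g (side j 2 z) - f (side j 0 z) \<bullet> g (side j 0 z)) / 2)"

text \<open>With indices for the two faces, f2 g2 - f0 g0 = (f2 - f0) g2 + f0 (g2 - g0): each term
  has a jump as a factor, the other factor is taken in the sup norm. The integrands being
  nonnegative, the time interval may be extended to \<open>T\<close>.\<close>

lemma face_pairing_le:
  fixes f g :: "'n::finite vfield"
  assumes "s \<le> T" "Ck_bound 0 (Om T) f F 1" "Ck_bound 0 (Om T) g G 1" "0 \<le> F" "0 \<le> G"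
  shows "\<bar>face_pairing s j f g\<bar> \<le>
    (G * integral (Om T) (\<lambda>z. norm (face_jump j f z)) + F * integral (Om T) (\<lambda>z. norm (face_jump j g z))) / 2"
proof -
  have cf: "continuous_on (Om T) f" and cg: "continuous_on (Om T) g" using assms by auto
  let ?p = "\<lambda>z. (f (side j 2 z) \<bullet> g (side j 2 z) - f (side j 0 z) \<bullet> g (side j 0 z)) / 2"
  let ?q = "\<lambda>z. (G * norm (face_jump j f z) + F * norm (face_jump j g z)) / 2"
  have cp: "continuous_on (Om T) ?p"
    by (intro continuous_intros continuous_on_comp_side cf cg) auto
  have cq: "continuous_on (Om T) ?q"
    by (intro continuous_intros face_jump_continuous cf cg) auto
  have int: "(\<lambda>z. norm (face_jump j f z)) integrable_on Om T" "(\<lambda>z. norm (face_jump j g z)) integrable_on Om T"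
    by (intro integrable_Om[OF _ order_refl] continuous_intros face_jump_continuous cf cg)+
  have pq: "norm (?p z) \<le> ?q z" if "z \<in> Om T" for z
  proof -
    have z: "side j 2 z \<in> Om T" "side j 0 z \<in> Om T" using side_in_Om[OF that] by auto
    have "f (side j 2 z) \<bullet> g (side j 2 z) - f (side j 0 z) \<bullet> g (side j 0 z) =
       face_jump j f z \<bullet> g (side j 2 z) + f (side j 0 z) \<bullet> face_jump j g z"
      by (simp add: face_jump_def inner_diff_left inner_diff_right)
    moreover have "\<bar>face_jump j f z \<bullet> g (side j 2 z)\<bar> \<le> norm (face_jump j f z) * G"
      using assms z by (intro order_trans[OF Cauchy_Schwarz_ineq2] mult_left_mono) auto
    moreover have "\<bar>f (side j 0 z) \<bullet> face_jump j g z\<bar> \<le> F * norm (face_jump j g z)"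
      using assms z by (intro order_trans[OF Cauchy_Schwarz_ineq2] mult_right_mono) auto
    ultimately show ?thesis by (simp add: mult.commute)
  qed
  have "\<bar>face_pairing s j f g\<bar> \<le> integral (Om s) ?q"
    unfolding face_pairing_def real_norm_def[symmetric]
    using pq Om_mono[OF assms(1)]
    by (intro integral_norm_bound_integral integrable_Om[OF cp] integrable_Om[OF cq] assms) auto
  also have "\<dots> \<le> integral (Om T) ?q"
    using assms by (intro integral_subset_le Om_mono integrable_Om[OF cq]) auto
  also have "\<dots> = (G * integral (Om T) (\<lambda>z. norm (face_jump j f z)) + F * integral (Om T) (\<lambda>z. norm (face_jump j g z))) / 2"
    using int by (simp add: Henstock_Kurzweil_Integration.integral_add integrable_on_mult_right)
  finally show ?thesis .
qed

section \<open>Energy balance for the error of a periodic solution\<close>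

locale periodic_error =
  fixes T lam :: real and u v e :: "'n::finite vfield"
  assumes T: "0 < T" and u: "Ck_on 6 (Om T) u" and v: "Ck_on 6 (Om T) v"
    and per: "cell_periodic T u" and e_def: "e = (\<lambda>z. v z - u z)"
begin

lemma e: "Ck_on 6 (Om T) e"
  unfolding e_def by (rule Ck_on_diff[OF compact_Om thick_Om[OF T] v u])

abbreviation N :: "nat \<Rightarrow> real" where "N k \<equiv> Ck_norm k (Om T) e"
abbreviation U :: real where "U \<equiv> Ck_norm 6 (Om T) u"

lemma e_bound: "k \<le> 6 \<Longrightarrow> Ck_bound k (Om T) e (N k) 1"
  by (rule Ck_bound_compact[OF compact_Om e])

lemma u_bound: "k \<le> 6 \<Longrightarrow> Ck_bound k (Om T) u U 1"
  by (rule Ck_bound_le[OF _ Ck_bound_compact[OF compact_Om u order_refl]])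

lemma v_bound: "k \<le> 6 \<Longrightarrow> Ck_bound k (Om T) v (Ck_norm 6 (Om T) v) 1"
  by (rule Ck_bound_le[OF _ Ck_bound_compact[OF compact_Om v order_refl]])

lemma N_nonneg: "k \<le> 6 \<Longrightarrow> 0 \<le> N k" and U_nonneg: "0 \<le> U" and V_nonneg: "0 \<le> Ck_norm 6 (Om T) v"
  using Ck_norm_nonneg[OF e_bound Om_nonempty[OF T]] Ck_norm_nonneg[OF u_bound Om_nonempty[OF T]]
    Ck_norm_nonneg[OF v_bound Om_nonempty[OF T]] by auto

lemma pders_u_side:
  assumes z: "z \<in> Om T" and bs: "set bs \<subseteq> Basis" "length bs \<le> 6"
  shows "pders (Om T) bs u (side j 2 z) = pders (Om T) bs u (side j 0 z)"
proof -
  let ?x = "fst (side j 0 z)"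
  have x: "?x \<in> cell" "?x $ j = 0" "snd z \<in> {0..T}"
    using z side_in_Om[OF z, of 0 j] by (auto simp: Om_def side_def)
  have "?x + axis j 2 = fst (side j 2 z)"
    by (auto simp: side_def vec_eq_iff axis_def)
  moreover have "pders (Om T) bs u (?x, snd z) = pders (Om T) bs u (?x + axis j 2, snd z)"
    using per x bs unfolding cell_periodic_def by blast
  ultimately show ?thesis by (simp add: side_def)
qed

lemma u_side: "z \<in> Om T \<Longrightarrow> u (side j 2 z) = u (side j 0 z)"
  using pders_u_side[of z "[]" j] by simp

text \<open>Equal to \<open>res_pde lam T v\<close> wherever \<open>u\<close> solves the equation, but written in terms of the error,
  so that it is controlled on the whole closed cylinder.\<close>

definition Rd :: "'n vfield" where
  "Rd z = dt T e z + (\<Sum>j\<in>UNIV. (e z $ j) *\<^sub>R dx T j u z + (v z $ j) *\<^sub>R dx T j e z)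
     + lam *\<^sub>R lap T e z + lap T (lap T e) z"

lemma cont:
  "continuous_on (Om T) e" "continuous_on (Om T) u" "continuous_on (Om T) v"
  "continuous_on (Om T) (dt T e)" "continuous_on (Om T) (dx T j e)" "continuous_on (Om T) (dx T j u)"
  "continuous_on (Om T) (lap T e)" "continuous_on (Om T) (dx T j (lap T e))" "continuous_on (Om T) (dx T j (dx T j e))"
  "continuous_on (Om T) (dx T j (dx T j (lap T e)))" "continuous_on (Om T) (lap T (lap T e))"
proof -
  note [intro] = Ck_bound_continuous
  have B: "Ck_bound (Suc (Suc (Suc (Suc 0)))) (Om T) e (N 4) 1" "Ck_bound (Suc 0) (Om T) u U 1"
    "Ck_bound 0 (Om T) v (Ck_norm 6 (Om T) v) 1"
    using e_bound[of 4] u_bound[of "Suc 0"] v_bound[of 0] by (simp_all add: eval_nat_numeral)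
  show "continuous_on (Om T) e" "continuous_on (Om T) u" "continuous_on (Om T) v"
    using B by blast+
  show "continuous_on (Om T) (dt T e)" "continuous_on (Om T) (dx T j e)" "continuous_on (Om T) (dx T j u)"
    using Ck_bound_dt[OF B(1)] Ck_bound_dx[OF B(1)] Ck_bound_dx[OF B(2)] by blast+
  show "continuous_on (Om T) (lap T e)" "continuous_on (Om T) (dx T j (lap T e))" "continuous_on (Om T) (dx T j (dx T j e))"
    using Ck_bound_lap[OF T B(1)] Ck_bound_dx[OF Ck_bound_lap[OF T B(1)]] Ck_bound_dx[OF Ck_bound_dx[OF B(1)]] by blast+
  show "continuous_on (Om T) (dx T j (dx T j (lap T e)))" "continuous_on (Om T) (lap T (lap T e))"
    using Ck_bound_dx[OF Ck_bound_dx[OF Ck_bound_lap[OF T B(1)]]] Ck_bound_lap[OF T Ck_bound_lap[OF T B(1)]] by blast+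
qed

lemma differentiable:
  "e differentiable_on Om T" "u differentiable_on Om T" "v differentiable_on Om T" "dx T j e differentiable_on Om T"
  "lap T e differentiable_on Om T" "dx T j (lap T e) differentiable_on Om T"
proof -
  note D = Ck_bound_differentiable
  have B: "Ck_bound (Suc (Suc (Suc (Suc 0)))) (Om T) e (N 4) 1" "Ck_bound (Suc 0) (Om T) u U 1"
    "Ck_bound (Suc 0) (Om T) v (Ck_norm 6 (Om T) v) 1"
    using e_bound[of 4] u_bound[of "Suc 0"] v_bound[of "Suc 0"] by (simp_all add: eval_nat_numeral)
  show "e differentiable_on Om T" "u differentiable_on Om T" "v differentiable_on Om T" "dx T j e differentiable_on Om T"
    using D[OF B(1)] D[OF B(2)] D[OF B(3)] D[OF Ck_bound_dx[OF B(1)]] by blast+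
  show "lap T e differentiable_on Om T" "dx T j (lap T e) differentiable_on Om T"
    using D[OF Ck_bound_lap[OF T B(1)]] D[OF Ck_bound_dx[OF Ck_bound_lap[OF T B(1)]]] by blast+
qed

lemma Rd_continuous: "continuous_on (Om T) Rd"
  unfolding Rd_def[abs_def] by (intro continuous_intros cont)

lemma component_times_e:
  shows "(\<lambda>z. (e z $ j) *\<^sub>R e z) differentiable_on Om T"
    and "z \<in> Om T \<Longrightarrow> dx T j (\<lambda>z. (e z $ j) *\<^sub>R e z) z = (e z $ j) *\<^sub>R dx T j e z + (dx T j e z $ j) *\<^sub>R e z"
proof -
  have c: "(\<lambda>z. e z $ j) differentiable_on Om T"
    by (rule differentiable_on_linear[OF bounded_linear_vec_nth differentiable(1)])
  show "(\<lambda>z. (e z $ j) *\<^sub>R e z) differentiable_on Om T"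
    by (rule differentiable_on_bilinear[OF bounded_bilinear_scaleR c differentiable(1)])
  show "dx T j (\<lambda>z. (e z $ j) *\<^sub>R e z) z = (e z $ j) *\<^sub>R dx T j e z + (dx T j e z $ j) *\<^sub>R e z" if "z \<in> Om T"
    using pder_bilinear[OF thick_Om[OF T] bounded_bilinear_scaleR c differentiable(1) that, of "(axis j 1, 0)"]
      pder_linear[OF thick_Om[OF T] bounded_linear_vec_nth differentiable(1) that, of "(axis j 1, 0)" j]
    by (simp add: dx_def)
qed

abbreviation I :: "real \<Rightarrow> ('n spacetime \<Rightarrow> real) \<Rightarrow> real" where "I s \<equiv> integral (Om s)"

lemma I_sum:
  fixes f :: "'n \<Rightarrow> 'n spacetime \<Rightarrow> real"
  assumes "s \<le> T" "\<And>j. continuous_on (Om T) (f j)"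
  shows "I s (\<lambda>z. \<Sum>j\<in>UNIV. f j z) = (\<Sum>j\<in>UNIV. I s (f j))"
  by (rule Henstock_Kurzweil_Integration.integral_sum) (auto intro: integrable_Om[OF assms(2) assms(1)])

text \<open>Two integrations by parts in each direction move both derivatives of the outer Laplacian
  onto the left factor; summed over \<open>j\<close> they form \<open>lap T e\<close> again.\<close>

lemma integral_bilaplacian:
  assumes s: "0 < s" "s \<le> T"
  shows "I s (\<lambda>z. e z \<bullet> lap T (lap T e) z) = I s (\<lambda>z. (norm (lap T e z))\<^sup>2) +
    (\<Sum>j\<in>UNIV. face_pairing s j e (dx T j (lap T e)) - face_pairing s j (dx T j e) (lap T e))"
proof -
  let ?q = "lap T e"
  have 1: "I s (\<lambda>z. e z \<bullet> dx T j (dx T j ?q) z) = face_pairing s j e (dx T j ?q) - face_pairing s j (dx T j e) ?q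
     + I s (\<lambda>z. dx T j (dx T j e) z \<bullet> ?q z)" for j
    using integration_by_parts[OF s differentiable(1) differentiable(6) cont(5) cont(10), of j]
      integration_by_parts[OF s differentiable(4) differentiable(5) cont(9) cont(8), of j]
    by (simp add: face_pairing_def)
  have "I s (\<lambda>z. e z \<bullet> lap T ?q z) = (\<Sum>j\<in>UNIV. I s (\<lambda>z. e z \<bullet> dx T j (dx T j ?q) z))"
    using I_sum[OF s(2), of "\<lambda>j z. e z \<bullet> dx T j (dx T j ?q) z"] cont
    by (simp add: lap_def[of T "lap T e"] inner_sum_right continuous_on_inner)
  moreover have "(\<Sum>j\<in>UNIV. I s (\<lambda>z. dx T j (dx T j e) z \<bullet> ?q z)) = I s (\<lambda>z. (norm (?q z))\<^sup>2)"
  proof -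
    have "(norm (?q z))\<^sup>2 = (\<Sum>j\<in>UNIV. dx T j (dx T j e) z \<bullet> ?q z)" for z
      by (simp add: power2_norm_eq_inner inner_sum_left[symmetric] lap_def[of T e z, symmetric])
    then show ?thesis
      using I_sum[OF s(2), of "\<lambda>j z. dx T j (dx T j e) z \<bullet> ?q z"] cont by (simp add: continuous_on_inner)
  qed
  ultimately show ?thesis unfolding 1 by (simp add: sum.distrib)
qed

lemma integral_gradient:
  assumes s: "0 < s" "s \<le> T"
  shows "I s (\<lambda>z. e z \<bullet> lap T e z) = (\<Sum>j\<in>UNIV. face_pairing s j e (dx T j e)) - I s (\<lambda>z. \<Sum>j\<in>UNIV. (norm (dx T j e z))\<^sup>2)"
proof -
  have 1: "I s (\<lambda>z. e z \<bullet> dx T j (dx T j e) z) = face_pairing s j e (dx T j e) - I s (\<lambda>z. (norm (dx T j e z))\<^sup>2)" for j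
    using integration_by_parts[OF s differentiable(1) differentiable(4) cont(5) cont(9), of j]
    by (simp add: face_pairing_def power2_norm_eq_inner)
  have "I s (\<lambda>z. e z \<bullet> lap T e z) = (\<Sum>j\<in>UNIV. I s (\<lambda>z. e z \<bullet> dx T j (dx T j e) z))"
    using I_sum[OF s(2), of "\<lambda>j z. e z \<bullet> dx T j (dx T j e) z"] cont
    by (simp add: lap_def inner_sum_right continuous_on_inner)
  also have "\<dots> = (\<Sum>j\<in>UNIV. face_pairing s j e (dx T j e)) - (\<Sum>j\<in>UNIV. I s (\<lambda>z. (norm (dx T j e z))\<^sup>2))"
    by (simp add: 1 sum_subtractf)
  also have "(\<Sum>j\<in>UNIV. I s (\<lambda>z. (norm (dx T j e z))\<^sup>2)) = I s (\<lambda>z. \<Sum>j\<in>UNIV. (norm (dx T j e z))\<^sup>2)"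
    by (rule I_sum[symmetric, OF s(2)]) (intro continuous_intros cont)
  finally show ?thesis .
qed

text \<open>Both copies of \<open>e\<close> in the product get differentiated. Summed over
  \<open>j\<close>, the last term contains the divergence of \<open>e\<close>; no incompressibility
  is available here to make it vanish.\<close>

lemma integral_transport:
  assumes s: "0 < s" "s \<le> T"
  shows "I s (\<lambda>z. (e z $ j) * (e z \<bullet> dx T j u z)) = face_pairing s j (\<lambda>z. (e z $ j) *\<^sub>R e z) u
    - I s (\<lambda>z. (e z $ j) * (dx T j e z \<bullet> u z) + (dx T j e z $ j) * (e z \<bullet> u z))"
proof -
  have c: "continuous_on (Om T) (dx T j (\<lambda>z. (e z $ j) *\<^sub>R e z))"
    by (subst continuous_on_cong[OF refl component_times_e(2)]) (auto intro!: continuous_intros cont)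
  have "I s (\<lambda>z. dx T j (\<lambda>z. (e z $ j) *\<^sub>R e z) z \<bullet> u z) =
    I s (\<lambda>z. (e z $ j) * (dx T j e z \<bullet> u z) + (dx T j e z $ j) * (e z \<bullet> u z))"
    using Om_mono[OF s(2)]
    by (intro Henstock_Kurzweil_Integration.integral_cong)
      (auto simp: component_times_e(2) inner_add_left)
  then show ?thesis
    using integration_by_parts[OF s component_times_e(1)[of j] differentiable(2) c cont(6)]
    by (simp add: face_pairing_def)
qed

lemma I_add: "s \<le> T \<Longrightarrow> continuous_on (Om T) f \<Longrightarrow> continuous_on (Om T) g \<Longrightarrow> I s (\<lambda>z. f z + g z) = I s f + I s g"
  and I_diff: "s \<le> T \<Longrightarrow> continuous_on (Om T) f \<Longrightarrow> continuous_on (Om T) g \<Longrightarrow> I s (\<lambda>z. f z - g z) = I s f - I s g"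
  by (simp_all add: Henstock_Kurzweil_Integration.integral_add Henstock_Kurzweil_Integration.integral_diff integrable_Om)

lemma I_mono:
  assumes "s \<le> T" "continuous_on (Om T) f" "continuous_on (Om T) g" "\<And>z. z \<in> Om T \<Longrightarrow> f z \<le> g z"
  shows "I s f \<le> I s g"
  using assms Om_mono[OF assms(1)] by (intro integral_le integrable_Om[OF assms(2,1)] integrable_Om[OF assms(3,1)]) auto

text \<open>Collected from \<open>integral_transport\<close>, \<open>integral_bilaplacian\<close>
  and \<open>integral_gradient\<close>; the last carries 1/2 because half of that identity is
  used.\<close>

definition boundary_terms :: "real \<Rightarrow> real" where
  "boundary_terms s = (\<Sum>j\<in>UNIV. - face_pairing s j (\<lambda>z. (e z $ j) *\<^sub>R e z) u
     - face_pairing s j e (dx T j (lap T e)) + face_pairing s j (dx T j e) (lap T e) + face_pairing s j e (dx T j e) / 2)"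

abbreviation energy_density :: "'n spacetime \<Rightarrow> real" where
  "energy_density z \<equiv> e z \<bullet> Rd z
     + (\<Sum>j\<in>UNIV. (e z $ j) * (dx T j e z \<bullet> u z) + (dx T j e z $ j) * (e z \<bullet> u z) - (v z $ j) * (e z \<bullet> dx T j e z))
     - (lam + 1 / 2) * (e z \<bullet> lap T e z) - (norm (lap T e z))\<^sup>2 - (\<Sum>j\<in>UNIV. (norm (dx T j e z))\<^sup>2) / 2"

text \<open>Integrating by parts moves the gradient off \<open>u\<close>, so only the sup norm of \<open>u\<close> enters; half of
  the identity for the integral of \<open>e \<bullet> lap e\<close> is added to provide the dissipation of the gradient.\<close>

lemma energy_identity:
  assumes s: "0 < s" "s \<le> T"
  shows "(energy e s - energy e 0) / 2 = boundary_terms s + I s energy_density"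
proof -
  note [continuous_intros] = cont Rd_continuous
  let ?tr = "\<lambda>j z. (e z $ j) * (dx T j e z \<bullet> u z) + (dx T j e z $ j) * (e z \<bullet> u z)"
  let ?ad = "\<lambda>j z. (v z $ j) * (e z \<bullet> dx T j e z)"
  let ?G = "\<lambda>z. \<Sum>j\<in>UNIV. (norm (dx T j e z))\<^sup>2"
  have "e z \<bullet> dt T e z = e z \<bullet> Rd z - (\<Sum>j\<in>UNIV. (e z $ j) * (e z \<bullet> dx T j u z)) - (\<Sum>j\<in>UNIV. ?ad j z)
      - lam * (e z \<bullet> lap T e z) - e z \<bullet> lap T (lap T e) z" for z
    by (simp add: Rd_def inner_add_right inner_sum_right sum.distrib)
  then have "I s (\<lambda>z. e z \<bullet> dt T e z) = I s (\<lambda>z. e z \<bullet> Rd z) - (\<Sum>j\<in>UNIV. I s (\<lambda>z. (e z $ j) * (e z \<bullet> dx T j u z)))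
      - (\<Sum>j\<in>UNIV. I s (?ad j)) - lam * I s (\<lambda>z. e z \<bullet> lap T e z) - I s (\<lambda>z. e z \<bullet> lap T (lap T e) z)"
    by (simp only:, subst I_sum[symmetric, OF s(2)], (intro continuous_intros)[1],
        subst I_sum[symmetric, OF s(2)], (intro continuous_intros)[1])
      (simp add: I_diff[OF s(2)] continuous_intros)
  moreover have "I s (\<lambda>z. e z \<bullet> Rd z + (\<Sum>j\<in>UNIV. ?tr j z - ?ad j z)
      - (lam + 1 / 2) * (e z \<bullet> lap T e z) - (norm (lap T e z))\<^sup>2 - ?G z / 2)
    = I s (\<lambda>z. e z \<bullet> Rd z) + (\<Sum>j\<in>UNIV. I s (?tr j)) - (\<Sum>j\<in>UNIV. I s (?ad j))
      - (lam + 1 / 2) * I s (\<lambda>z. e z \<bullet> lap T e z) - I s (\<lambda>z. (norm (lap T e z))\<^sup>2) - I s ?G / 2"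
  proof -
    have "I s (\<lambda>z. \<Sum>j\<in>UNIV. ?tr j z - ?ad j z) = (\<Sum>j\<in>UNIV. I s (?tr j)) - (\<Sum>j\<in>UNIV. I s (?ad j))"
      by (subst I_sum[OF s(2)]) (simp_all add: I_diff[OF s(2)] sum_subtractf continuous_intros)
    then show ?thesis
      by (simp add: I_diff[OF s(2)] I_add[OF s(2)] continuous_intros)
  qed
  ultimately show ?thesis
    unfolding energy_difference[OF s differentiable(1) cont(4), symmetric] boundary_terms_def
      integral_transport[OF s] integral_bilaplacian[OF s] integral_gradient[OF s]
    by (simp add: sum_subtractf sum.distrib sum_negf algebra_simps flip: sum_divide_distrib)
qed

lemma square_bound: "a * b \<le> a\<^sup>2 / 2 + b\<^sup>2 / 2" for a b :: real
  using sum_squares_bound[of a b] by simp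

lemma pointwise_energy_bound:
  assumes z: "z \<in> Om T" and UV: "norm (u z) \<le> a" "norm (e z) \<le> b"
  shows "energy_density z \<le> (norm (Rd z))\<^sup>2 / 4 + (2 + (lam + 1 / 2)\<^sup>2 / 2 + 18 * real CARD('n)) * (a\<^sup>2 + b\<^sup>2 + 1) / 2 * (norm (e z))\<^sup>2"
proof -
  let ?E = "norm (e z)"
  have ab: "0 \<le> a" "0 \<le> b" using UV norm_ge_zero order_trans by blast+
  \<comment> \<open>The balance is for half the energy, so 1/4 turns into 1/2 after
    doubling.\<close>
  have 1: "e z \<bullet> Rd z \<le> ?E\<^sup>2 + (norm (Rd z))\<^sup>2 / 4"
    using norm_cauchy_schwarz[of "e z" "Rd z"] zero_le_power2[of "?E - norm (Rd z) / 2"]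
    by (simp add: power2_eq_square algebra_simps)
  \<comment> \<open>Completing the square: the negative square of the Laplacian absorbs the mixed
    term.\<close>
  have 2: "- (lam + 1 / 2) * (e z \<bullet> lap T e z) - (norm (lap T e z))\<^sup>2 \<le> (lam + 1 / 2)\<^sup>2 / 4 * ?E\<^sup>2"
  proof -
    have "0 \<le> (norm (((lam + 1 / 2) / 2) *\<^sub>R e z + lap T e z))\<^sup>2" by simp
    also have "\<dots> = (lam + 1 / 2)\<^sup>2 / 4 * ?E\<^sup>2 + (lam + 1 / 2) * (e z \<bullet> lap T e z) + (norm (lap T e z))\<^sup>2"
      by (simp add: power2_norm_eq_inner inner_add_left inner_add_right inner_commute[of "lap T e z" "e z"])
        (simp add: power2_eq_square field_simps)
    finally show ?thesis by (simp add: algebra_simps)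
  qed
  have v: "norm (v z) \<le> a + b"
    using norm_triangle_ineq[of "u z" "e z"] UV by (simp add: e_def)
  \<comment> \<open>As \<open>v = u + e\<close>, the three products have total coefficient
    \<open>3 * a + b\<close>. Young's inequality leaves half of the squared derivative, which the
    dissipation of the gradient absorbs.\<close>
  have 3: "(e z $ j) * (dx T j e z \<bullet> u z) + (dx T j e z $ j) * (e z \<bullet> u z) - (v z $ j) * (e z \<bullet> dx T j e z)
     \<le> (norm (dx T j e z))\<^sup>2 / 2 + 9 * (a\<^sup>2 + b\<^sup>2) * ?E\<^sup>2" for j
  proof -
    let ?D = "norm (dx T j e z)"
    have le: "\<bar>x $ j * (y \<bullet> w)\<bar> \<le> norm x * (norm y * norm w)" for x y w :: "real ^ 'n"
      unfolding abs_mult by (intro mult_mono component_le_norm_cart Cauchy_Schwarz_ineq2) auto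
    have m: "?E * (?D * norm (u z)) \<le> ?E * ?D * a" "?D * (?E * norm (u z)) \<le> ?E * ?D * a"
      "norm (v z) * (?E * ?D) \<le> ?E * ?D * (a + b)"
      using mult_left_mono[OF UV(1), of "?E * ?D"] mult_left_mono[OF v, of "?E * ?D"] by (simp_all add: mult_ac)
    have "(e z $ j) * (dx T j e z \<bullet> u z) + (dx T j e z $ j) * (e z \<bullet> u z) - (v z $ j) * (e z \<bullet> dx T j e z)
       \<le> ?D * (?E * (3 * a + b))"
      using le[of "e z" "dx T j e z" "u z"] le[of "dx T j e z" "e z" "u z"] le[of "v z" "e z" "dx T j e z"] m
      by (simp add: algebra_simps)
    also have "\<dots> \<le> ?D\<^sup>2 / 2 + (?E * (3 * a + b))\<^sup>2 / 2" by (rule square_bound)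
    also have "\<dots> \<le> ?D\<^sup>2 / 2 + 9 * (a\<^sup>2 + b\<^sup>2) * ?E\<^sup>2"
    proof -
      have "(3 * a + b)\<^sup>2 \<le> 18 * (a\<^sup>2 + b\<^sup>2)"
      proof -
        have "(3 * a + b)\<^sup>2 + ((3 * a - b)\<^sup>2 + 16 * b\<^sup>2) = 18 * (a\<^sup>2 + b\<^sup>2)"
          by (simp add: power2_eq_square algebra_simps)
        moreover have "0 \<le> (3 * a - b)\<^sup>2 + 16 * b\<^sup>2" by simp
        ultimately show ?thesis by linarith
      qed
      from mult_left_mono[OF this, of "?E\<^sup>2 / 2"] show ?thesis
        unfolding power_mult_distrib by (simp add: mult_ac distrib_left)
    qed
    finally show ?thesis .
  qed
  have 4: "(\<Sum>j\<in>UNIV. (e z $ j) * (dx T j e z \<bullet> u z) + (dx T j e z $ j) * (e z \<bullet> u z) - (v z $ j) * (e z \<bullet> dx T j e z))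
     \<le> (\<Sum>j\<in>UNIV. (norm (dx T j e z))\<^sup>2) / 2 + real CARD('n) * (9 * (a\<^sup>2 + b\<^sup>2) * ?E\<^sup>2)"
    using sum_mono[of UNIV, OF 3] by (simp add: sum.distrib sum_divide_distrib)
  \<comment> \<open>The leading factor is twice the sum of the three coefficients 1, (lam + 1/2)^2 /
    4 and 9 * d; it becomes C1.\<close>
  have 5: "?E\<^sup>2 + (lam + 1 / 2)\<^sup>2 / 4 * ?E\<^sup>2 + real CARD('n) * (9 * (a\<^sup>2 + b\<^sup>2) * ?E\<^sup>2)
    \<le> (2 + (lam + 1 / 2)\<^sup>2 / 2 + 18 * real CARD('n)) * (a\<^sup>2 + b\<^sup>2 + 1) / 2 * ?E\<^sup>2"
  proof -
    have "1 + (lam + 1 / 2)\<^sup>2 / 4 + real CARD('n) * (9 * (a\<^sup>2 + b\<^sup>2))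
      \<le> (2 + (lam + 1 / 2)\<^sup>2 / 2 + 18 * real CARD('n)) * (a\<^sup>2 + b\<^sup>2 + 1) / 2"
    proof -
      have "1 + m / 4 + d * (9 * A) \<le> (2 + m / 2 + 18 * d) * (A + 1) / 2" if "0 \<le> m" "0 \<le> d" "0 \<le> A" for m d A :: real
      proof -
        have "(2 + m / 2 + 18 * d) * (A + 1) / 2 = 1 + m / 4 + d * (9 * A) + ((2 + m / 2) * A + 18 * d) / 2"
          by (simp add: field_simps)
        moreover have "0 \<le> (2 + m / 2) * A + 18 * d" using that by (intro add_nonneg_nonneg mult_nonneg_nonneg) auto
        ultimately show ?thesis by simp
      qed
      from this[of "(lam + 1 / 2)\<^sup>2" "real CARD('n)" "a\<^sup>2 + b\<^sup>2"] show ?thesis by simp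
    qed
    from mult_right_mono[OF this, of "?E\<^sup>2"] show ?thesis by (simp add: algebra_simps)
  qed
  show ?thesis using 1 2 4 5 by linarith
qed

definition face_L1 :: real where
  "face_L1 = (\<Sum>i=1..4. \<Sum>j\<in>UNIV. integral (Om T) (\<lambda>z. norm (face_jump j (trace_op T i j e) z)))"

lemma N_le: "j \<le> k \<Longrightarrow> k \<le> 6 \<Longrightarrow> N j \<le> N k"
  using Ck_norm_mono_order[OF compact_Om Om_nonempty[OF T] Ck_bound_imp_Ck_on[OF e_bound[of k]]] by blast

text \<open>Every pairing is quadratic in \<open>e\<close>: one factor becomes a jump and is
  collected in \<open>face_L1\<close>, the other is bounded by \<open>N 4\<close>. Hence the
  constant in front of the boundary residuals is linear in a norm of the error.\<close>

lemma boundary_terms_le: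
  assumes s: "s \<le> T"
  shows "boundary_terms s \<le> (U + real CARD('n) + 1) * N 4 * face_L1"
proof -
  let ?d = "real CARD('n)"
  let ?J = "\<lambda>i j. integral (Om T) (\<lambda>z. norm (face_jump j (trace_op T i j e) z))"
  have N4: "Ck_bound 4 (Om T) e (N 4) 1" "0 \<le> N 4" using e_bound N_nonneg by auto
  have d1: "1 \<le> ?d" by (simp add: Suc_le_eq)
  have tB: "Ck_bound 0 (Om T) (trace_op T i j e) (?d * N 4) 1" if "i \<in> {1..4}" for i j
    by (rule Ck_bound_le[OF _ Ck_bound_trace_op[OF T, of 0 i]]) (use that Ck_bound_le[OF _ N4(1)] N4 in auto)
  have ct: "continuous_on (Om T) (trace_op T i j e)" if "i \<in> {1..4}" for i j
    using Ck_bound_continuous[OF tB[OF that]] .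
  have J: "0 \<le> ?J i j" if "i \<in> {1..4}" for i j
    using ct[OF that] by (intro integral_nonneg integrable_Om[OF _ order_refl] continuous_intros face_jump_continuous) auto
  have tr: "trace_op T 1 j e = e" "trace_op T 2 j e = dx T j e" "trace_op T 3 j e = lap T e"
    "trace_op T 4 j e = dx T j (lap T e)" for j by (simp_all add: trace_op_def)
  have "- face_pairing s j (\<lambda>z. (e z $ j) *\<^sub>R e z) u
     - face_pairing s j e (dx T j (lap T e)) + face_pairing s j (dx T j e) (lap T e) + face_pairing s j e (dx T j e) / 2
     \<le> (U + ?d + 1) * N 4 * (\<Sum>i=1..4. ?J i j)" for j
  proof -
    have pair: "\<bar>face_pairing s j (trace_op T i j e) (trace_op T k j e)\<bar> \<le> ?d * N 4 * (?J i j + ?J k j) / 2"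
      if "i \<in> {1..4}" "k \<in> {1..4}" for i k
      using face_pairing_le[OF s tB[OF that(1)] tB[OF that(2)]] N4(2) d1
      by (simp add: distrib_left)
    have "\<bar>face_pairing s j (\<lambda>z. (e z $ j) *\<^sub>R e z) u\<bar> \<le> U * N 4 * ?J 1 j"
    proof -
      let ?w = "\<lambda>z. (e z $ j) *\<^sub>R e z"
      have cw: "continuous_on (Om T) ?w" by (intro continuous_intros cont)
      have nN: "norm (e z) \<le> N 4" if "z \<in> Om T" for z by (rule Ck_bound_norm[OF N4(1) that])
      have "norm (?w z) \<le> N 4 * N 4" if "z \<in> Om T" for z
        using component_le_norm_cart[of "e z" j] nN[OF that] by (auto intro!: mult_mono)
      then have wB: "Ck_bound 0 (Om T) ?w (N 4 * N 4) 1" using cw by simp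
      have "\<bar>face_pairing s j ?w u\<bar> \<le> (U * integral (Om T) (\<lambda>z. norm (face_jump j ?w z))
           + N 4 * N 4 * integral (Om T) (\<lambda>z. norm (face_jump j u z))) / 2"
        using face_pairing_le[OF s wB u_bound[of 0]] N4 U_nonneg by simp
      \<comment> \<open>The exact solution has no jump, so the term with \<open>N 4 * N 4\<close>
        disappears and only the jump of the product remains.\<close>
      also have "integral (Om T) (\<lambda>z. norm (face_jump j u z)) = integral (Om T) (\<lambda>z :: 'n spacetime. 0 :: real)"
        by (rule Henstock_Kurzweil_Integration.integral_cong) (simp add: face_jump_def u_side)
      also have "U * integral (Om T) (\<lambda>z. norm (face_jump j ?w z)) \<le> U * integral (Om T) (\<lambda>z. 2 * N 4 * norm (face_jump j e z))"
      proof (intro mult_left_mono U_nonneg I_mono order_refl continuous_intros face_jump_continuous cw cont)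
        fix z :: "'n spacetime" assume z: "z \<in> Om T"
        let ?p = "e (side j 2 z)" and ?q = "e (side j 0 z)"
        have "face_jump j ?w z = ((?p - ?q) $ j) *\<^sub>R ?p + (?q $ j) *\<^sub>R (?p - ?q)"
          by (simp add: face_jump_def algebra_simps)
        also have "norm \<dots> \<le> norm (?p - ?q) * N 4 + N 4 * norm (?p - ?q)"
          using component_le_norm_cart[of "?p - ?q" j] component_le_norm_cart[of ?q j]
            nN[OF side_in_Om[OF z, of 2 j]] nN[OF side_in_Om[OF z, of 0 j]]
          by (intro order_trans[OF norm_triangle_ineq] add_mono) (auto intro!: mult_mono simp del: vector_minus_component)
        finally show "norm (face_jump j ?w z) \<le> 2 * N 4 * norm (face_jump j e z)"
          by (simp add: face_jump_def)
      qed
      finally show ?thesis unfolding tr by (simp add: mult_ac)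
    qed
    moreover note pair[of 1 4] pair[of 2 3] pair[of 1 2]
    \<comment> \<open>The right side is split into what the four pairings use and a nonnegative
      surplus.\<close>
    moreover have "(U + ?d + 1) * N 4 * (\<Sum>i=1..4. ?J i j) = U * N 4 * ?J 1 j
      + ?d * N 4 * (?J 1 j + ?J 4 j) / 2 + ?d * N 4 * (?J 2 j + ?J 3 j) / 2 + ?d * N 4 * (?J 1 j + ?J 2 j) / 4
      + (U * N 4 * (?J 2 j + ?J 3 j + ?J 4 j) + N 4 * (?J 1 j + ?J 2 j + ?J 3 j + ?J 4 j)
         + ?d * N 4 * (?J 1 j / 4 + ?J 2 j / 4 + ?J 3 j / 2 + ?J 4 j / 2))"
      by (simp add: eval_nat_numeral field_simps)
    moreover have "0 \<le> U * N 4 * (?J 2 j + ?J 3 j + ?J 4 j) + N 4 * (?J 1 j + ?J 2 j + ?J 3 j + ?J 4 j)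
         + ?d * N 4 * (?J 1 j / 4 + ?J 2 j / 4 + ?J 3 j / 2 + ?J 4 j / 2)"
      using U_nonneg N4(2) by (intro add_nonneg_nonneg mult_nonneg_nonneg divide_nonneg_pos J) auto
    ultimately show ?thesis unfolding tr by simp
  qed
  then have "boundary_terms s \<le> (\<Sum>j\<in>UNIV. (U + ?d + 1) * N 4 * (\<Sum>i=1..4. ?J i j))"
    unfolding boundary_terms_def by (rule sum_mono)
  also have "\<dots> = (U + ?d + 1) * N 4 * face_L1"
    unfolding face_L1_def sum_distrib_left[symmetric] by (subst sum.swap) (rule refl)
  finally show ?thesis .
qed

lemma energy_inequality:
  assumes s: "0 < s" "s \<le> T" and UV: "\<And>z. z \<in> Om T \<Longrightarrow> norm (u z) \<le> a" "\<And>z. z \<in> Om T \<Longrightarrow> norm (e z) \<le> b"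
  shows "energy e s \<le> energy e 0 + I T (\<lambda>z. (norm (Rd z))\<^sup>2) / 2 + 2 * ((U + real CARD('n) + 1) * N 4 * face_L1)
     + (2 + (lam + 1 / 2)\<^sup>2 / 2 + 18 * real CARD('n)) * (a\<^sup>2 + b\<^sup>2 + 1) * integral {0..s} (energy e)"
proof -
  note [continuous_intros] = cont Rd_continuous
  let ?k = "(2 + (lam + 1 / 2)\<^sup>2 / 2 + 18 * real CARD('n)) * (a\<^sup>2 + b\<^sup>2 + 1)"
  have "(energy e s - energy e 0) / 2 \<le> boundary_terms s + I s (\<lambda>z. (norm (Rd z))\<^sup>2 / 4 + ?k / 2 * (norm (e z))\<^sup>2)"
    unfolding energy_identity[OF s]
  proof (rule add_left_mono, rule I_mono[OF s(2)])
    fix z :: "'n spacetime" assume z: "z \<in> Om T"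
    show "energy_density z
     \<le> (norm (Rd z))\<^sup>2 / 4 + ?k / 2 * (norm (e z))\<^sup>2"
      using pointwise_energy_bound[OF z UV[OF z]] by simp
  qed (intro continuous_intros; simp)+
  also have "I s (\<lambda>z. (norm (Rd z))\<^sup>2 / 4 + ?k / 2 * (norm (e z))\<^sup>2) = I s (\<lambda>z. (norm (Rd z))\<^sup>2) / 4 + ?k / 2 * I s (\<lambda>z. (norm (e z))\<^sup>2)"
    by (simp add: I_add[OF s(2)] continuous_intros)
  also have "I s (\<lambda>z. (norm (Rd z))\<^sup>2) \<le> I T (\<lambda>z. (norm (Rd z))\<^sup>2)"
    using s by (intro integral_subset_le Om_mono integrable_Om[of T] continuous_intros) auto
  also have "I s (\<lambda>z. (norm (e z))\<^sup>2) = integral {0..s} (energy e)"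
    using continuous_on_subset[OF cont(1) Om_mono[OF s(2)]] by (rule integral_energy)
  finally have "(energy e s - energy e 0) / 2 \<le> boundary_terms s + I T (\<lambda>z. (norm (Rd z))\<^sup>2) / 4
      + ?k * integral {0..s} (energy e) / 2" by simp
  moreover have "E \<le> E0 + R / 2 + 2 * P + K" if "(E - E0) / 2 \<le> B + R / 4 + K / 2" "B \<le> P" for E E0 B R K P :: real
    using that by (simp add: field_simps)
  ultimately show ?thesis using boundary_terms_le[OF s(2)] by blast
qed

end

section \<open>Essential suprema, L^2 norms and stability\<close>

lemma norm_le_Linf_on:
  fixes f :: "'a::euclidean_space \<Rightarrow> 'b::real_normed_vector"
  assumes f: "continuous_on (cbox l u) f" and ne: "box l u \<noteq> {}" and z: "z \<in> cbox l u"
  shows "norm (f z) \<le> Linf_on (cbox l u) f"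
  unfolding Linf_on_def
proof (rule cInf_greatest)
  obtain B where "\<forall>x\<in>f ` cbox l u. norm x \<le> B"
    using compact_imp_bounded[OF compact_continuous_image[OF f compact_cbox]] bounded_iff by blast
  then have "max B 0 \<in> {a. 0 \<le> a \<and> (AE z in lebesgue_on (cbox l u). norm (f z) \<le> a)}"
    by (auto intro!: AE_I2 simp: le_max_iff_disj)
  then show "{a. 0 \<le> a \<and> (AE z in lebesgue_on (cbox l u). norm (f z) \<le> a)} \<noteq> {}" by blast
next
  fix a assume "a \<in> {a. 0 \<le> a \<and> (AE z in lebesgue_on (cbox l u). norm (f z) \<le> a)}"
  then have "AE z in lebesgue_on (cbox l u). norm (f z) \<le> a" by simp
  then obtain W where W: "{z \<in> space (lebesgue_on (cbox l u)). \<not> norm (f z) \<le> a} \<subseteq> W" "W \<in> null_sets (lebesgue_on (cbox l u))"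
    by (rule AE_E3) auto
  then have "negligible W" by (simp add: null_sets_restrict_space negligible_iff_null_sets)
  show "norm (f z) \<le> a"
  proof (rule ccontr)
    assume "\<not> norm (f z) \<le> a"
    have "openin (top_of_set (cbox l u)) (cbox l u \<inter> (\<lambda>z. norm (f z)) -` {a<..})"
      using continuous_openin_preimage_gen[OF continuous_on_norm[OF f] open_greaterThan] by simp
    then obtain V where V: "open V" "cbox l u \<inter> (\<lambda>z. norm (f z)) -` {a<..} = cbox l u \<inter> V"
      by (auto simp: openin_open)
    \<comment> \<open>The point may lie on the boundary. An open set meeting the closure of the open
      box meets the box itself, and their intersection is open, nonempty and contained in the null
      set \<open>W\<close>.\<close>
    have "z \<in> V \<inter> closure (box l u)"
      using V(2) z \<open>\<not> norm (f z) \<le> a\<close> by (auto simp: closure_box[OF ne])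
    then have "V \<inter> box l u \<noteq> {}" using open_Int_closure_eq_empty[OF V(1)] by blast
    moreover have "V \<inter> box l u \<subseteq> W"
    proof
      fix x assume "x \<in> V \<inter> box l u"
      then have "x \<in> cbox l u \<inter> (\<lambda>z. norm (f z)) -` {a<..}"
        using V(2) box_subset_cbox[of l u] by blast
      then show "x \<in> W" using W(1) by auto
    qed
    ultimately show False
      using open_not_negligible[of "V \<inter> box l u"] V(1) \<open>negligible W\<close> negligible_subset
      by (metis open_Int open_box)
  qed
qed

lemma L2_on_squared:
  fixes f :: "'a::euclidean_space \<Rightarrow> 'b::real_normed_vector"
  assumes "continuous_on (cbox l u) f"
  shows "(L2_on (cbox l u) f)\<^sup>2 = integral (cbox l u) (\<lambda>z. (norm (f z))\<^sup>2)"
proof -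
  have "continuous_on (cbox l u) (\<lambda>z. (norm (f z))\<^sup>2)" by (intro continuous_intros assms)
  then have "integrable (lebesgue_on (cbox l u)) (\<lambda>z. (norm (f z))\<^sup>2)"
    by (intro absolutely_integrable_imp_integrable absolutely_integrable_continuous) auto
  from has_integral_integral_lebesgue_on[OF this]
  have "(LINT z|lebesgue_on (cbox l u). (norm (f z))\<^sup>2) = integral (cbox l u) (\<lambda>z. (norm (f z))\<^sup>2)"
    by (simp add: integral_unique)
  moreover have "0 \<le> (LINT z|lebesgue_on (cbox l u). (norm (f z))\<^sup>2)"
    by (intro Bochner_Integration.integral_nonneg) simp
  ultimately show ?thesis by (simp add: L2_on_def)
qed

lemma box_Om_nonempty: "0 < T \<Longrightarrow> box (0, 0) (\<chi> i. 2, T) \<noteq> ({} :: 'n::finite spacetime set)"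
  by (auto simp: box_ne_empty Basis_prod_def Basis_vec_def inner_axis)

lemma measure_cell: "measure lborel (cell :: (real ^ 'n::finite) set) = 2 ^ CARD('n)"
  using content_cbox_cart[of 0 "\<chi> i::'n. 2"] unfolding cell_eq_cbox
  by (simp add: interval_eq_empty_cart)

lemma measure_Om: "0 \<le> T \<Longrightarrow> measure lborel (Om T :: 'n::finite spacetime set) = 2 ^ CARD('n) * T"
  using measure_cell[where 'n = 'n] by (simp add: Om_eq_cbox content_Pair cell_eq_cbox)

text \<open>The optimal \<open>a = sqrt (q / p)\<close> gives the geometric mean; if
  \<open>p\<close> or \<open>q\<close> is 0, a large or small \<open>a\<close> does. It turns a
  family of weighted Young inequalities into a Cauchy-Schwarz or L^2 triangle inequality with sharp
  constant.\<close>

lemma le_sqrt_if_le_balanced: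
  fixes Y p q :: real
  assumes le: "\<And>a. 0 < a \<Longrightarrow> Y \<le> (p * a + q / a) / 2" and "0 \<le> p" "0 \<le> q"
  shows "Y \<le> sqrt (p * q)"
proof (cases "p = 0 \<or> q = 0")
  case False
  then have "0 < p" "0 < q" using assms by auto
  have "p * sqrt (q / p) = sqrt (p * q)" "q / sqrt (q / p) = sqrt (p * q)"
    using \<open>0 < p\<close> \<open>0 < q\<close> by (simp_all add: real_sqrt_mult real_sqrt_divide field_simps)
  then show ?thesis using le[of "sqrt (q / p)"] \<open>0 < p\<close> \<open>0 < q\<close> by simp
next
  case True
  show ?thesis
  proof (rule ccontr)
    assume "\<not> Y \<le> sqrt (p * q)"
    then have Y: "0 < Y" using True by auto
    show False
    proof (cases "p = 0")
      case True
      have "0 \<le> q / Y" using assms(3) Y by simp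
      then have pos: "0 < (q / Y + 1) * 2" by (intro mult_pos_pos add_nonneg_pos) auto
      \<comment> \<open>For \<open>p = 0\<close> the hypothesis reads
        \<open>Y \<le> q / (2 * a)\<close>; the choice \<open>a = q / Y + 1\<close> is large enough
        for a contradiction.\<close>
      have "Y \<le> q / ((q / Y + 1) * 2)" using le[of "q / Y + 1"] \<open>0 \<le> q / Y\<close> True by simp
      then have "Y * ((q / Y + 1) * 2) \<le> q" unfolding pos_le_divide_eq[OF pos] .
      moreover have "Y * ((q / Y + 1) * 2) = 2 * q + 2 * Y" using Y by (simp add: field_simps)
      ultimately show False using assms(3) Y by linarith
    next
      case False
      then have "q = 0" "0 < p" using True assms by auto
      then show False using le[of "Y / p"] Y by (simp add: field_simps)
    qed
  qed
qed

context periodic_error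
begin

lemma stability:
  assumes UV: "\<And>z. z \<in> Om T \<Longrightarrow> norm (u z) \<le> a" "\<And>z. z \<in> Om T \<Longrightarrow> norm (e z) \<le> b"
    and K: "(2 + (lam + 1 / 2)\<^sup>2 / 2 + 18 * real CARD('n)) * (a\<^sup>2 + b\<^sup>2 + 1) \<le> K"
    and A: "energy e 0 + I T (\<lambda>z. (norm (Rd z))\<^sup>2) / 2 + 2 * ((U + real CARD('n) + 1) * N 4 * face_L1) \<le> A"
    and "0 \<le> A"
  shows "(L2_on (Om T) e)\<^sup>2 \<le> A * (T + K * T\<^sup>2 * exp (K * T))"
proof -
  have K0: "0 < K"
  proof -
    have "0 < (2 + (lam + 1 / 2)\<^sup>2 / 2 + 18 * real CARD('n)) * (a\<^sup>2 + b\<^sup>2 + 1)"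
      by (intro mult_pos_pos add_nonneg_pos add_pos_nonneg) auto
    then show ?thesis using K by linarith
  qed
  have nonneg: "0 \<le> integral {0..s} (energy e)" if "s \<le> T" for s
    using integral_energy[OF continuous_on_subset[OF cont(1) Om_mono[OF that]]]
      integral_nonneg[OF integrable_Om[of T "\<lambda>z. (norm (e z))\<^sup>2" s]] that cont(1)
    by (simp add: continuous_intros)
  have "energy e s \<le> A + K * integral {0..s} (energy e)" if "s \<in> {0<..T}" for s
    using energy_inequality[of s a b] UV that A mult_right_mono[OF K nonneg[of s]] by fastforce
  then have "integral {0..T} (energy e) \<le> A * (T + K * T\<^sup>2 * exp (K * T))"
    by (intro gronwall_integral T K0 assms(5) energy_continuous cont(1)) auto
  then show ?thesis
    using L2_on_squared[OF cont(1)[unfolded Om_eq_cbox]] integral_energy[OF cont(1)] by (simp add: Om_eq_cbox)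
qed

text \<open>Cauchy-Schwarz over \<open>d\<close> copies of the cylinder, of total measure
  \<open>d * 2 ^ d * T\<close>. This is where the factor \<open>T powr (1 / 2)\<close> of
  \<open>C3_const\<close> originates.\<close>

lemma face_L1_le:
  "face_L1 \<le> sqrt (real CARD('n) * 2 ^ CARD('n) * T) *
     (\<Sum>i=1..4. sqrt (\<Sum>j\<in>UNIV. I T (\<lambda>z. (norm (face_jump j (trace_op T i j e) z))\<^sup>2)))"
  unfolding face_L1_def sum_distrib_left
proof (rule sum_mono)
  fix i :: nat assume i: "i \<in> {1..4}"
  let ?g = "\<lambda>j z. norm (face_jump j (trace_op T i j e) z)"
  have ct: "continuous_on (Om T) (trace_op T i j e)" for j
    by (rule Ck_bound_continuous[OF Ck_bound_trace_op[OF T, of 0 i]]) (use i e_bound[of i] N_nonneg[of i] in auto)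
  have cg: "continuous_on (Om T) (?g j)" for j
    by (intro continuous_intros face_jump_continuous ct)
  have g1: "I T (?g j) \<le> (2 ^ CARD('n) * T * a + I T (\<lambda>z. (?g j z)\<^sup>2) / a) / 2" if "0 < a" for a j
  proof -
    have "I T (?g j) \<le> I T (\<lambda>z. (a + (?g j z)\<^sup>2 / a) / 2)"
    proof (rule I_mono[OF order_refl cg])
      show "continuous_on (Om T) (\<lambda>z. (a + (?g j z)\<^sup>2 / a) / 2)"
        using that by (intro continuous_intros cg) auto
      show "?g j z \<le> (a + (?g j z)\<^sup>2 / a) / 2" for z
        using that sum_squares_bound[of a "?g j z"] by (simp add: field_simps power2_eq_square)
    qed
    also have "\<dots> = (I T (\<lambda>z. a) + I T (\<lambda>z. (?g j z)\<^sup>2) / a) / 2"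
      using that by (simp add: I_add[OF order_refl] continuous_on_power[OF cg] continuous_intros cg)
    also have "I T (\<lambda>z. a) = 2 ^ CARD('n) * T * a"
      using measure_Om[where 'n = 'n, of T] T by (simp add: Om_eq_cbox)
    finally show ?thesis .
  qed
  have "(\<Sum>j\<in>UNIV. I T (?g j)) \<le> sqrt (real CARD('n) * 2 ^ CARD('n) * T * (\<Sum>j\<in>UNIV. I T (\<lambda>z. (?g j z)\<^sup>2)))"
  proof (rule le_sqrt_if_le_balanced)
    fix a :: real assume "0 < a"
    have "(\<Sum>j\<in>UNIV. I T (?g j)) \<le> (\<Sum>j\<in>UNIV. (2 ^ CARD('n) * T * a + I T (\<lambda>z. (?g j z)\<^sup>2) / a) / 2)"
      by (intro sum_mono g1 \<open>0 < a\<close>)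
    also have "\<dots> = (real CARD('n) * 2 ^ CARD('n) * T * a + (\<Sum>j\<in>UNIV. I T (\<lambda>z. (?g j z)\<^sup>2)) / a) / 2"
      by (simp add: sum.distrib flip: sum_divide_distrib)
    finally show "(\<Sum>j\<in>UNIV. I T (?g j)) \<le> (real CARD('n) * 2 ^ CARD('n) * T * a + (\<Sum>j\<in>UNIV. I T (\<lambda>z. (?g j z)\<^sup>2)) / a) / 2" .
  qed (use T in \<open>auto intro!: sum_nonneg integral_nonneg integrable_Om[OF _ order_refl] continuous_intros cg\<close>)
  then show "(\<Sum>j\<in>UNIV. I T (?g j)) \<le> sqrt (real CARD('n) * 2 ^ CARD('n) * T) * sqrt (\<Sum>j\<in>UNIV. I T (\<lambda>z. (?g j z)\<^sup>2))"
    by (simp add: real_sqrt_mult)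
qed

end

section \<open>Midpoint grids\<close>

lemma mids_unique_index:
  assumes "0 < l" "0 < N"
  shows "inj_on (\<lambda>k. (real k + 1 / 2) * l / real N) {..<N}"
  using assms by (auto simp: inj_on_def)

lemma mids_eq_image: "mids l N = (\<lambda>k. (real k + 1 / 2) * l / real N) ` {..<N}"
  by (auto simp: mids_def)

lemma finite_mids: "finite (mids l N)"
  by (simp add: mids_eq_image)

lemma card_mids: "0 < l \<Longrightarrow> 0 < N \<Longrightarrow> card (mids l N) = N"
  by (simp add: mids_eq_image card_image[OF mids_unique_index])

lemma mids_bounds:
  assumes "m \<in> mids l N" "0 < l"
  shows "l / real N / 2 \<le> m" "m \<le> l - l / real N / 2"
proof -
  obtain k where k: "k < N" "m = (real k + 1 / 2) * l / real N" using assms by (auto simp: mids_def)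
  then have N: "0 < real N" by auto
  have "0 \<le> real k * l / real N" using assms by simp
  then show "l / real N / 2 \<le> m" using k by (simp add: add_divide_distrib distrib_right)
  have "real k + 1 \<le> real N" using k by simp
  then have "(real k + 1) * l \<le> real N * l" using assms by (intro mult_right_mono) auto
  then show "m \<le> l - l / real N / 2" using k N by (simp add: field_simps)
qed

lemma mids_strict_bounds:
  assumes "m \<in> mids l N" "0 < l"
  shows "0 < m" "m < l"
proof -
  have "0 < N" using assms by (auto simp: mids_def)
  then have "0 < l / real N / 2" using assms by simp
  then show "0 < m" "m < l" using mids_bounds[OF assms] by auto
qed

lemma mids_separated:
  assumes "m \<in> mids l N" "m' \<in> mids l N" "m \<noteq> m'" "0 < l"
  shows "l / real N \<le> \<bar>m - m'\<bar>"
proof -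
  obtain k k' where k: "k < N" "m = (real k + 1 / 2) * l / real N" "m' = (real k' + 1 / 2) * l / real N"
    using assms by (auto simp: mids_def)
  then have "k \<noteq> k'" using assms by auto
  then have "1 \<le> \<bar>real k - real k'\<bar>" by linarith
  moreover have "m - m' = (real k - real k') * (l / real N)"
    unfolding k by (simp add: add_divide_distrib distrib_right left_diff_distrib diff_divide_distrib)
  ultimately show ?thesis
    using mult_right_mono[of 1 "\<bar>real k - real k'\<bar>" "l / real N"] assms by (simp add: abs_mult)
qed

lemma mids_cover:
  assumes "0 < l" "0 < N" "0 \<le> x" "x \<le> l"
  shows "\<exists>m\<in>mids l N. \<bar>x - m\<bar> \<le> l / real N / 2"
proof -
  \<comment> \<open>The cap \<open>N - 1\<close> takes care of \<open>x = l\<close>, where the floor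
    would be \<open>N\<close>.\<close>
  define k where "k = min (N - 1) (nat \<lfloor>x * real N / l\<rfloor>)"
  have N: "0 < real N" using assms by simp
  have k: "k < N" using assms by (simp add: k_def)
  have y: "0 \<le> x * real N / l" "x * real N / l \<le> real N" using assms N by (simp_all add: field_simps)
  have "real k \<le> x * real N / l" "x * real N / l \<le> real k + 1"
  proof -
    show "real k \<le> x * real N / l" using y unfolding k_def by linarith
    show "x * real N / l \<le> real k + 1"
    proof (cases "nat \<lfloor>x * real N / l\<rfloor> \<le> N - 1")
      case True
      then have "k = nat \<lfloor>x * real N / l\<rfloor>" by (simp add: k_def)
      then show ?thesis using y(1) by linarith
    next
      case False
      then have "k = N - 1" by (simp add: k_def)
      then show ?thesis using y(2) assms by (simp add: of_nat_diff)
    qed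
  qed
  then have "real k * l \<le> x * real N" "x * real N \<le> (real k + 1) * l"
    using assms by (simp_all add: field_simps)
  then have "\<bar>x - (real k + 1 / 2) * l / real N\<bar> \<le> l / real N / 2"
    using N by (auto simp: abs_le_iff field_simps)
  then show ?thesis using k by (auto simp: mids_def)
qed

text \<open>Midpoints of the partition of \<open>cbox 0 u\<close> into \<open>n b\<close> slabs in direction \<open>b\<close>.\<close>

definition grid :: "'a::euclidean_space \<Rightarrow> ('a \<Rightarrow> nat) \<Rightarrow> 'a set" where
  "grid u n = {m. \<forall>b\<in>Basis. m \<bullet> b \<in> mids (u \<bullet> b) (n b)}"

definition grid_cell :: "'a::euclidean_space \<Rightarrow> ('a \<Rightarrow> nat) \<Rightarrow> 'a \<Rightarrow> 'a set" where
  "grid_cell u n m = {z. \<forall>b\<in>Basis. \<bar>z \<bullet> b - m \<bullet> b\<bar> \<le> u \<bullet> b / real (n b) / 2}"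

locale box_grid =
  fixes u :: "'a::euclidean_space" and n :: "'a \<Rightarrow> nat"
  assumes u: "\<And>b. b \<in> Basis \<Longrightarrow> 0 < u \<bullet> b" and n: "\<And>b. b \<in> Basis \<Longrightarrow> 0 < n b"
begin

lemma grid_bij: "bij_betw (\<lambda>g. \<Sum>b\<in>Basis. g b *\<^sub>R b) (PiE Basis (\<lambda>b. mids (u \<bullet> b) (n b))) (grid u n)"
  by (rule bij_betwI[where g = "\<lambda>m. \<lambda>b\<in>Basis. m \<bullet> b"])
    (auto simp: grid_def euclidean_representation PiE_iff extensional_def fun_eq_iff)

lemma finite_grid: "finite (grid u n)"
  using bij_betw_finite[OF grid_bij] by (auto intro: finite_PiE finite_mids)

lemma card_grid: "card (grid u n) = (\<Prod>b\<in>Basis. n b)"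
  using bij_betw_same_card[OF grid_bij] by (simp add: card_PiE card_mids u n)

lemma grid_cell_cbox: "grid_cell u n m = cbox (m - (\<Sum>b\<in>Basis. (u \<bullet> b / real (n b) / 2) *\<^sub>R b)) (m + (\<Sum>b\<in>Basis. (u \<bullet> b / real (n b) / 2) *\<^sub>R b))"
proof (rule set_eqI)
  fix z
  have "\<bar>z \<bullet> b - m \<bullet> b\<bar> \<le> c \<longleftrightarrow> m \<bullet> b - c \<le> z \<bullet> b \<and> z \<bullet> b \<le> m \<bullet> b + c" for b c by linarith
  then show "z \<in> grid_cell u n m \<longleftrightarrow> z \<in> cbox (m - (\<Sum>b\<in>Basis. (u \<bullet> b / real (n b) / 2) *\<^sub>R b)) (m + (\<Sum>b\<in>Basis. (u \<bullet> b / real (n b) / 2) *\<^sub>R b))"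
    by (simp add: grid_cell_def mem_box inner_diff_left inner_add_left)
qed

lemma grid_cell_subset: "m \<in> grid u n \<Longrightarrow> grid_cell u n m \<subseteq> cbox 0 u"
proof
  fix z assume m: "m \<in> grid u n" and z: "z \<in> grid_cell u n m"
  have "0 \<le> z \<bullet> b \<and> z \<bullet> b \<le> u \<bullet> b" if b: "b \<in> Basis" for b
  proof -
    have "m \<bullet> b \<in> mids (u \<bullet> b) (n b)" "\<bar>z \<bullet> b - m \<bullet> b\<bar> \<le> u \<bullet> b / real (n b) / 2"
      using m z b by (auto simp: grid_def grid_cell_def)
    then show ?thesis using mids_bounds[OF _ u[OF b]] by fastforce
  qed
  then show "z \<in> cbox 0 u" by (simp add: mem_box)
qed

lemma grid_subset: "grid u n \<subseteq> cbox 0 u"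
  using grid_cell_subset u by (auto simp: grid_cell_def less_imp_le subset_iff)

lemma grid_cover: "cbox 0 u = (\<Union>m\<in>grid u n. grid_cell u n m)"
proof
  show "(\<Union>m\<in>grid u n. grid_cell u n m) \<subseteq> cbox 0 u" using grid_cell_subset by blast
  show "cbox 0 u \<subseteq> (\<Union>m\<in>grid u n. grid_cell u n m)"
  proof
    fix z assume z: "z \<in> cbox 0 u"
    have "\<exists>m\<in>mids (u \<bullet> b) (n b). \<bar>z \<bullet> b - m\<bar> \<le> u \<bullet> b / real (n b) / 2" if "b \<in> Basis" for b
      using z that by (intro mids_cover u n) (auto simp: mem_box)
    then obtain g where g: "\<And>b. b \<in> Basis \<Longrightarrow> g b \<in> mids (u \<bullet> b) (n b) \<and> \<bar>z \<bullet> b - g b\<bar> \<le> u \<bullet> b / real (n b) / 2"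
      by metis
    let ?m = "\<Sum>b\<in>Basis. g b *\<^sub>R b"
    have "?m \<in> grid u n" "z \<in> grid_cell u n ?m" using g by (auto simp: grid_def grid_cell_def)
    then show "z \<in> (\<Union>m\<in>grid u n. grid_cell u n m)" by blast
  qed
qed

text \<open>Distinct midpoints differ in some coordinate by at least a full edge, so common points
  of their cells lie on the hyperplane halfway between them.\<close>

lemma negligible_grid_cells:
  assumes "m \<in> grid u n" "m' \<in> grid u n" "m \<noteq> m'"
  shows "negligible (grid_cell u n m \<inter> grid_cell u n m')"
proof -
  obtain b where b: "b \<in> Basis" "m \<bullet> b \<noteq> m' \<bullet> b" using assms(3) by (auto simp: euclidean_eq_iff[of m])
  have sep: "u \<bullet> b / real (n b) \<le> \<bar>m \<bullet> b - m' \<bullet> b\<bar>"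
    using assms b by (intro mids_separated u) (auto simp: grid_def)
  have "z \<bullet> b = (m \<bullet> b + m' \<bullet> b) / 2" if "z \<in> grid_cell u n m \<inter> grid_cell u n m'" for z
  proof -
    have "\<bar>z \<bullet> b - m \<bullet> b\<bar> \<le> u \<bullet> b / real (n b) / 2" "\<bar>z \<bullet> b - m' \<bullet> b\<bar> \<le> u \<bullet> b / real (n b) / 2"
      using that b by (auto simp: grid_cell_def)
    moreover have "p = (q + r) / 2" if "\<bar>p - q\<bar> \<le> w / 2" "\<bar>p - r\<bar> \<le> w / 2" "w \<le> \<bar>q - r\<bar>" for p q r w :: real
      using that by (simp add: abs_if split: if_splits)
    ultimately show ?thesis using sep by blast
  qed
  then have "grid_cell u n m \<inter> grid_cell u n m' \<subseteq> {z. z \<bullet> b = (m \<bullet> b + m' \<bullet> b) / 2}" by blast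
  then show ?thesis using negligible_subset[OF negligible_standard_hyperplane[OF b(1)]] by blast
qed

lemma integral_grid:
  fixes f :: "'a \<Rightarrow> real"
  assumes "continuous_on (cbox 0 u) f"
  shows "integral (cbox 0 u) f = (\<Sum>m\<in>grid u n. integral (grid_cell u n m) f)"
proof -
  have "(f has_integral integral (grid_cell u n m) f) (grid_cell u n m)" if "m \<in> grid u n" for m
    using continuous_on_subset[OF assms grid_cell_subset[OF that]] unfolding grid_cell_cbox
    by (intro integrable_integral integrable_continuous)
  then have "(f has_integral (\<Sum>m\<in>grid u n. integral (grid_cell u n m) f)) (\<Union>m\<in>grid u n. grid_cell u n m)"
    using negligible_grid_cells by (intro has_integral_UN finite_grid) (auto simp: pairwise_def)
  then show ?thesis unfolding grid_cover by (rule integral_unique)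
qed

lemma measure_grid_cell: "measure lborel (grid_cell u n m) = measure lborel (cbox 0 u) / real (card (grid u n))"
proof -
  have "0 \<le> u \<bullet> b / real (n b) / 2" if "b \<in> Basis" for b using u[OF that] by simp
  then have "measure lborel (grid_cell u n m) = (\<Prod>b\<in>Basis. u \<bullet> b / real (n b))"
    unfolding grid_cell_cbox by (subst content_cbox) (auto simp: inner_add_left inner_diff_left intro!: prod.cong)
  also have "\<dots> = measure lborel (cbox 0 u) / real (card (grid u n))"
    using u by (subst content_cbox) (auto simp: card_grid prod_dividef less_imp_le)
  finally show ?thesis .
qed

text \<open>\<open>H m\<close> may be any upper bound on the cell, so that a Young inequality with a
  chosen weight can be applied cell by cell before summation.\<close>

lemma integral_le_grid_sum:
  fixes f :: "'a \<Rightarrow> real"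
  assumes f: "continuous_on (cbox 0 u) f" and H: "\<And>m z. m \<in> grid u n \<Longrightarrow> z \<in> grid_cell u n m \<Longrightarrow> f z \<le> H m"
  shows "integral (cbox 0 u) f \<le> measure lborel (cbox 0 u) / real (card (grid u n)) * (\<Sum>m\<in>grid u n. H m)"
  unfolding integral_grid[OF f] sum_distrib_left
proof (rule sum_mono)
  fix m assume m: "m \<in> grid u n"
  have "f integrable_on grid_cell u n m"
    using continuous_on_subset[OF f grid_cell_subset[OF m]] unfolding grid_cell_cbox by (rule integrable_continuous)
  then have "integral (grid_cell u n m) f \<le> integral (grid_cell u n m) (\<lambda>z. H m)"
    using H[OF m] by (intro integral_le) (auto simp: grid_cell_cbox)
  also have "\<dots> = measure lborel (grid_cell u n m) * H m"
    unfolding grid_cell_cbox by simp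
  finally show "integral (grid_cell u n m) f \<le> measure lborel (cbox 0 u) / real (card (grid u n)) * H m"
    by (simp add: measure_grid_cell)
qed

text \<open>By symmetry of the cell about its midpoint; the integrand is the \<open>b\<close>-derivative of \<open>(z \<bullet> b - m \<bullet> b)\<^sup>2 / 2\<close>.\<close>

lemma integral_coordinate_grid_cell:
  assumes b: "b \<in> Basis"
  shows "integral (grid_cell u n m) (\<lambda>z. z \<bullet> b - m \<bullet> b) = 0"
proof -
  let ?w = "\<Sum>b\<in>Basis. (u \<bullet> b / real (n b) / 2) *\<^sub>R b"
  have w: "0 < ?w \<bullet> b" using u[OF b] n[OF b] b by simp
  have D: "((\<lambda>z. (z \<bullet> b - m \<bullet> b)\<^sup>2 / 2) has_derivative (\<lambda>h. (z \<bullet> b - m \<bullet> b) * (h \<bullet> b))) (at z within S)" for z S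
    by (auto intro!: derivative_eq_intros)
  have "((m + ?w) \<bullet> b - (m - ?w) \<bullet> b) * integral (cbox (m - ?w) (m + ?w)) (\<lambda>z. (z \<bullet> b - m \<bullet> b) * (b \<bullet> b)) =
    integral (cbox (m - ?w) (m + ?w)) (\<lambda>z. (coord_upd b ((m + ?w) \<bullet> b) z \<bullet> b - m \<bullet> b)\<^sup>2 / 2 - (coord_upd b ((m - ?w) \<bullet> b) z \<bullet> b - m \<bullet> b)\<^sup>2 / 2)"
    by (rule integral_partial_derivative[OF b _ D])
      (use w in \<open>auto simp: inner_add_left inner_diff_left simp del: inner_sum_left_Basis intro!: continuous_intros\<close>)
  also have "\<dots> = 0" using b by (simp add: inner_coord_upd inner_add_left inner_diff_left del: inner_sum_left_Basis)
  finally show ?thesis using w b unfolding grid_cell_cbox by (simp add: inner_add_left inner_diff_left del: inner_sum_left_Basis)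
qed

lemma integral_linear_grid_cell:
  fixes g :: "'a \<Rightarrow> real"
  assumes "linear g"
  shows "integral (grid_cell u n m) (\<lambda>z. g (z - m)) = 0"
proof -
  have "g (z - m) = (\<Sum>b\<in>Basis. g b * (z \<bullet> b - m \<bullet> b))" for z
  proof -
    have "g (z - m) = g (\<Sum>b\<in>Basis. ((z - m) \<bullet> b) *\<^sub>R b)" by (simp add: euclidean_representation)
    also have "\<dots> = (\<Sum>b\<in>Basis. ((z - m) \<bullet> b) * g b)" by (simp add: linear_sum[OF assms] linear_scale[OF assms])
    finally show ?thesis by (simp add: inner_diff_left mult.commute)
  qed
  then have "integral (grid_cell u n m) (\<lambda>z. g (z - m)) = integral (grid_cell u n m) (\<lambda>z. \<Sum>b\<in>Basis. g b * (z \<bullet> b - m \<bullet> b))"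
    by simp
  also have "\<dots> = (\<Sum>b\<in>Basis. integral (grid_cell u n m) (\<lambda>z. g b * (z \<bullet> b - m \<bullet> b)))"
    unfolding grid_cell_cbox
    by (rule Henstock_Kurzweil_Integration.integral_sum) (auto intro!: integrable_continuous continuous_intros)
  also have "\<dots> = 0"
    by (simp add: integral_coordinate_grid_cell)
  finally show ?thesis .
qed

text \<open>The linear part integrates to 0 over each cell by symmetry, so only the remainder
  \<open>B\<close> is felt and the quadrature sum keeps the coefficient 1.\<close>

lemma midpoint_rule:
  fixes f :: "'a \<Rightarrow> real"
  assumes f: "continuous_on (cbox 0 u) f" and lin: "\<And>m. m \<in> grid u n \<Longrightarrow> linear (g m)"
    and B: "\<And>m z. m \<in> grid u n \<Longrightarrow> z \<in> grid_cell u n m \<Longrightarrow> f z \<le> f m + g m (z - m) + B"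
  shows "integral (cbox 0 u) f \<le> measure lborel (cbox 0 u) / real (card (grid u n)) * (\<Sum>m\<in>grid u n. f m) + measure lborel (cbox 0 u) * B"
proof -
  have "integral (grid_cell u n m) f \<le> measure lborel (cbox 0 u) / real (card (grid u n)) * (f m + B)" if m: "m \<in> grid u n" for m
  proof -
    have i: "f integrable_on grid_cell u n m"
      using continuous_on_subset[OF f grid_cell_subset[OF m]] unfolding grid_cell_cbox by (rule integrable_continuous)
    have l: "(\<lambda>z. g m (z - m)) integrable_on grid_cell u n m" unfolding grid_cell_cbox
      by (intro integrable_continuous linear_continuous_on_compose[OF _ lin[OF m]] continuous_intros)
    have c: "(\<lambda>z. f m + B) integrable_on grid_cell u n m" unfolding grid_cell_cbox by (rule integrable_const)
    have "integral (grid_cell u n m) f \<le> integral (grid_cell u n m) (\<lambda>z. g m (z - m) + (f m + B))"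
      using B[OF m] by (intro integral_le i Henstock_Kurzweil_Integration.integrable_add l c) (auto simp: algebra_simps)
    also have "\<dots> = integral (grid_cell u n m) (\<lambda>z. g m (z - m)) + integral (grid_cell u n m) (\<lambda>z. f m + B)"
      by (rule Henstock_Kurzweil_Integration.integral_add[OF l c])
    also have "\<dots> = integral (grid_cell u n m) (\<lambda>z. f m + B)"
      by (simp add: integral_linear_grid_cell[OF lin[OF m]])
    also have "\<dots> = measure lborel (grid_cell u n m) * (f m + B)"
      unfolding grid_cell_cbox by simp
    finally show ?thesis by (simp add: measure_grid_cell)
  qed
  then have "integral (cbox 0 u) f \<le> (\<Sum>m\<in>grid u n. measure lborel (cbox 0 u) / real (card (grid u n)) * (f m + B))"
    unfolding integral_grid[OF f] by (rule sum_mono)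
  also have "\<dots> = measure lborel (cbox 0 u) / real (card (grid u n)) * (\<Sum>m\<in>grid u n. f m) + measure lborel (cbox 0 u) * B"
  proof -
    have "card (grid u n) \<noteq> 0" using n by (simp add: card_grid)
    then show ?thesis unfolding sum_distrib_left[symmetric] sum.distrib by (simp add: distrib_left)
  qed
  finally show ?thesis .
qed

lemma norm_grid_cell_le:
  assumes "z \<in> grid_cell u n m" "\<And>b. b \<in> Basis \<Longrightarrow> u \<bullet> b / real (n b) \<le> h"
  shows "norm (z - m) \<le> real DIM('a) * h"
proof -
  have "norm (z - m) \<le> (\<Sum>b\<in>Basis. \<bar>(z - m) \<bullet> b\<bar>)" by (rule norm_le_l1)
  also have "\<dots> \<le> (\<Sum>b\<in>(Basis::'a set). h)"
  proof (rule sum_mono)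
    fix b :: 'a assume b: "b \<in> Basis"
    have "0 \<le> u \<bullet> b / real (n b)" using u[OF b] by simp
    then show "\<bar>(z - m) \<bullet> b\<bar> \<le> h"
      using assms(1) assms(2)[OF b] b by (auto simp: grid_cell_def inner_diff_left)
  qed
  finally show ?thesis by simp
qed

end

section \<open>Lipschitz and Taylor estimates from bounds on partial derivatives\<close>

lemma norm_linear_le_Basis:
  fixes D :: "'a::euclidean_space \<Rightarrow> 'b::real_normed_vector"
  assumes "linear D" "\<And>b. b \<in> Basis \<Longrightarrow> norm (D b) \<le> X"
  shows "norm (D h) \<le> real DIM('a) * X * norm h"
proof -
  have "D h = (\<Sum>b\<in>Basis. (h \<bullet> b) *\<^sub>R D b)"
    using linear_sum[OF assms(1), of "\<lambda>b. (h \<bullet> b) *\<^sub>R b" Basis]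
    by (simp add: euclidean_representation linear_scale[OF assms(1)])
  also have "norm \<dots> \<le> (\<Sum>b\<in>(Basis::'a set). norm h * X)"
    using assms(2) by (intro sum_norm_le) (auto intro!: mult_mono Basis_le_norm)
  finally show ?thesis by (simp add: mult_ac)
qed

lemma Ck_bound_lipschitz:
  fixes f :: "'a::euclidean_space \<Rightarrow> 'b::real_normed_vector"
  assumes "Ck_bound (Suc k) S f X 1" "convex S" "x \<in> S" "y \<in> S"
  shows "norm (f x - f y) \<le> real DIM('a) * X * norm (x - y)"
proof (rule differentiable_bound[OF assms(2) _ _ assms(3,4)])
  have f: "f differentiable_on S" using assms(1) by simp
  fix z assume z: "z \<in> S"
  show D: "(f has_derivative frechet_derivative f (at z within S)) (at z within S)"
    by (rule has_derivative_frechet[OF f z])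
  have "norm (frechet_derivative f (at z within S) b) \<le> X" if "b \<in> Basis" for b
    using Ck_bound_norm[of k S "pder S b f" "X * 1" 1 z] assms(1) that z by (simp add: pder_def)
  then show "onorm (frechet_derivative f (at z within S)) \<le> real DIM('a) * X"
    by (intro onorm_le norm_linear_le_Basis has_derivative_linear[OF D])
qed

text \<open>The mean value inequality for \<open>f\<close> minus its linear part at
  \<open>m\<close>; the derivative of this difference, \<open>?D y - ?D m\<close>, is small by the
  Lipschitz bound for the partial derivatives.\<close>

lemma Ck_bound_taylor:
  fixes f :: "'a::euclidean_space \<Rightarrow> 'b::real_normed_vector"
  assumes f: "Ck_bound (Suc (Suc k)) S f X 1" and S: "convex S" and m: "m \<in> S" and z: "z \<in> S"
  shows "norm (f z - f m - frechet_derivative f (at m within S) (z - m)) \<le> (real DIM('a))\<^sup>2 * X * (norm (z - m))\<^sup>2"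
proof -
  let ?D = "\<lambda>y. frechet_derivative f (at y within S)"
  \<comment> \<open>The ball keeps \<open>norm (y - m)\<close> below \<open>norm (z - m)\<close> and
    the set convex.\<close>
  let ?S = "S \<inter> cball m (norm (z - m))"
  have df: "f differentiable_on S" using f by simp
  have D: "(f has_derivative ?D y) (at y within S)" if "y \<in> S" for y
    by (rule has_derivative_frechet[OF df that])
  have bl: "bounded_linear (?D m)" by (rule has_derivative_bounded_linear[OF D[OF m]])
  have "norm ((f z - ?D m z) - (f m - ?D m m)) \<le> (real DIM('a) * (real DIM('a) * X * norm (z - m))) * norm (z - m)"
  proof (rule differentiable_bound[of ?S])
    show "convex ?S" by (intro convex_Int S convex_cball)
    show "z \<in> ?S" "m \<in> ?S" using z m by (auto simp: dist_norm norm_minus_commute)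
    fix y assume y: "y \<in> ?S"
    have "((\<lambda>y. f y - ?D m y) has_derivative (\<lambda>h. ?D y h - ?D m h)) (at y within S)"
      using y by (intro has_derivative_diff D bounded_linear.has_derivative[OF bl has_derivative_ident]) auto
    then show H: "((\<lambda>y. f y - ?D m y) has_derivative (\<lambda>h. ?D y h - ?D m h)) (at y within ?S)"
      by (rule has_derivative_subset) auto
    show "onorm (\<lambda>h. ?D y h - ?D m h) \<le> real DIM('a) * (real DIM('a) * X * norm (z - m))"
    proof (rule onorm_le, rule norm_linear_le_Basis[OF has_derivative_linear[OF H]])
      fix b :: 'a assume b: "b \<in> Basis"
      have "Ck_bound (Suc k) S (pder S b f) X 1" using f b by simp
      from Ck_bound_lipschitz[OF this S, of y m] have "norm (?D y b - ?D m b) \<le> real DIM('a) * X * norm (y - m)"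
        using y m by (simp add: pder_def)
      also have "\<dots> \<le> real DIM('a) * X * norm (z - m)"
      proof (rule mult_left_mono)
        show "norm (y - m) \<le> norm (z - m)" using y by (auto simp: dist_norm norm_minus_commute)
        have "norm (f m) \<le> X" using Ck_bound_norm[OF f m] .
        then show "0 \<le> real DIM('a) * X" using norm_ge_zero[of "f m"] by (simp del: norm_ge_zero)
      qed
      finally show "norm (?D y b - ?D m b) \<le> real DIM('a) * X * norm (z - m)" .
    qed
  qed
  moreover have "(f z - ?D m z) - (f m - ?D m m) = f z - f m - ?D m (z - m)"
    by (simp add: linear_diff[OF bounded_linear.linear[OF bl]])
  ultimately show ?thesis by (simp add: power2_eq_square mult_ac)
qed

section \<open>Quadrature of the residuals\<close>

lemma le_powr_inverse:
  fixes h y :: real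
  assumes "0 \<le> h" "h ^ p \<le> y" "0 < p"
  shows "h \<le> y powr (1 / real p)"
proof (cases "h = 0")
  case False
  then have "0 < h" using assms by simp
  then have "h = (h ^ p) powr (1 / real p)"
    using assms(3) by (simp add: powr_realpow[symmetric] powr_powr)
  also have "\<dots> \<le> y powr (1 / real p)"
    using assms \<open>0 < h\<close> by (intro powr_mono2) auto
  finally show ?thesis .
qed simp

lemma near_cubes_mesh:
  assumes "near_cubes kap T N K" "1 \<le> kap" "0 < T"
  defines "h \<equiv> max (2 / real N) (T / real K)"
  shows "0 < h" "h \<le> kap * (2 / real N)" "h \<le> kap * (T / real K)" "0 < N" "0 < K"
proof -
  have NK: "0 < N" "0 < K" using assms by (auto simp: near_cubes_def)
  then show "0 < N" "0 < K" by auto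
  have pos: "0 < 2 / real N" "0 < T / real K" using NK assms by auto
  then show "0 < h" by (simp add: h_def less_max_iff_disj)
  have "1 * (2 / real N) \<le> kap * (2 / real N)" "1 * (T / real K) \<le> kap * (T / real K)"
    using assms(2) pos by (intro mult_right_mono; simp)+
  then show "h \<le> kap * (2 / real N)" "h \<le> kap * (T / real K)"
    using assms(1) by (auto simp: h_def near_cubes_def)
qed

text \<open>Each edge of a cell is at least \<open>?h / kap\<close>, so the power
  \<open>d + 1\<close> of this length is at most the cell volume, \<open>2 ^ d * T\<close> divided
  by the number of nodes.\<close>

lemma near_cubes_mesh_int:
  assumes "near_cubes kap T N K" "1 \<le> kap" "0 < T"
  shows "(max (2 / real N) (T / real K))\<^sup>2 \<le>
    kap\<^sup>2 * (2 ^ d * T) powr (2 / (real d + 1)) * (real N ^ d * real K) powr (- 2 / (real d + 1))"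
proof -
  let ?h = "max (2 / real N) (T / real K)"
  note h = near_cubes_mesh[OF assms]
  have hk: "?h / kap \<le> 2 / real N" "?h / kap \<le> T / real K" "0 \<le> ?h / kap"
    using h(1-3) assms(2) by (simp_all add: pos_divide_le_eq mult.commute del: times_divide_eq_right times_divide_eq_left)
  have "(?h / kap) ^ d * (?h / kap) \<le> (2 / real N) ^ d * (T / real K)"
    using hk by (intro mult_mono power_mono zero_le_power) auto
  then have "(?h / kap) ^ Suc d \<le> (2 / real N) ^ d * (T / real K)" by (simp add: mult.commute)
  also have "\<dots> = 2 ^ d * T / (real N ^ d * real K)"
    by (simp add: power_divide)
  finally have "?h / kap \<le> (2 ^ d * T / (real N ^ d * real K)) powr (1 / real (Suc d))"
    using h assms by (intro le_powr_inverse) (auto simp: le_max_iff_disj)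
  then have "(?h / kap)\<^sup>2 \<le> ((2 ^ d * T / (real N ^ d * real K)) powr (1 / real (Suc d)))\<^sup>2"
    using h assms by (intro power_mono) (auto simp: le_max_iff_disj)
  also have "\<dots> = (2 ^ d * T / (real N ^ d * real K)) powr (2 / (real d + 1))"
    using h assms by (subst powr_realpow[symmetric]) (auto simp: powr_powr add.commute)
  also have "\<dots> = (2 ^ d * T) powr (2 / (real d + 1)) * (real N ^ d * real K) powr (- 2 / (real d + 1))"
    using h assms by (simp add: powr_divide powr_minus_divide)
  finally show ?thesis using assms(2) by (simp add: power_divide field_simps)
qed

text \<open>Boundary cells have \<open>d\<close> edges, \<open>d - 1\<close> in space and one in
  time; their volume is the lateral measure \<open>d * 2 ^ d * T\<close> divided by the number of
  boundary nodes.\<close>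

lemma near_cubes_mesh_sb:
  assumes "near_cubes kap T N K" "1 \<le> kap" "0 < T" "0 < d"
  shows "max (2 / real N) (T / real K) \<le>
    kap * (real d * 2 ^ d * T) powr (1 / real d) * (2 * real d * real N ^ (d - 1) * real K) powr (- 1 / real d)"
proof -
  let ?h = "max (2 / real N) (T / real K)"
  note h = near_cubes_mesh[OF assms(1-3)]
  obtain d' where d': "d = Suc d'" using assms(4) by (cases d) auto
  have hk: "?h / kap \<le> 2 / real N" "?h / kap \<le> T / real K" "0 \<le> ?h / kap"
    using h(1-3) assms(2) by (simp_all add: pos_divide_le_eq mult.commute del: times_divide_eq_right times_divide_eq_left)
  have "(?h / kap) ^ d' * (?h / kap) \<le> (2 / real N) ^ d' * (T / real K)"
    using hk by (intro mult_mono power_mono zero_le_power) auto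
  then have "(?h / kap) ^ d \<le> (2 / real N) ^ d' * (T / real K)" by (simp add: mult.commute d')
  also have "\<dots> = (real d * 2 ^ d * T) / (2 * real d * real N ^ (d - 1) * real K)"
    using assms(4) by (simp add: power_divide d' del: of_nat_Suc)
  finally have "?h / kap \<le> ((real d * 2 ^ d * T) / (2 * real d * real N ^ (d - 1) * real K)) powr (1 / real d)"
    using h assms by (intro le_powr_inverse) (auto simp: le_max_iff_disj)
  also have "\<dots> = (real d * 2 ^ d * T) powr (1 / real d) * (2 * real d * real N ^ (d - 1) * real K) powr (- 1 / real d)"
    using h assms by (subst powr_divide) (auto simp: powr_minus_divide)
  finally show ?thesis using assms(2) by (simp add: field_simps)
qed

lemma mesh_t:
  assumes "0 < N" "0 < d"
  shows "(2 / real N)\<^sup>2 = 4 * (real N ^ d) powr (- 2 / real d)"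
proof -
  have "(real N ^ d) powr (- 2 / real d) = real N powr (- 2)"
    using assms by (simp add: powr_realpow[symmetric] powr_powr)
  then show ?thesis using assms by (simp add: powr_minus powr_numeral power_divide divide_inverse power_inverse)
qed

section \<open>Grids of the cylinder and of its lateral boundary\<close>

definition st_corner :: "real \<Rightarrow> 'n::finite spacetime" where
  "st_corner T = (\<chi> i. 2, T)"

definition st_count :: "nat \<Rightarrow> nat \<Rightarrow> 'n::finite spacetime \<Rightarrow> nat" where
  "st_count N K B = (if B = (0, 1) then K else N)"

lemma Om_corner: "Om T = cbox 0 (st_corner T)"
  by (simp add: Om_eq_cbox st_corner_def zero_prod_def)

lemma ball_Basis_spacetime:
  "(\<forall>B\<in>(Basis :: 'n::finite spacetime set). P B) \<longleftrightarrow> (\<forall>i. P (axis i 1, 0)) \<and> P (0, 1)"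
  by (auto simp: Basis_prod_def Basis_vec_def)

lemma box_grid_spacetime:
  assumes "0 < T" "0 < N" "0 < K"
  shows "box_grid (st_corner T :: 'n::finite spacetime) (st_count N K)"
proof -
  have "\<forall>B\<in>(Basis :: 'n spacetime set). 0 < st_corner T \<bullet> B \<and> 0 < st_count N K B"
    using assms unfolding ball_Basis_spacetime by (simp add: st_corner_def st_count_def inner_axis)
  then show ?thesis unfolding box_grid_def by blast
qed

abbreviation interior_grid :: "real \<Rightarrow> nat \<Rightarrow> nat \<Rightarrow> 'n::finite spacetime set" where
  "interior_grid T N K \<equiv> {x. \<forall>i. x $ i \<in> mids 2 N} \<times> mids T K"

abbreviation boundary_grid :: "real \<Rightarrow> nat \<Rightarrow> nat \<Rightarrow> 'n::finite spacetime set" where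
  "boundary_grid T N K \<equiv> {x. \<exists>i. x $ i \<in> {0, 2} \<and> (\<forall>j. j \<noteq> i \<longrightarrow> x $ j \<in> mids 2 N)} \<times> mids T K"

lemma grid_spacetime: "grid (st_corner T :: 'n::finite spacetime) (st_count N K) = interior_grid T N K"
proof (rule set_eqI)
  fix z :: "'n spacetime"
  show "z \<in> grid (st_corner T) (st_count N K) \<longleftrightarrow> z \<in> interior_grid T N K"
    unfolding grid_def mem_Collect_eq ball_Basis_spacetime
    by (cases z) (simp add: st_corner_def st_count_def inner_axis)
qed

lemma box_grid_cell: "0 < N \<Longrightarrow> box_grid (\<chi> i. 2 :: real ^ 'n::finite) (\<lambda>_. N)"
  by (auto simp: box_grid_def Basis_vec_def inner_axis)

lemma grid_cell_points: "grid (\<chi> i. 2 :: real ^ 'n::finite) (\<lambda>_. N) = {x. \<forall>i. x $ i \<in> mids 2 N}"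
  by (auto simp: grid_def Basis_vec_def inner_axis)

lemma card_space_grid: "0 < N \<Longrightarrow> card {x :: real ^ 'n::finite. \<forall>i. x $ i \<in> mids 2 N} = N ^ CARD('n)"
  using box_grid.card_grid[OF box_grid_cell[where 'n = 'n], of N] by (simp add: grid_cell_points)

lemma card_spacetime_grid:
  "0 < T \<Longrightarrow> 0 < N \<Longrightarrow> 0 < K \<Longrightarrow> card (interior_grid T N K :: 'n::finite spacetime set) = N ^ CARD('n) * K"
  by (simp add: card_cartesian_product card_space_grid card_mids)

lemma spacetime_mesh:
  assumes "B \<in> (Basis :: 'n::finite spacetime set)"
  shows "st_corner T \<bullet> B / real (st_count N K B) \<le> max (2 / real N) (T / real K)"
proof -
  have "\<forall>B\<in>(Basis :: 'n spacetime set). st_corner T \<bullet> B / real (st_count N K B) \<le> max (2 / real N) (T / real K)"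
    unfolding ball_Basis_spacetime by (simp add: st_corner_def st_count_def inner_axis)
  then show ?thesis using assms by blast
qed

lemma measure_lebesgue_Om: "0 \<le> T \<Longrightarrow> measure lebesgue (Om T :: 'n::finite spacetime set) = 2 ^ CARD('n) * T"
  using measure_Om[where 'n = 'n, of T] by (simp add: Om_eq_cbox measure_completion)

lemma measure_lebesgue_cell: "measure lebesgue (cell :: (real ^ 'n::finite) set) = 2 ^ CARD('n)"
  using measure_cell[where 'n = 'n] by (simp add: cell_eq_cbox measure_completion)

definition face_grid :: "real \<Rightarrow> nat \<Rightarrow> nat \<Rightarrow> 'n \<Rightarrow> real \<Rightarrow> 'n::finite spacetime set" where
  "face_grid T N K j c = {x. x $ j = c \<and> (\<forall>k. k \<noteq> j \<longrightarrow> x $ k \<in> mids 2 N)} \<times> mids T K"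

text \<open>Projection along axis \<open>j\<close> maps the full grid onto the grid of a face with fibres of \<open>N\<close> points.\<close>

lemma sum_face_grid:
  fixes g :: "'n::finite spacetime \<Rightarrow> real"
  assumes "0 < N"
  shows "real N * sum g (face_grid T N K j c) = (\<Sum>m\<in>interior_grid T N K. g (side j c m))"
proof -
  have "(\<Sum>m\<in>interior_grid T N K. g (side j c m))
      = (\<Sum>p\<in>face_grid T N K j c \<times> mids 2 N. g (fst p))"
    by (rule sum.reindex_bij_witness[where i = "\<lambda>p. side j (snd p) (fst p)" and j = "\<lambda>m. (side j c m, fst m $ j)"])
      (auto simp: face_grid_def side_def vec_eq_iff)
  also have "\<dots> = (\<Sum>y\<in>face_grid T N K j c. \<Sum>r\<in>mids 2 N. g y)"
    unfolding sum.cartesian_product by (simp add: split_beta)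
  also have "\<dots> = real N * sum g (face_grid T N K j c)"
    using assms by (simp add: card_mids sum_distrib_left)
  finally show ?thesis by simp
qed

lemma finite_face_grid: "finite (face_grid T N K j c :: 'n::finite spacetime set)"
proof -
  have "finite {x :: real ^ 'n. \<forall>k. x $ k \<in> insert c (mids 2 N)}"
    by (rule finite_subset[OF _ finite_imageI[OF finite_PiE[of UNIV "\<lambda>_. insert c (mids 2 N)"], of "\<lambda>g. \<chi> k. g k"]])
      (auto simp: finite_mids image_iff intro!: bexI[of _ "vec_nth _"])
  then have "finite ({x :: real ^ 'n. \<forall>k. x $ k \<in> insert c (mids 2 N)} \<times> mids T K)"
    by (simp add: finite_mids)
  then show ?thesis by (rule finite_subset[rotated]) (auto simp: face_grid_def)
qed

lemma boundary_grid_eq: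
  "(boundary_grid T N K :: 'n::finite spacetime set)
    = (\<Union>p\<in>UNIV \<times> {0, 2}. face_grid T N K (fst p) (snd p))"
  by (fastforce simp: face_grid_def)

text \<open>Midpoints avoid 0 and 2, so every boundary node lies on exactly one face. Summing over
  the interior grid matches integrals over \<open>Om T\<close> of functions of
  \<open>side\<close>.\<close>

lemma sum_boundary_grid:
  fixes g :: "'n::finite spacetime \<Rightarrow> real"
  assumes "0 < N"
  shows "real N * sum g (boundary_grid T N K)
    = (\<Sum>j\<in>UNIV. \<Sum>m\<in>interior_grid T N K. g (side j 0 m) + g (side j 2 m))"
proof -
  have no: "x $ j \<notin> {0, 2}" if "x $ j \<in> mids 2 N" for x :: "real ^ 'n" and j
    using mids_strict_bounds[OF that] by auto
  have "face_grid T N K (fst p) (snd p) \<inter> face_grid T N K (fst q) (snd q) = {}"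
    if pq: "p \<in> UNIV \<times> {0, 2}" "q \<in> UNIV \<times> {0, 2}" "p \<noteq> q" for p q :: "'n \<times> real"
  proof (rule ccontr)
    assume "\<not> ?thesis"
    then obtain x t where "(x, t) \<in> face_grid T N K (fst p) (snd p)" "(x, t) \<in> face_grid T N K (fst q) (snd q)" by fast
    then have x: "x $ fst p = snd p" "x $ fst q = snd q" "fst p \<noteq> fst q \<Longrightarrow> x $ fst p \<in> mids 2 N"
      by (auto simp: face_grid_def)
    show False
    proof (cases "fst p = fst q")
      case True
      then show False using x pq(3) by (simp add: prod_eq_iff)
    next
      case False
      then show False using x(1) no[OF x(3)] pq(1) by auto
    qed
  qed
  then have "sum g (boundary_grid T N K)
    = (\<Sum>p\<in>UNIV \<times> {0, 2}. sum g (face_grid T N K (fst p) (snd p)))"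
    unfolding boundary_grid_eq by (intro sum.UNION_disjoint) (auto simp: finite_face_grid)
  also have "\<dots> = (\<Sum>j\<in>UNIV. \<Sum>c\<in>{0, 2}. sum g (face_grid T N K j c))"
    unfolding sum.cartesian_product by (simp add: split_beta)
  finally have *: "sum g (boundary_grid T N K)
    = (\<Sum>j\<in>UNIV. sum g (face_grid T N K j 0) + sum g (face_grid T N K j 2))" by simp
  show ?thesis
    by (subst *, subst sum_distrib_left) (simp only: distrib_left sum_face_grid[OF assms] sum.distrib)
qed

text \<open>The preceding identity for the constant function 1 does the counting.\<close>

lemma card_boundary_grid:
  assumes "0 < N" "0 < T" "0 < K"
  shows "real (card (boundary_grid T N K :: 'n::finite spacetime set))
    = 2 * real CARD('n) * real N ^ (CARD('n) - 1) * real K"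
proof -
  have "real N * real (card (boundary_grid T N K :: 'n spacetime set))
    = 2 * real CARD('n) * (real N ^ CARD('n) * real K)"
    using sum_boundary_grid[where 'n = 'n, OF assms(1), of "\<lambda>_. 1" T K]
    by (simp add: card_spacetime_grid[OF assms(2,1,3)] card_cartesian_product[symmetric] del: card_cartesian_product)
  also have "real N ^ CARD('n) = real N * real N ^ (CARD('n) - 1)"
    by (subst power_Suc[symmetric]) simp
  finally show ?thesis using assms(1) by simp
qed

section \<open>Residuals expressed by the error, and their quadrature\<close>

context periodic_error
begin

lemma dx_split: "z \<in> Om T \<Longrightarrow> dx T j e z = dx T j v z - dx T j u z"
  unfolding e_def by (rule dx_diff[OF T differentiable(3,2)])

lemma lap_split: "z \<in> Om T \<Longrightarrow> lap T e z = lap T v z - lap T u z"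
  unfolding e_def by (rule lap_diff[OF T v_bound u_bound]) auto

lemma B6: "Ck_bound (Suc (Suc (Suc (Suc (Suc (Suc 0)))))) (Om T) e (N 6) 1"
  "Ck_bound (Suc (Suc (Suc (Suc (Suc (Suc 0)))))) (Om T) u U 1"
  "Ck_bound (Suc (Suc (Suc (Suc (Suc (Suc 0)))))) (Om T) v (Ck_norm 6 (Om T) v) 1"
  using e_bound[of 6] u_bound[of 6] v_bound[of 6] by (simp_all add: eval_nat_numeral)

lemma dx_lap_split: "z \<in> Om T \<Longrightarrow> dx T j (lap T e) z = dx T j (lap T v) z - dx T j (lap T u) z"
proof -
  assume z: "z \<in> Om T"
  have "dx T j (lap T e) z = dx T j (\<lambda>z. lap T v z - lap T u z) z"
    by (rule dx_cong[OF lap_split z])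
  also have "\<dots> = dx T j (lap T v) z - dx T j (lap T u) z"
    by (intro dx_diff T z Ck_bound_differentiable[OF Ck_bound_lap[OF T B6(3)]] Ck_bound_differentiable[OF Ck_bound_lap[OF T B6(2)]])
  finally show ?thesis .
qed

lemma lap_lap_split: "z \<in> Om T \<Longrightarrow> lap T (lap T e) z = lap T (lap T v) z - lap T (lap T u) z"
proof -
  assume z: "z \<in> Om T"
  have "lap T (lap T e) z = lap T (\<lambda>z. lap T v z - lap T u z) z"
    by (rule lap_cong[OF lap_split z])
  also have "\<dots> = lap T (lap T v) z - lap T (lap T u) z"
    using Ck_bound_le[OF _ Ck_bound_lap[OF T B6(3)], of 2] Ck_bound_le[OF _ Ck_bound_lap[OF T B6(2)], of 2]
    by (intro lap_diff T z) auto
  finally show ?thesis .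
qed

text \<open>Restricted to interior times because \<open>ks_solution\<close> states the equation
  there; all time midpoints are interior.\<close>

lemma Rd_eq_residual:
  assumes "ks_solution lam T u" "x \<in> cell" "t \<in> {0<..<T}"
  shows "res_pde lam T v (x, t) = Rd (x, t)"
proof -
  let ?z = "(x, t)"
  have z: "?z \<in> Om T" using assms by (auto simp: Om_def)
  have 0: "res_pde lam T u ?z = 0" using assms by (auto simp: ks_solution_def)
  have dt: "dt T e ?z = dt T v ?z - dt T u ?z"
    unfolding e_def by (rule dt_diff[OF T differentiable(3,2) z])
  \<comment> \<open>The quadratic convection terms are subtracted as v_j dv - u_j du = e_j du + v_j
    de.\<close>
  have "Rd ?z = res_pde lam T v ?z - res_pde lam T u ?z"
    unfolding Rd_def res_pde_def dt dx_split[OF z] lap_split[OF z] lap_lap_split[OF z]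
    by (simp add: e_def algebra_simps sum_subtractf sum.distrib)
  then show ?thesis using 0 by simp
qed

text \<open>The factors that multiply \<open>N 6\<close> in the bounds for the terms of
  \<open>Rd\<close>: time derivative, convection, Laplacian, bilaplacian. The norm of
  \<open>v\<close> makes it depend on the network.\<close>

definition Rd_rate :: real where
  "Rd_rate = 1 + real CARD('n) * (2 * U + 2 * Ck_norm 6 (Om T) v) + \<bar>lam\<bar> * real CARD('n) + (real CARD('n))\<^sup>2"

lemma Rd_bound: "Ck_bound (Suc 0) (Om T) Rd (N 6 * Rd_rate) 1"
proof -
  let ?V = "Ck_norm 6 (Om T) v"
  note thick = thick_Om[OF T, where 'n = 'n]
  have N6: "0 \<le> N 6" by (rule N_nonneg) simp
  have le: "Ck_bound k S f X 1 \<Longrightarrow> j \<le> k \<Longrightarrow> Ck_bound j S f X 1" for k j S and f :: "'n vfield" and X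
    using Ck_bound_le by blast
  have a: "Ck_bound (Suc 0) (Om T) (dt T e) (N 6) 1"
    by (rule le[OF Ck_bound_dt[OF B6(1)]]) simp
  have b: "Ck_bound (Suc 0) (Om T) (\<lambda>z. (e z $ j) *\<^sub>R dx T j u z) (2 ^ Suc 0 * N 6 * U) 1" for j
    by (intro Ck_bound_bilinear[OF thick bounded_bilinear_scaleR] Ck_bound_component[OF thick]
        le[OF B6(1)] le[OF Ck_bound_dx[OF B6(2)]] N6 U_nonneg) auto
  have c: "Ck_bound (Suc 0) (Om T) (\<lambda>z. (v z $ j) *\<^sub>R dx T j e z) (2 ^ Suc 0 * ?V * N 6) 1" for j
    by (intro Ck_bound_bilinear[OF thick bounded_bilinear_scaleR] Ck_bound_component[OF thick]
        le[OF B6(3)] le[OF Ck_bound_dx[OF B6(1)]] N6 V_nonneg) auto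
  have d: "Ck_bound (Suc 0) (Om T) (\<lambda>z. lam *\<^sub>R lap T e z) (real CARD('n) * N 6 * \<bar>lam\<bar>) 1"
    by (intro Ck_bound_linear[OF thick bounded_linear_scaleR_right] le[OF Ck_bound_lap[OF T B6(1)]]) auto
  have f: "Ck_bound (Suc 0) (Om T) (lap T (lap T e)) (real CARD('n) * (real CARD('n) * N 6)) 1"
    by (rule le[OF Ck_bound_lap[OF T Ck_bound_lap[OF T B6(1)]]]) simp
  have "Ck_bound (Suc 0) (Om T) (\<lambda>z. dt T e z + (\<Sum>j\<in>UNIV. (e z $ j) *\<^sub>R dx T j u z + (v z $ j) *\<^sub>R dx T j e z)
     + lam *\<^sub>R lap T e z + lap T (lap T e) z)
     (N 6 + (\<Sum>j\<in>(UNIV::'n set). 2 ^ Suc 0 * N 6 * U + 2 ^ Suc 0 * ?V * N 6) + real CARD('n) * N 6 * \<bar>lam\<bar> + real CARD('n) * (real CARD('n) * N 6)) 1"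
    by (intro Ck_bound_add[OF thick] Ck_bound_sum[OF thick] a b c d f) auto
  moreover have "N 6 + (\<Sum>j\<in>(UNIV::'n set). 2 ^ Suc 0 * N 6 * U + 2 ^ Suc 0 * ?V * N 6) + real CARD('n) * N 6 * \<bar>lam\<bar>
     + real CARD('n) * (real CARD('n) * N 6) = N 6 * Rd_rate"
    by (simp add: Rd_rate_def algebra_simps power2_eq_square)
  ultimately show ?thesis unfolding Rd_def[abs_def] by simp
qed

text \<open>On a cell \<open>Rd\<close> varies by at most \<open>?A\<close>, proportional to the
  mesh size. Squaring makes this error second order at the price of a factor 2, which the 1/2 on the
  left compensates.\<close>

lemma quadrature_int:
  assumes ks: "ks_solution lam T u" and NK: "0 < n" "0 < K"
    and S: "S_int S = interior_grid T n K"
  shows "I T (\<lambda>z. (norm (Rd z))\<^sup>2) / 2 \<le> (E_pde lam T v S)\<^sup>2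
     + 2 ^ CARD('n) * T * ((real CARD('n) + 1)\<^sup>2 * (N 6 * Rd_rate))\<^sup>2 * (max (2 / real n) (T / real K))\<^sup>2"
proof -
  interpret G: box_grid "st_corner T :: 'n spacetime" "st_count n K" by (rule box_grid_spacetime[OF T NK])
  let ?G = "grid (st_corner T :: 'n spacetime) (st_count n K)" and ?h = "max (2 / real n) (T / real K)"
  let ?d = "real CARD('n)"
  let ?A = "(?d + 1)\<^sup>2 * (N 6 * Rd_rate) * ?h"
  have GS: "?G = S_int S" using S grid_spacetime by simp
  have XR: "0 \<le> N 6 * Rd_rate"
    using N_nonneg[of 6] U_nonneg V_nonneg unfolding Rd_rate_def by (intro mult_nonneg_nonneg add_nonneg_nonneg) auto
  have vol: "measure lborel (cbox 0 (st_corner T :: 'n spacetime)) = 2 ^ CARD('n) * T"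
    using measure_Om[where 'n = 'n, of T] T by (simp add: Om_corner)
  have "(norm (Rd z))\<^sup>2 \<le> 2 * (norm (Rd m))\<^sup>2 + 2 * ?A\<^sup>2"
    if m: "m \<in> ?G" and z: "z \<in> grid_cell (st_corner T) (st_count n K) m" for m z
  proof -
    have mz: "m \<in> Om T" "z \<in> Om T" using G.grid_subset G.grid_cell_subset[OF m] m z by (auto simp: Om_corner)
    have "norm (Rd z) \<le> norm (Rd m) + norm (Rd z - Rd m)" by norm
    moreover have "norm (Rd z - Rd m) \<le> (?d + 1) * (N 6 * Rd_rate) * norm (z - m)"
      using Ck_bound_lipschitz[OF Rd_bound convex_Om mz(2,1)] by (simp add: add.commute)
    moreover have "(?d + 1) * (N 6 * Rd_rate) * norm (z - m) \<le> (?d + 1) * (N 6 * Rd_rate) * ((?d + 1) * ?h)"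
      using G.norm_grid_cell_le[OF z spacetime_mesh] XR by (intro mult_left_mono) (auto simp: add.commute)
    moreover have "(?d + 1) * (N 6 * Rd_rate) * ((?d + 1) * ?h) = ?A" by (simp only: power2_eq_square mult_ac)
    ultimately have "norm (Rd z) \<le> norm (Rd m) + ?A" by linarith
    then have "(norm (Rd z))\<^sup>2 \<le> (norm (Rd m) + ?A)\<^sup>2" by (intro power_mono) auto
    also have "\<dots> \<le> 2 * (norm (Rd m))\<^sup>2 + 2 * ?A\<^sup>2"
      using sum_squares_bound[of "norm (Rd m)" ?A] by (simp add: power2_sum)
    finally show ?thesis .
  qed
  then have "I T (\<lambda>z. (norm (Rd z))\<^sup>2) \<le> 2 ^ CARD('n) * T / real (card ?G) * (\<Sum>m\<in>?G. 2 * (norm (Rd m))\<^sup>2 + 2 * ?A\<^sup>2)"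
    using G.integral_le_grid_sum[of "\<lambda>z. (norm (Rd z))\<^sup>2" "\<lambda>m. 2 * (norm (Rd m))\<^sup>2 + 2 * ?A\<^sup>2"] Rd_continuous
    by (simp add: Om_corner vol continuous_on_power continuous_on_norm)
  also have "\<dots> = 2 * (2 ^ CARD('n) * T / real (card ?G) * (\<Sum>m\<in>?G. (norm (Rd m))\<^sup>2)) + 2 * (2 ^ CARD('n) * T * ?A\<^sup>2)"
  proof -
    have "card ?G \<noteq> 0" using NK T by (simp add: grid_spacetime card_spacetime_grid)
    then show ?thesis by (simp add: sum.distrib distrib_left sum_distrib_left[symmetric] del: power_mult_distrib)
  qed
  also have "2 ^ CARD('n) * T / real (card ?G) * (\<Sum>m\<in>?G. (norm (Rd m))\<^sup>2) = (E_pde lam T v S)\<^sup>2"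
  proof -
    have "(\<Sum>m\<in>?G. (norm (Rd m))\<^sup>2) = (\<Sum>m\<in>?G. (norm (res_pde lam T v m))\<^sup>2)"
    proof (rule sum.cong[OF refl])
      fix m assume "m \<in> ?G"
      then obtain x t where m: "m = (x, t)" "\<forall>i. x $ i \<in> mids 2 n" "t \<in> mids T K"
        by (auto simp: grid_spacetime)
      then have "x \<in> cell" "t \<in> {0<..<T}"
        using mids_strict_bounds[of t T K] mids_strict_bounds[of _ 2 n] T by (auto simp: cell_def less_imp_le)
      then show "(norm (Rd m))\<^sup>2 = (norm (res_pde lam T v m))\<^sup>2" using Rd_eq_residual[OF ks] m(1) by simp
    qed
    then show ?thesis using T
      by (simp add: E_pde_def quad_def GS measure_lebesgue_Om sum_nonneg)
  qed
  finally show ?thesis by (simp add: power_mult_distrib mult_ac)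
qed

lemma quadrature_t:
  assumes n: "0 < n" and S: "S_t S = {x. \<forall>i. x $ i \<in> mids 2 n}"
  shows "energy e 0 \<le> (E_t v u S)\<^sup>2 + 2 ^ CARD('n) * (3 * (real CARD('n) + 1) ^ 4 * (N 2)\<^sup>2) * (real CARD('n))\<^sup>2 * (2 / real n)\<^sup>2"
proof -
  interpret G: box_grid "\<chi> i. 2 :: real ^ 'n" "\<lambda>_. n" by (rule box_grid_cell[OF n])
  let ?G = "grid (\<chi> i. 2 :: real ^ 'n) (\<lambda>_. n)" and ?h = "2 / real n" and ?d = "real CARD('n)"
  let ?f = "\<lambda>x. (norm (e (x, 0)))\<^sup>2" and ?X = "N 2"
  let ?D = "\<lambda>m. frechet_derivative e (at (m, 0) within Om T)"
  \<comment> \<open>The derivative of the squared norm of \<open>e\<close> at the midpoint in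
    spatial directions: the linear part for \<open>midpoint_rule\<close>.\<close>
  let ?l = "\<lambda>m h. 2 * (e (m, 0) \<bullet> ?D m (h, 0))"
  have GS: "?G = S_t S" using S grid_cell_points by simp
  have E2: "Ck_bound (Suc (Suc 0)) (Om T) e ?X 1" using e_bound[of 2] by (simp add: numeral_2_eq_2)
  have X: "0 \<le> ?X" by (rule N_nonneg) simp
  have inOm: "(x, 0) \<in> Om T" if "x \<in> cbox 0 (\<chi> i. 2)" for x :: "real ^ 'n"
    using that T by (auto simp: Om_def cell_eq_cbox)
  have cont0: "continuous_on (cbox 0 (\<chi> i. 2)) ?f"
    by (intro continuous_intros continuous_on_compose2[OF cont(1)]) (use inOm in auto)
  have lin: "linear (?l m)" if m: "m \<in> ?G" for m
  proof -
    have "linear (?D m)"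
      using has_derivative_linear[OF has_derivative_frechet[OF differentiable(1) inOm]] G.grid_subset m by blast
    then show ?thesis
      by (intro linearI) (simp_all add: linear_add[of "?D m" "(_, 0)" "(_, 0)", simplified]
        linear_scale[of "?D m" _ "(_, 0)", simplified] inner_add_right distrib_left)
  qed
  have B: "?f z \<le> ?f m + ?l m (z - m) + 3 * (?d + 1) ^ 4 * ?X\<^sup>2 * (?d * ?h)\<^sup>2"
    if m: "m \<in> ?G" and z: "z \<in> grid_cell (\<chi> i. 2) (\<lambda>_. n) m" for m z
  proof -
    have mz: "(m, 0) \<in> Om T" "(z, 0) \<in> Om T"
      using inOm G.grid_subset G.grid_cell_subset[OF m] m z by auto
    have zm: "norm ((z, 0) - (m, 0::real)) = norm (z - m)" by (simp add: norm_Pair)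
    let ?r = "norm (z - m)" and ?a = "e (z, 0) - e (m, 0)"
    have "(\<chi> i. 2 :: real ^ 'n) \<bullet> b / real n \<le> ?h" if "b \<in> Basis" for b
      using that by (auto simp: Basis_vec_def inner_axis)
    from G.norm_grid_cell_le[OF z this] have h: "?r \<le> ?d * ?h" by simp
    have l1: "norm ?a \<le> (?d + 1) * ?X * ?r"
      using Ck_bound_lipschitz[OF E2 convex_Om mz(2,1)] zm by (simp add: add.commute)
    have l2: "norm (?a - ?D m (z - m, 0)) \<le> (?d + 1)\<^sup>2 * ?X * ?r\<^sup>2"
      using Ck_bound_taylor[OF E2 convex_Om mz] zm by (simp add: add.commute)
    have l0: "norm (e (m, 0)) \<le> ?X" by (rule Ck_bound_norm[OF E2 mz(1)])
    \<comment> \<open>An exact expansion of the square. The last two terms are of second order, by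
      Taylor's formula and by the Lipschitz bound; they contribute 2 and 1 to the factor 3.\<close>
    have "?f z = ?f m + ?l m (z - m) + 2 * (e (m, 0) \<bullet> (?a - ?D m (z - m, 0))) + (norm ?a)\<^sup>2"
      by (simp add: power2_norm_eq_inner inner_diff_left inner_diff_right inner_commute[of "e (z, 0)" "e (m, 0)"])
    also have "e (m, 0) \<bullet> (?a - ?D m (z - m, 0)) \<le> ?X * ((?d + 1)\<^sup>2 * ?X * ?r\<^sup>2)"
      using l0 l2 X by (intro order_trans[OF norm_cauchy_schwarz] mult_mono) auto
    also have "(norm ?a)\<^sup>2 \<le> ((?d + 1) * ?X * ?r)\<^sup>2"
      using l1 by (intro power_mono) auto
    also have "?f m + ?l m (z - m) + 2 * (?X * ((?d + 1)\<^sup>2 * ?X * ?r\<^sup>2)) + ((?d + 1) * ?X * ?r)\<^sup>2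
       = ?f m + ?l m (z - m) + (?d + 1)\<^sup>2 * (3 * ?X\<^sup>2 * ?r\<^sup>2)"
    proof -
      have "2 * (x * (p * x * q)) + p * x\<^sup>2 * q = p * (3 * x\<^sup>2 * q)" for p q x :: real
        by (simp add: power2_eq_square algebra_simps)
      from this[of ?X "(?d + 1)\<^sup>2" "?r\<^sup>2"] show ?thesis unfolding power_mult_distrib by simp
    qed
    also have "(?d + 1)\<^sup>2 * (3 * ?X\<^sup>2 * ?r\<^sup>2) \<le> (?d + 1) ^ 4 * (3 * ?X\<^sup>2 * (?d * ?h)\<^sup>2)"
      using h by (intro mult_mono power_increasing power_mono mult_left_mono) auto
    finally show ?thesis by (simp add: mult_ac)
  qed
  have vol: "measure lborel (cbox 0 (\<chi> i. 2 :: real ^ 'n)) = 2 ^ CARD('n)"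
    using measure_cell[where 'n = 'n] by (simp add: cell_eq_cbox)
  have "energy e 0 \<le> 2 ^ CARD('n) / real (card ?G) * (\<Sum>m\<in>?G. ?f m) + 2 ^ CARD('n) * (3 * (?d + 1) ^ 4 * ?X\<^sup>2 * (?d * ?h)\<^sup>2)"
    using G.midpoint_rule[OF cont0 lin B] unfolding vol energy_def cell_eq_cbox by blast
  also have "2 ^ CARD('n) / real (card ?G) * (\<Sum>m\<in>?G. ?f m) = (E_t v u S)\<^sup>2"
    by (simp add: E_t_def quad_def GS measure_lebesgue_cell sum_nonneg res_t_def e_def)
  finally show ?thesis unfolding power_mult_distrib[of ?d ?h] by (simp only: mult_ac)
qed

text \<open>Periodicity is given for iterated partial derivatives, so \<open>lap T u\<close> and
  \<open>dx T j (lap T u)\<close> are first written as sums of those, of order at most 3.\<close>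

lemma trace_op_u_side:
  assumes z: "z \<in> Om T"
  shows "trace_op T i j u (side j 2 z) = trace_op T i j u (side j 0 z)"
proof -
  let ?b = "\<lambda>k::'n. (axis k 1 :: real ^ 'n, 0::real)"
  have dx: "dx T k u = pders (Om T) [?b k] u" for k by (simp add: dx_def)
  have lap: "lap T u y = (\<Sum>k\<in>UNIV. pders (Om T) [?b k, ?b k] u y)" for y by (simp add: lap_def dx_def)
  have dxlap: "dx T j (lap T u) y = (\<Sum>k\<in>UNIV. pders (Om T) [?b j, ?b k, ?b k] u y)" if y: "y \<in> Om T" for y
  proof -
    have "dx T k (dx T k u) differentiable_on Om T" for k
      by (rule Ck_bound_differentiable[OF Ck_bound_dx[OF Ck_bound_dx[OF B6(2)]]])
    then have "(lap T u has_derivative (\<lambda>h. \<Sum>k\<in>UNIV. frechet_derivative (dx T k (dx T k u)) (at y within Om T) h)) (at y within Om T)"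
      unfolding lap_def[abs_def] by (intro has_derivative_sum has_derivative_frechet y)
    from pder_eqI[OF thick_Om[OF T] y this, of "?b j"] show ?thesis
      by (simp add: dx_def pder_def)
  qed
  have B: "?b k \<in> Basis" for k by (rule axis_Basis)
  consider "i = 1" | "i = 2" | "i = 3" | "i \<noteq> 1 \<and> i \<noteq> 2 \<and> i \<noteq> 3" by blast
  then show ?thesis
  proof cases
    case 1
    then show ?thesis using u_side[OF z] by (simp add: trace_op_def)
  next
    case 2
    then show ?thesis using pders_u_side[OF z, of "[?b j]"] B by (simp add: trace_op_def dx)
  next
    case 3
    have "pders (Om T) [?b k, ?b k] u (side j 2 z) = pders (Om T) [?b k, ?b k] u (side j 0 z)" for k
      using B by (intro pders_u_side z) auto
    then show ?thesis using 3 by (simp add: trace_op_def lap)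
  next
    case 4
    have "pders (Om T) [?b j, ?b k, ?b k] u (side j 2 z) = pders (Om T) [?b j, ?b k, ?b k] u (side j 0 z)" for k
      using B by (intro pders_u_side z) auto
    then show ?thesis using 4 side_in_Om[OF z] by (simp add: trace_op_def dxlap)
  qed
qed

text \<open>Links the energy estimate, which produces jumps of \<open>e\<close>, to the training
  errors, which measure jumps of \<open>v\<close>.\<close>

lemma face_jump_trace_op:
  assumes z: "z \<in> Om T"
  shows "face_jump j (trace_op T i j v) z = face_jump j (trace_op T i j e) z"
proof -
  have "trace_op T i j e y = trace_op T i j v y - trace_op T i j u y" if "y \<in> Om T" for y
    using dx_split[OF that] lap_split[OF that] dx_lap_split[OF that] by (simp add: trace_op_def e_def)
  then show ?thesis
    using trace_op_u_side[OF z] side_in_Om[OF z] by (simp add: face_jump_def)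
qed

text \<open>Passing to the opposite face reverses the jump and the outer normal; the norm does not
  see these signs.\<close>

lemma norm_res_sb:
  assumes y: "y \<in> face_grid T n K j c" and c: "c \<in> {0, 2}" and i: "i \<in> {1..4}"
  shows "norm (res_sb T i v y) = norm (face_jump j (trace_op T i j v) y)"
proof -
  obtain x t where xt: "y = (x, t)" by fastforce
  have x: "x $ j = c" and others: "x $ k \<noteq> 0 \<and> x $ k \<noteq> 2" if "k \<noteq> j" for k
    using y mids_strict_bounds[of "x $ k" 2 n] that unfolding xt by (auto simp: face_grid_def)
  have xj: "x $ j = c" using y unfolding xt by (simp add: face_grid_def)
  have sides: "side j 0 y = (if c = 0 then y else (opp x, t))" "side j 2 y = (if c = 0 then (opp x, t) else y)"
    using xj c others unfolding xt by (auto simp: side_def opp_def vec_eq_iff)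
  have jump: "jump f y = (if c = 0 then - face_jump j f y else face_jump j f y)" for f :: "'n vfield"
    unfolding face_jump_def sides by (simp add: jump_def xt)
  have nj: "normal_jump T f y = (if c = 0 then - 1 else 1) *\<^sub>R jump (dx T j f) y" for f :: "'n vfield"
  proof -
    have o: "outer_normal x $ k = (if k = j then (if c = 0 then - 1 else 1) else 0)" for k
      using xj c others[of k] by (auto simp: outer_normal_def)
    have "normal_jump T f y = (\<Sum>k\<in>UNIV. (outer_normal x $ k) *\<^sub>R jump (dx T k f) y)"
      by (simp add: normal_jump_def xt)
    also have "\<dots> = (\<Sum>k\<in>UNIV. if k = j then (if c = 0 then - 1 else 1) *\<^sub>R jump (dx T k f) y else 0)"
      by (intro sum.cong) (auto simp: o)
    finally show ?thesis by simp
  qed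
  show ?thesis
    using i by (auto simp: res_sb_def trace_op_def nj jump)
qed

text \<open>In effect an L^2 triangle inequality: quadrature value plus oscillation on the cells.
  The coefficient 1 of \<open>E_sb\<close> comes from Young's inequality with a free weight
  \<open>a\<close>, optimised at the end.\<close>

lemma quadrature_sb:
  assumes NK: "0 < n" "0 < K" and i: "i \<in> {1..4}"
    and S: "S_sb S i = boundary_grid T n K"
  shows "sqrt (\<Sum>j\<in>UNIV. I T (\<lambda>z. (norm (face_jump j (trace_op T i j e) z))\<^sup>2)) \<le> E_sb T i v S
     + sqrt (real CARD('n) * 2 ^ CARD('n) * T) * (2 * (real CARD('n) + 1)\<^sup>2 * real CARD('n) * N i) * max (2 / real n) (T / real K)"
proof -
  interpret G: box_grid "st_corner T :: 'n spacetime" "st_count n K" by (rule box_grid_spacetime[OF T NK])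
  let ?G = "grid (st_corner T :: 'n spacetime) (st_count n K)" and ?h = "max (2 / real n) (T / real K)"
  let ?d = "real CARD('n)" and ?J = "\<lambda>j. face_jump j (trace_op T i j e)"
  let ?A = "2 * (?d + 1)\<^sup>2 * ?d * N i * ?h" and ?vol = "2 ^ CARD('n) * T"
  let ?X = "\<Sum>j\<in>UNIV. I T (\<lambda>z. (norm (?J j z))\<^sup>2)"
  have Ni: "0 \<le> N i" using i by (intro N_nonneg) auto
  have h0: "0 \<le> ?h" by (simp add: le_max_iff_disj)
  have A0: "0 \<le> ?A" using Ni h0 by simp
  have tB: "Ck_bound (Suc 0) (Om T) (trace_op T i j e) (?d * N i) 1" for j
    using Ck_bound_trace_op[OF T, of 0 i] e_bound[of i] i Ni by simp
  have cJ: "continuous_on (Om T) (?J j)" for j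
    by (intro face_jump_continuous Ck_bound_continuous[OF tB])
  have vol: "measure lborel (cbox 0 (st_corner T :: 'n spacetime)) = ?vol"
    using measure_Om[where 'n = 'n, of T] T by (simp add: Om_corner)
  have G0: "real (card ?G) = real n ^ CARD('n) * real K"
    using NK T by (simp add: grid_spacetime card_spacetime_grid)
  have Gpos: "0 < real (card ?G)" unfolding G0 using NK by simp
  have osc: "norm (?J j z) \<le> norm (?J j m) + ?A"
    if m: "m \<in> ?G" and z: "z \<in> grid_cell (st_corner T) (st_count n K) m" for m z j
  proof -
    have mz: "m \<in> Om T" "z \<in> Om T" using G.grid_subset G.grid_cell_subset[OF m] m z by (auto simp: Om_corner)
    have zm: "norm (z - m) \<le> (?d + 1) * ?h"
      using G.norm_grid_cell_le[OF z spacetime_mesh] by (simp add: add.commute)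
    have side_le: "norm (side j c z - side j c m) \<le> norm (z - m)" for c
    proof -
      have "norm (fst (side j c z) - fst (side j c m)) \<le> norm (fst z - fst m)"
        by (rule norm_le_componentwise_cart) (auto simp: side_def)
      then have "(norm (fst (side j c z) - fst (side j c m)))\<^sup>2 \<le> (norm (fst z - fst m))\<^sup>2"
        by (rule power_mono) simp
      then show ?thesis by (cases z; cases m) (simp add: side_def norm_Pair)
    qed
    have lip: "norm (trace_op T i j e (side j c z) - trace_op T i j e (side j c m)) \<le> ?A / 2" if "c \<in> {0..2}" for c
    proof -
      have "norm (trace_op T i j e (side j c z) - trace_op T i j e (side j c m)) \<le> (?d + 1) * (?d * N i) * norm (side j c z - side j c m)"
        using Ck_bound_lipschitz[OF tB convex_Om side_in_Om[OF mz(2) that] side_in_Om[OF mz(1) that]] by (simp add: add.commute)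
      also have "\<dots> \<le> (?d + 1) * (?d * N i) * ((?d + 1) * ?h)"
        using side_le[of c] zm Ni by (intro mult_left_mono) auto
      also have "\<dots> = ?A / 2" by (simp add: power2_eq_square)
      finally show ?thesis .
    qed
    have "norm (?J j z - ?J j m) \<le> norm (trace_op T i j e (side j 2 z) - trace_op T i j e (side j 2 m))
        + norm (trace_op T i j e (side j 0 z) - trace_op T i j e (side j 0 m))"
    proof -
      have "norm ((a - b) - (a' - b')) \<le> norm (a - a') + norm (b - b')" for a b a' b' :: "real ^ 'n"
        using norm_triangle_ineq4[of "a - a'" "b - b'"] by (simp add: algebra_simps)
      then show ?thesis unfolding face_jump_def .
    qed
    also have "\<dots> \<le> ?A" using lip[of 2] lip[of 0] by simp
    finally show ?thesis using norm_triangle_sub[of "?J j z" "?J j m"] by linarith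
  qed
  \<comment> \<open>The jump in direction \<open>j\<close> does not depend on coordinate
    \<open>j\<close>, so quadrature over the interior grid agrees with that over the faces. The two
    opposite faces carry equal values, whence a factor 2.\<close>
  have E: "?vol / real (card ?G) * (\<Sum>j\<in>UNIV. \<Sum>m\<in>?G. (norm (?J j m))\<^sup>2) = (E_sb T i v S)\<^sup>2"
  proof -
    let ?g = "\<lambda>y. (norm (res_sb T i v y))\<^sup>2"
    have g: "?g (side j c m) = (norm (?J j m))\<^sup>2" if m: "m \<in> ?G" and c: "c \<in> {0, 2}" for j c m
    proof -
      have mO: "m \<in> Om T" using G.grid_subset m by (auto simp: Om_corner)
      have "side j c m \<in> face_grid T n K j c"
        using m by (auto simp: grid_spacetime face_grid_def side_def)
      then have "norm (res_sb T i v (side j c m)) = norm (face_jump j (trace_op T i j v) (side j c m))"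
        using c i by (rule norm_res_sb)
      also have "face_jump j (trace_op T i j v) (side j c m) = face_jump j (trace_op T i j v) m"
        by (simp add: face_jump_def side_def vec_eq_iff cong: if_cong)
      finally show ?thesis using face_jump_trace_op[OF mO] by simp
    qed
    have "real n * sum ?g (S_sb S i) = (\<Sum>j\<in>UNIV. \<Sum>m\<in>?G. ?g (side j 0 m) + ?g (side j 2 m))"
      unfolding S sum_boundary_grid[OF NK(1)] grid_spacetime ..
    also have "\<dots> = 2 * (\<Sum>j\<in>UNIV. \<Sum>m\<in>?G. (norm (?J j m))\<^sup>2)"
      by (simp add: g sum_distrib_left)
    finally have sum: "real n * sum ?g (S_sb S i) = 2 * (\<Sum>j\<in>UNIV. \<Sum>m\<in>?G. (norm (?J j m))\<^sup>2)" .
    have cardS: "real (card (S_sb S i)) = 2 * ?d * real n ^ (CARD('n) - 1) * real K"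
      unfolding S by (rule card_boundary_grid[OF NK(1) T NK(2)])
    have pw: "real n ^ CARD('n) = real n * real n ^ (CARD('n) - 1)" "(2::real) ^ CARD('n) = 2 * 2 ^ (CARD('n) - 1)"
      by (subst power_Suc[symmetric], simp)+
    have "(E_sb T i v S)\<^sup>2 = 2 * ?d * 2 ^ (CARD('n) - 1) * T / real (card (S_sb S i)) * sum ?g (S_sb S i)"
      using T by (simp add: E_sb_def quad_def sum_nonneg)
    also have "\<dots> = ?vol / real (card ?G) * (real n * sum ?g (S_sb S i) / 2)"
      unfolding cardS G0 pw using NK by (simp add: field_simps)
    finally show ?thesis unfolding sum by simp
  qed
  \<comment> \<open>With Q^2 for \<open>?d * ?vol * ?A\<^sup>2\<close> this is X - E^2 - Q^2 \<le>
    E^2 * a + Q^2 / a. Optimising over \<open>a\<close> gives 2 * E * Q, that is, X \<le> (E +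
    Q)^2.\<close>
  have le: "?X - (E_sb T i v S)\<^sup>2 - ?d * ?vol * ?A\<^sup>2 \<le> (2 * (E_sb T i v S)\<^sup>2 * a + 2 * (?d * ?vol * ?A\<^sup>2) / a) / 2"
    if a: "0 < a" for a
  proof -
    have "I T (\<lambda>z. (norm (?J j z))\<^sup>2) \<le> ?vol / real (card ?G) * (\<Sum>m\<in>?G. (1 + a) * (norm (?J j m))\<^sup>2 + (1 + 1 / a) * ?A\<^sup>2)" for j
    proof -
      have "(norm (?J j z))\<^sup>2 \<le> (1 + a) * (norm (?J j m))\<^sup>2 + (1 + 1 / a) * ?A\<^sup>2"
        if m: "m \<in> ?G" and z: "z \<in> grid_cell (st_corner T) (st_count n K) m" for m z
      proof -
        have young: "(p + q)\<^sup>2 \<le> (1 + a) * p\<^sup>2 + (1 + 1 / a) * q\<^sup>2" for p q :: real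
        proof -
          have "0 \<le> (a * p - q)\<^sup>2 / a" using a by simp
          also have "\<dots> = a * p\<^sup>2 + q\<^sup>2 / a - 2 * p * q"
            using a by (simp add: power2_eq_square field_simps)
          finally show ?thesis by (simp add: power2_sum algebra_simps)
        qed
        have "(norm (?J j z))\<^sup>2 \<le> (norm (?J j m) + ?A)\<^sup>2" using osc[OF m z] by (intro power_mono) auto
        then show ?thesis using young[of "norm (?J j m)" ?A] by linarith
      qed
      moreover have "continuous_on (cbox 0 (st_corner T)) (\<lambda>z. (norm (?J j z))\<^sup>2)"
        using cJ[of j] by (intro continuous_intros) (simp add: Om_corner)
      ultimately show ?thesis
        using G.integral_le_grid_sum[of "\<lambda>z. (norm (?J j z))\<^sup>2" "\<lambda>m. (1 + a) * (norm (?J j m))\<^sup>2 + (1 + 1 / a) * ?A\<^sup>2"]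
        by (simp only: Om_corner vol)
    qed
    then have "?X \<le> (\<Sum>j\<in>UNIV. ?vol / real (card ?G) * (\<Sum>m\<in>?G. (1 + a) * (norm (?J j m))\<^sup>2 + (1 + 1 / a) * ?A\<^sup>2))"
      by (rule sum_mono)
    also have "\<dots> = (1 + a) * (?vol / real (card ?G) * (\<Sum>j\<in>UNIV. \<Sum>m\<in>?G. (norm (?J j m))\<^sup>2)) + (1 + 1 / a) * (?d * ?vol * ?A\<^sup>2)"
    proof -
      have "(\<Sum>m\<in>?G. (1 + a) * (norm (?J j m))\<^sup>2 + (1 + 1 / a) * ?A\<^sup>2)
        = (1 + a) * (\<Sum>m\<in>?G. (norm (?J j m))\<^sup>2) + real (card ?G) * ((1 + 1 / a) * ?A\<^sup>2)" for j
        by (simp only: sum.distrib sum_distrib_left[symmetric] sum_constant) (simp only: mult_ac)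
      then have "?vol / real (card ?G) * (\<Sum>m\<in>?G. (1 + a) * (norm (?J j m))\<^sup>2 + (1 + 1 / a) * ?A\<^sup>2)
        = (1 + a) * (?vol / real (card ?G) * (\<Sum>m\<in>?G. (norm (?J j m))\<^sup>2)) + ?vol * ((1 + 1 / a) * ?A\<^sup>2)" for j
        using Gpos by (simp only: distrib_left) simp
      then show ?thesis
        by (simp only: sum.distrib sum_distrib_left[symmetric] sum_constant) simp
    qed
    finally show ?thesis unfolding E using a by (simp add: field_simps)
  qed
  have pos: "0 \<le> ?d * ?vol * ?A\<^sup>2" using T by simp
  have "?X - (E_sb T i v S)\<^sup>2 - ?d * ?vol * ?A\<^sup>2 \<le> sqrt (2 * (E_sb T i v S)\<^sup>2 * (2 * (?d * ?vol * ?A\<^sup>2)))"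
    by (rule le_sqrt_if_le_balanced[OF le]) (use pos in auto)
  also have E0: "0 \<le> E_sb T i v S" unfolding E_sb_def quad_def using T by (simp add: sum_nonneg)
  have "sqrt (2 * (E_sb T i v S)\<^sup>2 * (2 * (?d * ?vol * ?A\<^sup>2))) = 2 * E_sb T i v S * (sqrt (?d * ?vol) * ?A)"
    using A0 E0 by (simp add: real_sqrt_mult)
  finally have "?X \<le> (E_sb T i v S + sqrt (?d * ?vol) * ?A)\<^sup>2"
    using T by (simp add: power2_sum power_mult_distrib)
  then have "sqrt ?X \<le> E_sb T i v S + sqrt (?d * ?vol) * ?A"
    using A0 E0 T by (intro real_le_lsqrt) (auto intro!: sum_nonneg integral_nonneg integrable_Om[OF _ order_refl] continuous_intros cJ)
  then show ?thesis by (simp add: mult_ac)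
qed

end

section \<open>Explicit constants, error estimate and a priori bounds\<close>

definition jump_const :: "real \<Rightarrow> nat \<Rightarrow> real" where
  "jump_const U d = 2 * (U + real d + 1) * sqrt (real d * 2 ^ d)"

text \<open>The isolated \<open>real d\<close> passes from \<open>N i\<close> to
  \<open>comp_norm (i + 1)\<close>; the factor with \<open>kap\<close> converts the mesh size into a
  power of the number of nodes.\<close>

definition sb_const :: "real \<Rightarrow> real \<Rightarrow> nat \<Rightarrow> real" where
  "sb_const T kap d = sqrt (real d * 2 ^ d * T) * (2 * (real d + 1)\<^sup>2 * real d) * real d * (kap * (real d * 2 ^ d * T) powr (1 / real d))"

definition t_const :: "nat \<Rightarrow> real" where
  "t_const d = 2 ^ d * (3 * (real d + 1) ^ 4) * (real d)\<^sup>2 * 4"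

definition pde_const :: "real \<Rightarrow> real \<Rightarrow> nat \<Rightarrow> real" where
  "pde_const T kap d = 2 ^ d * T * (real d + 1) ^ 4 * (kap\<^sup>2 * (2 ^ d * T) powr (2 / (real d + 1)))"

text \<open>The value of C1, twice the coefficient sum from
  \<open>pointwise_energy_bound\<close>.\<close>

definition young_const :: "real \<Rightarrow> nat \<Rightarrow> real" where
  "young_const lam d = 2 + (lam + 1 / 2)\<^sup>2 / 2 + 18 * real d"

lemma young_const_pos: "0 < young_const lam d"
  unfolding young_const_def by (intro add_pos_nonneg) auto

lemma Linf_on_nonneg: "0 \<le> a \<Longrightarrow> (\<And>z. z \<in> S \<Longrightarrow> norm (f z) \<le> a) \<Longrightarrow> 0 \<le> Linf_on S f"
  unfolding Linf_on_def by (rule cInf_greatest) (auto intro!: exI[of _ a] AE_I2)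

lemma Linf_on_le: "0 \<le> a \<Longrightarrow> (\<And>z. z \<in> S \<Longrightarrow> norm (f z) \<le> a) \<Longrightarrow> Linf_on S f \<le> a"
  unfolding Linf_on_def by (rule cInf_lower) (auto intro!: AE_I2 bdd_belowI[of _ 0])

lemma quad_le:
  assumes "finite S" "\<And>y. y \<in> S \<Longrightarrow> g y \<le> B" "0 \<le> vol" "0 \<le> B"
  shows "quad vol S g \<le> vol * B"
proof (cases "S = {}")
  case False
  then have "0 < real (card S)" using assms(1) by (simp add: card_gt_0_iff)
  have "sum g S \<le> real (card S) * B" using assms by (intro sum_bounded_above) auto
  then have "vol / real (card S) * sum g S \<le> vol / real (card S) * (real (card S) * B)"
    using assms by (intro mult_left_mono) auto
  then show ?thesis using \<open>0 < real (card S)\<close> by (simp add: quad_def)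
qed (use assms in \<open>simp add: quad_def\<close>)

context periodic_error
begin

lemma Rd_rate_nonneg: "0 \<le> N 6 * Rd_rate"
  using N_nonneg[of 6] U_nonneg V_nonneg unfolding Rd_rate_def by (intro mult_nonneg_nonneg add_nonneg_nonneg) auto

text \<open>For at least one node the exponent \<open>- 2 / (d + 1)\<close> of \<open>M_int\<close>
  in \<open>C3_const\<close> may be weakened to the \<open>- 1 / (d + 1)\<close> of the final
  estimate.\<close>

lemma midpoint_set_cards:
  assumes "midpoint_set kap T S"
  shows "1 \<le> M_t S" "1 \<le> M_int S"
proof -
  show "1 \<le> M_t S"
    using assms by (auto simp: midpoint_set_def M_t_def card_space_grid Suc_le_eq simp flip: of_nat_power)
  obtain n K where "near_cubes kap T n K" "S_int S = interior_grid T n K"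
    using assms by (auto simp: midpoint_set_def)
  then show "1 \<le> M_int S"
    using T by (auto simp: M_int_def card_spacetime_grid near_cubes_def Suc_le_eq simp del: of_nat_mult of_nat_power)
qed

text \<open>The constants need only exceed explicit products. This freedom serves the main theorem,
  where \<open>Cpde\<close> is enlarged to become linear in the error norm.\<close>

lemma error_estimate:
  assumes ks: "ks_solution lam T u" and kap: "1 \<le> kap" and S: "midpoint_set kap T S"
    and C: "jump_const U CARD('n) * N 4 \<le> C" "0 \<le> C"
    and Ct: "t_const CARD('n) * (N 2)\<^sup>2 \<le> Ct"
    and Cpde: "pde_const T kap CARD('n) * (N 6 * Rd_rate)\<^sup>2 \<le> Cpde"
    and Csb: "\<And>i. i \<in> {1..4} \<Longrightarrow> sb_const T kap CARD('n) * comp_norm (i + 1) T e \<le> Csb i"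
      "\<And>i. i \<in> {1..4} \<Longrightarrow> 0 \<le> Csb i"
  defines "C2 \<equiv> C2_const (young_const lam CARD('n)) T v u"
  shows "0 \<le> C3_const lam T C Ct Cpde Csb v u S"
    and "(L2_on (Om T) e)\<^sup>2 \<le> C3_const lam T C Ct Cpde Csb v u S * (T + C2 * T\<^sup>2 * exp (C2 * T))"
proof -
  let ?d = "real CARD('n)" and ?D = "CARD('n)"
  have d1: "1 \<le> ?d" by (simp add: Suc_le_eq)
  have Ct0: "0 \<le> Ct" by (rule order_trans[OF _ Ct]) (simp add: t_const_def)
  have Cpde0: "0 \<le> Cpde" using T by (intro order_trans[OF _ Cpde]) (simp add: pde_const_def)
  have E0: "0 \<le> E_sb T i v S" for i unfolding E_sb_def quad_def using T by (simp add: sum_nonneg)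
  show nonneg: "0 \<le> C3_const lam T C Ct Cpde Csb v u S"
    unfolding C3_const_def using C(2) Ct0 Cpde0 Csb(2) E0 T
    by (intro add_nonneg_nonneg mult_nonneg_nonneg sum_nonneg) auto
  have int: "I T (\<lambda>z. (norm (Rd z))\<^sup>2) / 2 \<le> (E_pde lam T v S)\<^sup>2 + Cpde * M_int S powr (- 2 / (?d + 1))"
  proof -
    obtain n K where nK: "near_cubes kap T n K" and Si: "S_int S = interior_grid T n K"
      using S by (auto simp: midpoint_set_def)
    note m = near_cubes_mesh(4,5)[OF nK kap T]
    have M: "M_int S = real n ^ ?D * real K" using Si m T by (simp add: M_int_def card_spacetime_grid)
    have "2 ^ ?D * T * ((?d + 1)\<^sup>2 * (N 6 * Rd_rate))\<^sup>2 * (max (2 / real n) (T / real K))\<^sup>2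
      \<le> 2 ^ ?D * T * ((?d + 1)\<^sup>2 * (N 6 * Rd_rate))\<^sup>2 * (kap\<^sup>2 * (2 ^ ?D * T) powr (2 / (?d + 1)) * M_int S powr (- 2 / (?d + 1)))"
      unfolding M using T by (intro mult_left_mono near_cubes_mesh_int[OF nK kap T]) auto
    also have "\<dots> = pde_const T kap ?D * (N 6 * Rd_rate)\<^sup>2 * M_int S powr (- 2 / (?d + 1))"
      by (simp add: pde_const_def power_mult_distrib power_mult[symmetric])
    also have "\<dots> \<le> Cpde * M_int S powr (- 2 / (?d + 1))"
      by (intro mult_right_mono Cpde) auto
    finally show ?thesis using quadrature_int[OF ks m Si] by linarith
  qed
  have init: "energy e 0 \<le> (E_t v u S)\<^sup>2 + Ct * M_t S powr (- 2 / ?d)"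
  proof -
    obtain n where n: "0 < n" and St: "S_t S = {x. \<forall>i. x $ i \<in> mids 2 n}"
      using S by (auto simp: midpoint_set_def)
    have M: "M_t S = real n ^ ?D" using St n by (simp add: M_t_def card_space_grid)
    have "2 ^ ?D * (3 * (?d + 1) ^ 4 * (N 2)\<^sup>2) * ?d\<^sup>2 * (2 / real n)\<^sup>2 = t_const ?D * (N 2)\<^sup>2 * M_t S powr (- 2 / ?d)"
      unfolding M mesh_t[OF n zero_less_card_finite[where 'a = 'n]] t_const_def by (simp only: mult_ac)
    also have "\<dots> \<le> Ct * M_t S powr (- 2 / ?d)" by (intro mult_right_mono Ct) auto
    finally show ?thesis using quadrature_t[OF n St] by linarith
  qed
  have sb: "sqrt (\<Sum>j\<in>UNIV. I T (\<lambda>z. (norm (face_jump j (trace_op T i j e) z))\<^sup>2))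
     \<le> E_sb T i v S + Csb i * M_sb i S powr (- 1 / ?d)" if i: "i \<in> {1..4}" for i
  proof -
    obtain n K where nK: "near_cubes kap T n K"
      and Sb: "S_sb S i = boundary_grid T n K"
      using S i unfolding midpoint_set_def by blast
    note m = near_cubes_mesh(4,5)[OF nK kap T]
    have M: "M_sb i S = 2 * ?d * real n ^ (?D - 1) * real K"
      unfolding M_sb_def Sb by (rule card_boundary_grid[OF m(1) T m(2)])
    have i6: "i + 1 \<le> 6" using i by auto
    have Ck: "Ck_on (i + 1) (Om T) e" by (rule Ck_bound_imp_Ck_on[OF e_bound[OF i6]])
    have Ni: "0 \<le> N i" "N i \<le> ?d * comp_norm (i + 1) T e"
      using N_nonneg[of i] N_le[of i "i + 1"] i6 Ck_norm_le_comp_norm[OF T Ck] by auto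
    let ?s = "sqrt (?d * 2 ^ ?D * T)"
    have "?s * (2 * (?d + 1)\<^sup>2 * ?d * N i) * max (2 / real n) (T / real K)
      \<le> ?s * (2 * (?d + 1)\<^sup>2 * ?d * (?d * comp_norm (i + 1) T e)) * (kap * (?d * 2 ^ ?D * T) powr (1 / ?d) * M_sb i S powr (- 1 / ?d))"
    proof (intro mult_mono mult_left_mono Ni)
      show "max (2 / real n) (T / real K) \<le> kap * (?d * 2 ^ ?D * T) powr (1 / ?d) * M_sb i S powr (- 1 / ?d)"
        unfolding M by (rule near_cubes_mesh_sb[OF nK kap T zero_less_card_finite])
    qed (use T Ni in \<open>auto simp: le_max_iff_disj intro!: mult_nonneg_nonneg comp_norm_nonneg[OF T Ck]\<close>)
    also have "\<dots> = sb_const T kap ?D * comp_norm (i + 1) T e * M_sb i S powr (- 1 / ?d)"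
      unfolding sb_const_def by (simp only: mult_ac)
    also have "\<dots> \<le> Csb i * M_sb i S powr (- 1 / ?d)" by (intro mult_right_mono Csb i) auto
    finally show ?thesis using quadrature_sb[OF m i Sb] by linarith
  qed
  have faces: "2 * ((U + ?d + 1) * N 4 * face_L1) \<le>
     C * T powr (1 / 2) * (\<Sum>i=1..4. E_sb T i v S + Csb i * M_sb i S powr (- 1 / ?d))"
  proof -
    let ?Q = "\<Sum>i=1..4. E_sb T i v S + Csb i * M_sb i S powr (- 1 / ?d)"
    have Q0: "0 \<le> ?Q" by (intro sum_nonneg add_nonneg_nonneg mult_nonneg_nonneg E0 Csb(2)) auto
    have "face_L1 \<le> sqrt (?d * 2 ^ ?D * T) * ?Q"
      by (rule order_trans[OF face_L1_le], rule mult_left_mono, rule sum_mono, rule sb) (use T in auto)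
    then have "2 * ((U + ?d + 1) * N 4 * face_L1) \<le> 2 * ((U + ?d + 1) * N 4 * (sqrt (?d * 2 ^ ?D * T) * ?Q))"
      using U_nonneg N_nonneg[of 4] by (intro mult_left_mono) auto
    \<comment> \<open>The root of the lateral measure splits into the square root of
      \<open>T\<close> and a factor that belongs to \<open>jump_const\<close>.\<close>
    also have "\<dots> = jump_const U ?D * N 4 * (T powr (1 / 2) * ?Q)"
      using T by (simp add: jump_const_def real_sqrt_mult powr_half_sqrt)
    also have "\<dots> \<le> C * (T powr (1 / 2) * ?Q)" using Q0 by (intro mult_right_mono C) auto
    finally show ?thesis by (simp add: mult.assoc)
  qed
  have A: "energy e 0 + I T (\<lambda>z. (norm (Rd z))\<^sup>2) / 2 + 2 * ((U + ?d + 1) * N 4 * face_L1) \<le> C3_const lam T C Ct Cpde Csb v u S"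
    using init int faces unfolding C3_const_def by linarith
  have Linf: "norm (u z) \<le> Linf_on (Om T) u" "norm (e z) \<le> Linf_on (Om T) e" if "z \<in> Om T" for z
    using norm_le_Linf_on[OF _ box_Om_nonempty[OF T], of u z] norm_le_Linf_on[OF _ box_Om_nonempty[OF T], of e z] cont(1,2) that
    by (simp_all add: Om_eq_cbox)
  have "(2 + (lam + 1 / 2)\<^sup>2 / 2 + 18 * ?d) * ((Linf_on (Om T) u)\<^sup>2 + (Linf_on (Om T) e)\<^sup>2 + 1) \<le> C2"
    unfolding C2_def C2_const_def young_const_def[symmetric] e_def
    by (intro mult_left_mono less_imp_le[OF young_const_pos]) auto
  from stability[OF Linf this A nonneg]
  show "(L2_on (Om T) e)\<^sup>2 \<le> C3_const lam T C Ct Cpde Csb v u S * (T + C2 * T\<^sup>2 * exp (C2 * T))" .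
qed

text \<open>\<open>C3_const\<close> contains this error squared, while the final estimate is linear
  in \<open>E_total\<close>: a bound independent of the number of nodes absorbs one factor.
  \<open>E_pde_le\<close> has the same purpose.\<close>

lemma E_t_le:
  assumes S: "midpoint_set kap T S" and B: "N 6 \<le> B"
  shows "E_t v u S \<le> sqrt (2 ^ CARD('n)) * B"
proof -
  obtain n where n: "0 < n" and St: "S_t S = {x. \<forall>i. x $ i \<in> mids 2 n}"
    using S by (auto simp: midpoint_set_def)
  have fin: "finite (S_t S)"
    using card_space_grid[OF n, where 'n = 'n] n St by (metis card.infinite power_eq_0_iff less_irrefl)
  have B0: "0 \<le> B" using B N_nonneg[of 6] by simp
  have "quad (2 ^ CARD('n)) (S_t S) (\<lambda>x. (norm (res_t v u x))\<^sup>2) \<le> 2 ^ CARD('n) * B\<^sup>2"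
  proof (rule quad_le[OF fin])
    fix x assume "x \<in> S_t S"
    then have "(x, 0) \<in> Om T" using St mids_strict_bounds[of _ 2 n] T by (auto simp: Om_def cell_def less_imp_le)
    from Ck_bound_norm[OF e_bound[of 6] this] have "norm (res_t v u x) \<le> B" using B by (simp add: res_t_def e_def)
    then show "(norm (res_t v u x))\<^sup>2 \<le> B\<^sup>2" by (intro power_mono) auto
  qed auto
  then have "E_t v u S \<le> sqrt (2 ^ CARD('n) * B\<^sup>2)" by (simp add: E_t_def measure_lebesgue_cell)
  then show ?thesis using B0 by (simp add: real_sqrt_mult)
qed

lemma E_pde_le:
  assumes ks: "ks_solution lam T u" and S: "midpoint_set kap T S" and B: "N 6 * Rd_rate \<le> B"
  shows "E_pde lam T v S \<le> sqrt (2 ^ CARD('n) * T) * B"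
proof -
  obtain n K where nK: "near_cubes kap T n K" and Si: "S_int S = interior_grid T n K"
    using S by (auto simp: midpoint_set_def)
  have fin: "finite (S_int S)"
    using card_spacetime_grid[OF T, of n K, where 'n = 'n] nK Si
    by (metis card.infinite mult_is_0 near_cubes_def power_eq_0_iff less_irrefl)
  have B0: "0 \<le> B"
    using Rd_rate_nonneg B by linarith
  have "quad (2 ^ CARD('n) * T) (S_int S) (\<lambda>z. (norm (res_pde lam T v z))\<^sup>2) \<le> 2 ^ CARD('n) * T * B\<^sup>2"
  proof (rule quad_le[OF fin])
    fix z assume "z \<in> S_int S"
    then obtain x t where z: "z = (x, t)" "\<forall>i. x $ i \<in> mids 2 n" "t \<in> mids T K" using Si by auto
    then have xt: "x \<in> cell" "t \<in> {0<..<T}"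
      using mids_strict_bounds[of t T K] mids_strict_bounds[of _ 2 n] T by (auto simp: cell_def less_imp_le)
    then have "z \<in> Om T" using z by (auto simp: Om_def)
    from Ck_bound_norm[OF Rd_bound this] have "norm (res_pde lam T v z) \<le> B"
      using B Rd_eq_residual[OF ks xt] z(1) by simp
    then show "(norm (res_pde lam T v z))\<^sup>2 \<le> B\<^sup>2" by (intro power_mono) auto
  qed (use T in auto)
  then have "E_pde lam T v S \<le> sqrt (2 ^ CARD('n) * T * B\<^sup>2)" using T by (simp add: E_pde_def measure_lebesgue_Om)
  then show ?thesis using B0 by (simp add: real_sqrt_mult)
qed

text \<open>Each summand is a coefficient times one of four nonnegative quantities, and the
  coefficients are simply added up. The 4 counts the boundary errors, each at most
  \<open>E_total\<close>.\<close>

lemma C3_const_le: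
  assumes S: "midpoint_set kap T S" and ks: "ks_solution lam T u"
    and C: "0 \<le> C" "C \<le> c" and Ct: "0 \<le> Ct" "Ct \<le> ct" and Cpde: "0 \<le> Cpde" "Cpde \<le> cp"
    and Csb: "\<And>i. i \<in> {1..4} \<Longrightarrow> 0 \<le> Csb i \<and> Csb i \<le> cs"
    and B: "N 6 \<le> b" "N 6 * Rd_rate \<le> b'"
  shows "C3_const lam T C Ct Cpde Csb v u S \<le>
    (sqrt (2 ^ CARD('n)) * b + sqrt (2 ^ CARD('n) * T) * b' + 4 * (c * T powr (1 / 2)) + ct + cp + c * T powr (1 / 2) * cs)
    * (E_total lam T v u S + M_t S powr (- 2 / real CARD('n)) + M_int S powr (- 1 / (real CARD('n) + 1)) +
                 (\<Sum>i=1..4. M_sb i S powr (- 1 / real CARD('n))))"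
proof -
  let ?d = "real CARD('n)" and ?D = "CARD('n)" and ?E = "E_total lam T v u S"
  let ?mt = "M_t S powr (- 2 / ?d)" and ?mi = "M_int S powr (- 1 / (?d + 1))" and ?ms = "\<Sum>i=1..4. M_sb i S powr (- 1 / ?d)"
  have Q: "0 \<le> E_sb T i v S" "0 \<le> E_t v u S" "0 \<le> E_pde lam T v S" for i
    unfolding E_sb_def E_t_def E_pde_def quad_def using T by (simp_all add: sum_nonneg)
  have Et: "E_t v u S \<le> ?E" "E_pde lam T v S \<le> ?E"
  proof -
    have "0 \<le> (\<Sum>i=1..4. (E_sb T i v S)\<^sup>2)" by (intro sum_nonneg) auto
    then have "(E_t v u S)\<^sup>2 \<le> (E_pde lam T v S)\<^sup>2 + (\<Sum>i=1..4. (E_sb T i v S)\<^sup>2) + (E_t v u S)\<^sup>2"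
      "(E_pde lam T v S)\<^sup>2 \<le> (E_pde lam T v S)\<^sup>2 + (\<Sum>i=1..4. (E_sb T i v S)\<^sup>2) + (E_t v u S)\<^sup>2"
      using zero_le_power2[of "E_pde lam T v S"] zero_le_power2[of "E_t v u S"] by linarith+
    then show "E_t v u S \<le> ?E" "E_pde lam T v S \<le> ?E"
      unfolding E_total_def by - (rule real_le_rsqrt, assumption)+
  qed
  have Es: "E_sb T i v S \<le> ?E" if "i \<in> {1..4}" for i
    unfolding E_total_def
  proof (rule real_le_rsqrt)
    have "(E_sb T i v S)\<^sup>2 \<le> (\<Sum>i=1..4. (E_sb T i v S)\<^sup>2)"
      using that by (intro member_le_sum) auto
    then show "(E_sb T i v S)\<^sup>2 \<le> (E_pde lam T v S)\<^sup>2 + (\<Sum>i = 1..4. (E_sb T i v S)\<^sup>2) + (E_t v u S)\<^sup>2"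
      by (simp add: add_increasing add_increasing2)
  qed
  have E: "0 \<le> ?E" using Q(2) Et(1) by (rule order_trans)
  have ms: "0 \<le> ?ms" by (intro sum_nonneg) auto
  have cs: "0 \<le> cs" using Csb[of 1] by auto
  have b: "0 \<le> b" using B(1) N_nonneg[of 6] by simp
  have b': "0 \<le> b'"
    using Rd_rate_nonneg B(2) by linarith
  let ?P = "sqrt (2 ^ ?D) * b" and ?P' = "sqrt (2 ^ ?D * T) * b'" and ?q = "c * T powr (1 / 2)"
  have q: "0 \<le> ?q" using C by simp
  have P: "0 \<le> ?P" "0 \<le> ?P'" using b b' T by auto
  have 1: "(E_t v u S)\<^sup>2 \<le> ?P * ?E"
    unfolding power2_eq_square by (intro mult_mono E_t_le[OF S B(1)] Et Q P)
  have 2: "(E_pde lam T v S)\<^sup>2 \<le> ?P' * ?E"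
    unfolding power2_eq_square by (intro mult_mono E_pde_le[OF ks S B(2)] Et Q P)
  have 3: "Ct * ?mt \<le> ct * ?mt" by (intro mult_right_mono Ct) auto
  have 4: "Cpde * M_int S powr (- 2 / (?d + 1)) \<le> cp * ?mi"
    using midpoint_set_cards(2)[OF S] Cpde by (intro mult_mono powr_mono Cpde divide_right_mono) auto
  have 5: "C * T powr (1 / 2) * (\<Sum>i=1..4. E_sb T i v S + Csb i * M_sb i S powr (- 1 / ?d)) \<le> ?q * (4 * ?E + cs * ?ms)"
  proof (intro mult_mono mult_right_mono C q)
    have "(\<Sum>i=1..4. E_sb T i v S + Csb i * M_sb i S powr (- 1 / ?d)) \<le> (\<Sum>i=(1::nat)..4. ?E + cs * M_sb i S powr (- 1 / ?d))"
      using Es Csb by (intro sum_mono add_mono mult_right_mono) auto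
    also have "\<dots> = 4 * ?E + cs * ?ms" by (simp add: sum.distrib sum_distrib_left)
    finally show "(\<Sum>i=1..4. E_sb T i v S + Csb i * M_sb i S powr (- 1 / ?d)) \<le> 4 * ?E + cs * ?ms" .
    show "0 \<le> (\<Sum>i=1..4. E_sb T i v S + Csb i * M_sb i S powr (- 1 / ?d))"
      using Q(1) Csb by (intro sum_nonneg add_nonneg_nonneg mult_nonneg_nonneg) auto
  qed (use C in auto)
  have alg: "p * E + ct' * x + p' * E + cp' * y + r * (4 * E + cs' * z) \<le> (p + p' + 4 * r + ct' + cp' + r * cs') * (E + x + y + z)"
    if "0 \<le> p" "0 \<le> p'" "0 \<le> E" "0 \<le> x" "0 \<le> y" "0 \<le> z" "0 \<le> r" "0 \<le> ct'" "0 \<le> cp'" "0 \<le> cs'" for p p' E x y z r ct' cp' cs' :: real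
  proof -
    have "(p + p' + 4 * r + ct' + cp' + r * cs') * (E + x + y + z) = p * E + ct' * x + p' * E + cp' * y + r * (4 * E + cs' * z)
      + ((p + p' + 4 * r + cp' + r * cs') * x + (p + p' + 4 * r + ct' + r * cs') * y + (p + p' + 4 * r + ct' + cp') * z + (ct' + cp' + r * cs') * E)"
      by (simp add: algebra_simps)
    moreover have "0 \<le> (p + p' + 4 * r + cp' + r * cs') * x + (p + p' + 4 * r + ct' + r * cs') * y + (p + p' + 4 * r + ct' + cp') * z + (ct' + cp' + r * cs') * E"
      using that by (intro add_nonneg_nonneg mult_nonneg_nonneg) auto
    ultimately show ?thesis by linarith
  qed
  have "C3_const lam T C Ct Cpde Csb v u S \<le> ?P * ?E + ct * ?mt + ?P' * ?E + cp * ?mi + ?q * (4 * ?E + cs * ?ms)"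
    unfolding C3_const_def using 1 2 3 4 5 by linarith
  also have "\<dots> \<le> (?P + ?P' + 4 * ?q + ct + cp + ?q * cs) * (?E + ?mt + ?mi + ?ms)"
    using Ct Cpde by (intro alg P E ms q cs) auto
  finally show ?thesis .
qed

end

section \<open>The main theorem\<close>

text \<open>Positivity comes from a nonzero value of \<sigma>; it keeps the network bounds away from
  0, so that additive constants can be absorbed into them.\<close>

lemma activation_Ck_bound:
  assumes "activation \<sigma>" "k \<le> 6"
  shows "Ck_bound k UNIV \<sigma> (Ck_norm k UNIV \<sigma>) 1" "0 < Ck_norm k UNIV \<sigma>"
proof -
  have B6: "Ck_bound 6 UNIV \<sigma> (Ck_norm 6 UNIV \<sigma>) 1"
    using assms(1) by (intro Ck_bound_Ck_norm) (auto simp: activation_def)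
  have on: "Ck_on k UNIV \<sigma>" using Ck_bound_imp_Ck_on[OF Ck_bound_le[OF assms(2) B6]] .
  have "Ck_values k UNIV \<sigma> \<subseteq> Ck_values 6 UNIV \<sigma>"
    using assms(2) by (force simp: Ck_values_def)
  then have "bdd_above (Ck_values k UNIV \<sigma>)"
    using assms(1) bdd_above_mono by (auto simp: activation_def)
  then show B: "Ck_bound k UNIV \<sigma> (Ck_norm k UNIV \<sigma>) 1" using on by (intro Ck_bound_Ck_norm)
  obtain x where "\<sigma> x \<noteq> 0" using assms(1) by (auto simp: activation_def)
  then show "0 < Ck_norm k UNIV \<sigma>" using Ck_bound_norm[OF B, of x] by (simp add: less_le_trans)
qed

text \<open>The right side without \<open>c\<close> is at least \<open>y0\<close>, because
  \<open>1 \<le> W\<close> and \<open>R0 \<le> R\<close>; hence the contribution of \<open>u\<close>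
  is a multiple of it. The norm itself obeys the same bound as its square since N \<le> 1 +
  N^2.\<close>

lemma network_error_norm:
  fixes u :: "'n::finite vfield" and \<sigma> :: "real \<Rightarrow> real"
  assumes T: "0 < T" and u: "Ck_on k (Om T) u" and \<sigma>: "Ck_bound k UNIV \<sigma> s 1" "0 \<le> s"
    and R0: "0 < R0" and k: "2 \<le> k" and a: "0 < a"
  shows "\<exists>c>0. \<forall>W R \<theta>. R0 \<le> R \<longrightarrow> \<theta> \<in> networks CARD('n) L W R \<longrightarrow>
    Ck_norm k (Om T) (\<lambda>z. nn_fun \<sigma> \<theta> z - u z) \<le> c * (a * real W ^ 3 * R ^ k) ^ (k * L) \<and>
    (Ck_norm k (Om T) (\<lambda>z. nn_fun \<sigma> \<theta> z - u z))\<^sup>2 \<le> c * (a * real W ^ 3 * R ^ k) ^ (k * L)"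
proof -
  let ?d = "real CARD('n)" and ?X = "max (max 2 T) (2 ^ (k * k) * s)"
  \<comment> \<open>The factor \<open>max 1 (1 / R0)\<close> lets \<open>max 1 R\<close> be replaced
    by a multiple of \<open>R\<close>.\<close>
  define c1 where "c1 = 2 * ?X * max 1 (1 / R0)"
  have c1: "0 < c1" unfolding c1_def by (intro mult_pos_pos) (auto simp: less_max_iff_disj)
  obtain c0 where c0: "0 < c0" "\<And>(W::nat) R. R0 \<le> R \<Longrightarrow> 1 \<le> W \<Longrightarrow> (c1 * real W * R) ^ (2 * (k * L)) \<le> c0 * (a * real W ^ 3 * R ^ k) ^ (k * L)"
    using power_bound_WR[OF c1 a R0 k, of L] by blast
  define uk where "uk = Ck_norm k (Om T) u"
  define y0 where "y0 = (a * R0 ^ k) ^ (k * L)"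
  have y0: "0 < y0" using a R0 by (simp add: y0_def)
  have uk: "0 \<le> uk" unfolding uk_def by (rule Ck_norm_nonneg[OF Ck_bound_compact[OF compact_Om u order_refl] Om_nonempty[OF T]])
  \<comment> \<open>The first summand pays for the 1 in N \<le> 1 + N^2, the second for
    \<open>u\<close>, the third for the network.\<close>
  define c where "c = 1 / y0 + (2 * uk\<^sup>2 / y0 + 2 * ?d\<^sup>2 * c0)"
  have c: "0 < c" unfolding c_def using y0 c0 by (intro add_pos_nonneg) auto
  show ?thesis
  proof (intro exI[of _ c] conjI allI impI c)
    fix W R \<theta> assume R: "R0 \<le> R" and \<theta>: "\<theta> \<in> networks CARD('n) L W R"
    let ?v = "nn_fun \<sigma> \<theta> :: 'n vfield" and ?Y = "(a * real W ^ 3 * R ^ k) ^ (k * L)" and ?Q = "(c1 * real W * R) ^ (k * L)"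
    let ?N = "Ck_norm k (Om T) (\<lambda>z. ?v z - u z)"
    have Rpos: "0 < R" using R R0 by simp
    note nb = networks_Ck_bound[OF T \<sigma> \<theta> Rpos]
    have W: "1 \<le> W" by (rule nb(2))
    have v: "Ck_on k (Om T) ?v" by (rule Ck_bound_imp_Ck_on[OF nb(1)])
    have "max 1 R \<le> R * max 1 (1 / R0)"
    proof (rule max.boundedI)
      have "1 \<le> R * (1 / R0)" using R R0 by simp
      also have "\<dots> \<le> R * max 1 (1 / R0)" using Rpos by (intro mult_left_mono) auto
      finally show "1 \<le> R * max 1 (1 / R0)" .
      show "R \<le> R * max 1 (1 / R0)" using mult_left_mono[of 1 "max 1 (1 / R0)" R] Rpos by simp
    qed
    then have "2 * real W * max 1 R * ?X \<le> 2 * real W * (R * max 1 (1 / R0)) * ?X"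
      by (intro mult_mono) auto
    also have "\<dots> = c1 * real W * R" unfolding c1_def by (simp only: mult_ac)
    finally have "(2 * real W * max 1 R * ?X) ^ (k * L) \<le> ?Q"
      by (rule power_mono) (auto intro!: mult_nonneg_nonneg simp: le_max_iff_disj)
    then have "Ck_norm k (Om T) ?v \<le> ?d * ?Q"
      using networks_Ck_norm[OF T \<sigma> \<theta> Rpos] k by (intro order_trans[OF networks_Ck_norm[OF T \<sigma> \<theta> Rpos] mult_left_mono]) auto
    moreover have "?N \<le> Ck_norm k (Om T) ?v + uk"
      unfolding uk_def by (rule Ck_norm_diff_le[OF compact_Om Om_nonempty[OF T] thick_Om[OF T] v u])
    ultimately have N: "?N \<le> uk + ?d * ?Q" by simp
    have N0: "0 \<le> ?N"
      by (rule Ck_norm_nonneg[OF Ck_bound_compact[OF compact_Om Ck_on_diff[OF compact_Om thick_Om[OF T] v u] order_refl] Om_nonempty[OF T]])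
    have "a * R0 ^ k = a * 1 ^ 3 * R0 ^ k" by simp
    also have "\<dots> \<le> a * real W ^ 3 * R ^ k" using W R R0 a by (intro mult_mono power_mono) auto
    finally have Y: "y0 \<le> ?Y" unfolding y0_def using a R0 by (intro power_mono) auto
    have QY: "?Q\<^sup>2 \<le> c0 * ?Y" using c0(2)[OF R W] by (simp add: power_mult[symmetric] mult.commute)
    have "?N\<^sup>2 \<le> (uk + ?d * ?Q)\<^sup>2" using N N0 by (rule power_mono)
    also have "\<dots> \<le> 2 * uk\<^sup>2 + 2 * (?d * ?Q)\<^sup>2"
      using sum_squares_bound[of uk "?d * ?Q"] by (simp only: power2_sum)
    also have "\<dots> = 2 * uk\<^sup>2 + 2 * ?d\<^sup>2 * ?Q\<^sup>2"
      by (subst power_mult_distrib[of ?d ?Q]) simp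
    also have "\<dots> \<le> 2 * uk\<^sup>2 / y0 * ?Y + 2 * ?d\<^sup>2 * (c0 * ?Y)"
    proof (intro add_mono mult_left_mono QY)
      have "2 * uk\<^sup>2 / y0 * y0 \<le> 2 * uk\<^sup>2 / y0 * ?Y" using y0 by (intro mult_left_mono Y) auto
      then show "2 * uk\<^sup>2 \<le> 2 * uk\<^sup>2 / y0 * ?Y" using y0 by simp
    qed auto
    also have "\<dots> = (2 * uk\<^sup>2 / y0 + 2 * ?d\<^sup>2 * c0) * ?Y" by (simp add: algebra_simps)
    finally have sq: "?N\<^sup>2 \<le> (2 * uk\<^sup>2 / y0 + 2 * ?d\<^sup>2 * c0) * ?Y" .
    have one: "1 \<le> 1 / y0 * ?Y" using Y y0 by simp
    show "?N\<^sup>2 \<le> c * ?Y" using sq one unfolding c_def distrib_right by linarith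
    have "?N \<le> 1 + ?N\<^sup>2"
      using zero_le_power2[of "?N - 1"] N0 by (simp add: power2_eq_square algebra_simps)
    then show "?N \<le> c * ?Y" using sq one unfolding c_def distrib_right by linarith
  qed
qed

text \<open>The quantifiers record dependence: C1 on \<open>lam\<close> and the dimension,
  \<open>c\<close> also on \<open>T\<close>, \<open>kap\<close>, \<open>u\<close>, \<sigma>,
  \<open>L\<close> and \<open>R0\<close>, \<open>cP\<close> and \<open>K\<close> also on
  \<open>W\<close> and \<open>R\<close>; none on \<theta> or the training set. Strict positivity is
  restricted to a nonzero error because otherwise the upper bounds force \<open>Cpde\<close> and
  \<open>Csb\<close> to be 0.\<close>

theorem theorem3p15:
  fixes lam :: real
  assumes "CARD('n::finite) = 2 \<or> CARD('n) = 3" and "lam > 0"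
  shows "\<exists>C1>0. \<forall>T>0. \<forall>kap\<ge>1. \<forall>(u :: 'n vfield) \<sigma> (L::nat). \<forall>R0>0.
    ks_solution lam T u \<and> activation \<sigma> \<longrightarrow>
    (\<exists>c>0. \<forall>(W::nat). \<forall>R\<ge>R0. \<exists>cP>0. \<exists>K>0. \<forall>\<theta>\<in>networks CARD('n) L W R.
      let us = nn_fun \<sigma> \<theta>; uh = (\<lambda>z. us z - u z); C2 = C2_const C1 T us u;
          N = (\<lambda>k f. Ck_norm k (Om T) f); s = (\<lambda>k. Ck_norm k UNIV \<sigma>)
      in \<exists>C Ct Cpde (Csb :: nat \<Rightarrow> real).
        0 \<le> C \<and> 0 \<le> Ct \<and> 0 \<le> Cpde \<and> (\<forall>i\<in>{1..4}. 0 \<le> Csb i) \<and>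
        ((\<exists>z\<in>Om T. uh z \<noteq> 0) \<longrightarrow> 0 < C \<and> 0 < Ct \<and> 0 < Cpde \<and> (\<forall>i\<in>{1..4}. 0 < Csb i)) \<and>
        C \<le> c * (N 4 u + N 4 uh) \<and>
        N 4 u + N 4 uh \<le> c * (N 4 u + 16 ^ (4 * L) * (real CARD('n) + 1) ^ 8 *
            (4 ^ 4 * exp 2 * real W ^ 3 * R ^ 4 * s 4) ^ (4 * L)) \<and>
        Ct \<le> c * ((N 2 u)\<^sup>2 + (N 2 uh)\<^sup>2) \<and>
        (N 2 u)\<^sup>2 + (N 2 uh)\<^sup>2 \<le> c * ((N 2 u)\<^sup>2 +
            (exp 2 * 2 ^ 6 * real W ^ 3 * R ^ 2 * s 2) ^ (2 * L)) \<and>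
        Cpde\<^sup>2 \<le> cP * (comp_norm 6 T uh)\<^sup>2 \<and>
        (comp_norm 6 T uh)\<^sup>2 \<le> c * (exp 2 * 6 ^ 4 * real W ^ 3 * R ^ 6 * s 6) ^ (6 * L) \<and>
        (\<forall>i\<in>{1..4}. (Csb i)\<^sup>2 \<le> c * (comp_norm (i + 1) T uh)\<^sup>2 \<and>
            (comp_norm (i + 1) T uh)\<^sup>2 \<le>
              c * (exp 2 * (real i + 1) ^ 4 * real W ^ 3 * R ^ (i + 1) * s (i + 1)) ^ ((i + 1) * L)) \<and>
        (\<forall>S. midpoint_set kap T S \<longrightarrow>
          (L2_on (Om T) uh)\<^sup>2
            \<le> C3_const lam T C Ct Cpde Csb us u S * (T + C2 * T\<^sup>2 * exp (C2 * T)) \<and>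
          C3_const lam T C Ct Cpde Csb us u S * (T + C2 * T\<^sup>2 * exp (C2 * T))
            \<le> K * (E_total lam T us u S + M_t S powr (- 2 / real CARD('n)) +
                 M_int S powr (- 1 / (real CARD('n) + 1)) +
                 (\<Sum>i=1..4. M_sb i S powr (- 1 / real CARD('n))))))"
proof (rule exI[of _ "young_const lam CARD('n)"], rule conjI[OF young_const_pos], intro allI impI, goal_cases)
  case (1 T kap u \<sigma> L R0)
  then have T: "0 < T" and kap: "1 \<le> kap" and R0: "0 < R0" and hyp: "ks_solution lam T u \<and> activation \<sigma>"
    by auto
  from hyp have ks: "ks_solution lam T u" and act: "activation \<sigma>" by auto
  have u: "Ck_on 6 (Om T) u" and per: "cell_periodic T u" using ks by (auto simp: ks_solution_def)
  let ?d = "real CARD('n)" and ?D = "CARD('n)"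
  let ?s = "\<lambda>k. Ck_norm k UNIV \<sigma>" and ?U = "Ck_norm 6 (Om T) u"
  let ?e = "\<lambda>\<theta> z. nn_fun \<sigma> \<theta> z - u z"
  have uk: "Ck_on k (Om T) u" if "k \<le> 6" for k
    by (rule Ck_bound_imp_Ck_on[OF Ck_bound_compact[OF compact_Om u that]])
  have U0: "0 \<le> ?U" by (rule Ck_norm_nonneg[OF Ck_bound_compact[OF compact_Om u order_refl] Om_nonempty[OF T]])
  \<comment> \<open>Packs the conclusion of \<open>network_error_norm\<close>, to be instantiated
    for several orders \<open>k\<close> and factors \<open>a\<close>.\<close>
  define B where "B k a c \<longleftrightarrow> 0 < c \<and> (\<forall>W R \<theta>. R0 \<le> R \<longrightarrow> \<theta> \<in> networks ?D L W R \<longrightarrow>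
      Ck_norm k (Om T) (?e \<theta>) \<le> c * (a * real W ^ 3 * R ^ k) ^ (k * L) \<and>
      (Ck_norm k (Om T) (?e \<theta>))\<^sup>2 \<le> c * (a * real W ^ 3 * R ^ k) ^ (k * L))" for k a c
  have ex: "\<exists>c. B k (a * ?s k) c" if "2 \<le> k" "k \<le> 6" "0 < a" for k a
    using network_error_norm[OF T uk[OF that(2)] activation_Ck_bound(1)[OF act that(2)] less_imp_le[OF activation_Ck_bound(2)[OF act that(2)]] R0 that(1)
        mult_pos_pos[OF that(3) activation_Ck_bound(2)[OF act that(2)]], of L]
    unfolding B_def by blast
  obtain c4 where c4: "B 4 (4 ^ 4 * exp 2 * ?s 4) c4" using ex[of 4 "4 ^ 4 * exp 2"] by auto
  obtain c2 where c2: "B 2 (exp 2 * 2 ^ 6 * ?s 2) c2" using ex[of 2 "exp 2 * 2 ^ 6"] by auto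
  obtain c6 where c6: "B 6 (exp 2 * 6 ^ 4 * ?s 6) c6" using ex[of 6 "exp 2 * 6 ^ 4"] by auto
  have "\<forall>i\<in>{1..4::nat}. \<exists>c. B (i + 1) (exp 2 * (real i + 1) ^ 4 * ?s (i + 1)) c"
    by (intro ballI ex) auto
  then obtain cb where cb: "\<And>i. i \<in> {1..4::nat} \<Longrightarrow> B (i + 1) (exp 2 * (real i + 1) ^ 4 * ?s (i + 1)) (cb i)"
    by metis
  define jc tc sc where "jc = jump_const ?U ?D" and "tc = t_const ?D" and "sc = sb_const T kap ?D"
  have jc: "0 < jc" unfolding jc_def jump_const_def using U0 by (intro mult_pos_pos) auto
  have tc: "0 < tc" unfolding tc_def t_const_def by (intro mult_pos_pos) auto
  have sc: "0 < sc" unfolding sc_def sb_const_def using T kap by (intro mult_pos_pos) auto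
  have cpos: "0 < c4" "0 < c2" "0 < c6" "\<And>i. i \<in> {1..4} \<Longrightarrow> 0 < cb i"
    using c4 c2 c6 cb unfolding B_def by auto
  \<comment> \<open>A sum dominating all partial constants at once; it also exceeds 1, which handles
    the terms in \<open>u\<close>.\<close>
  define c where "c = jc + tc + sc\<^sup>2 + (c4 + 1) + (c2 + 1) + c6 + (\<Sum>i=1..4. cb i)"
  have cbs: "cb i \<le> (\<Sum>i=1..4. cb i)" if "i \<in> {1..4}" for i
    using that cpos(4) by (intro member_le_sum) (auto intro: less_imp_le)
  have cs0: "0 \<le> (\<Sum>i=1..4. cb i)" using cpos(4) by (intro sum_nonneg) (auto intro: less_imp_le)
  have cle: "0 < c" "jc \<le> c" "tc \<le> c" "sc\<^sup>2 \<le> c" "c4 \<le> c" "c2 \<le> c" "1 \<le> c" "c6 \<le> c" "\<And>i. i \<in> {1..4} \<Longrightarrow> cb i \<le> c"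
  proof -
    show "0 < c" "jc \<le> c" "tc \<le> c" "sc\<^sup>2 \<le> c" "c4 \<le> c" "c2 \<le> c" "1 \<le> c" "c6 \<le> c"
      using jc tc cpos(1-3) cs0 zero_le_power2[of sc] unfolding c_def by linarith+
    show "cb i \<le> c" if "i \<in> {1..4}" for i
      using cbs[OF that] jc tc cpos(1-3) zero_le_power2[of sc] unfolding c_def by linarith
  qed
  show ?case
  proof (rule exI[of _ c], rule conjI[OF cle(1)], intro allI impI, goal_cases)
    case (1 W R)
    then have R: "R0 \<le> R" .
    have Rpos: "0 < R" using R R0 by simp
    \<comment> \<open>Bounds the C^6 norm of every network with these \<open>W\<close> and
      \<open>R\<close>; \<open>b\<close> then bounds that of the error and \<open>\<rho>\<close>
      bounds \<open>Rd_rate\<close>, uniformly in \<theta>.\<close>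
    define Vb where "Vb = ?d * (2 * real W * max 1 R * max (max 2 T) (2 ^ (6 * 6) * ?s 6)) ^ (6 * L)"
    have Vb0: "0 \<le> Vb" unfolding Vb_def by (intro mult_nonneg_nonneg zero_le_power) (auto simp: le_max_iff_disj)
    define b where "b = ?U + Vb"
    have b0: "0 \<le> b" using U0 Vb0 by (simp add: b_def)
    define \<rho> where "\<rho> = 1 + ?d * (2 * ?U + 2 * Vb) + \<bar>lam\<bar> * ?d + ?d\<^sup>2"
    have \<rho>0: "0 \<le> \<rho>" using U0 Vb0 unfolding \<rho>_def by (intro add_nonneg_nonneg mult_nonneg_nonneg) auto
    \<comment> \<open>Of the two factors \<open>N 6\<close> in the squared residual bound one is
      kept, as \<open>d\<close> times \<open>comp_norm 6\<close>, and the other replaced by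
      \<open>b\<close>. Adding 1 makes \<open>gp\<close> positive.\<close>
    define gp where "gp = pde_const T kap ?D * (?d * b * \<rho>\<^sup>2) + 1"
    have pc: "0 \<le> pde_const T kap ?D" unfolding pde_const_def using T by (intro mult_nonneg_nonneg) auto
    have gp: "0 < gp" unfolding gp_def using pc b0 by (intro add_nonneg_pos mult_nonneg_nonneg) auto
    \<comment> \<open>The factor from \<open>C3_const_le\<close> with \<open>jc * b\<close>,
      \<open>tc * b\<^sup>2\<close>, \<open>gp * b\<close> and \<open>sc * b\<close> as bounds for
      the four kinds of constants.\<close>
    define K0 where "K0 = sqrt (2 ^ ?D) * b + sqrt (2 ^ ?D * T) * (b * \<rho>) + 4 * (jc * b * T powr (1 / 2)) + tc * b\<^sup>2 + gp * b
       + jc * b * T powr (1 / 2) * (sc * b)"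
    have K0: "0 \<le> K0" unfolding K0_def using b0 \<rho>0 jc tc gp sc T
      by (intro add_nonneg_nonneg mult_nonneg_nonneg) auto
    \<comment> \<open>In C2 the sup norm of the error is replaced by \<open>b\<close>, so that the
      Gronwall factor \<open>F\<close> is uniform in \<theta>.\<close>
    define C2b where "C2b = young_const lam ?D * (b\<^sup>2 + (Linf_on (Om T) u)\<^sup>2 + (grad_L2 T u)\<^sup>2 + 1)"
    have C2b0: "0 \<le> C2b" unfolding C2b_def by (intro mult_nonneg_nonneg less_imp_le[OF young_const_pos]) auto
    define F where "F = T + C2b * T\<^sup>2 * exp (C2b * T)"
    have F: "0 < F" unfolding F_def using T C2b0 by (intro add_pos_nonneg) auto
    \<comment> \<open>\<open>K0\<close> is only known to be nonnegative, hence the added 1.\<close>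
    have gp2: "0 < gp\<^sup>2" and KF: "0 < (K0 + 1) * F" using gp K0 F by auto
    show ?case
    proof (rule exI[of _ "gp\<^sup>2"], rule conjI[OF gp2], rule exI[of _ "(K0 + 1) * F"], rule conjI[OF KF], rule ballI, goal_cases)
      case (1 \<theta>)
      then have \<theta>: "\<theta> \<in> networks CARD('n) L W R" .
      define v where "v = (nn_fun \<sigma> \<theta> :: 'n vfield)"
      define e where "e = (\<lambda>z. v z - u z)"
      note s6 = activation_Ck_bound[OF act order_refl]
      have v6: "Ck_on 6 (Om T) v"
        unfolding v_def by (rule Ck_bound_imp_Ck_on[OF networks_Ck_bound(1)[OF T s6(1) less_imp_le[OF s6(2)] \<theta> Rpos]])
      interpret periodic_error T lam u v e
        by unfold_locales (use T u v6 per e_def in auto)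
      have V: "Ck_norm 6 (Om T) v \<le> Vb"
        unfolding v_def Vb_def by (rule networks_Ck_norm[OF T s6(1) less_imp_le[OF s6(2)] \<theta> Rpos]) simp
      have bound: "Ck_norm k (Om T) e \<le> cc * (a * real W ^ 3 * R ^ k) ^ (k * L)"
        "(Ck_norm k (Om T) e)\<^sup>2 \<le> cc * (a * real W ^ 3 * R ^ k) ^ (k * L)" if "B k a cc" for k a cc
        using that R \<theta> unfolding B_def e_def v_def by auto
      have N6: "N 6 \<le> b"
        using Ck_norm_diff_le[OF compact_Om Om_nonempty[OF T] thick_Om[OF T] v6 u] V unfolding e_def b_def by simp
      have Nb: "N k \<le> b" if "k \<le> 6" for k using N_le[OF that order_refl] N6 by simp
      have ek: "Ck_on k (Om T) e" if "k \<le> 6" for k by (rule Ck_bound_imp_Ck_on[OF e_bound[OF that]])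
      have comp: "0 \<le> comp_norm k T e" "comp_norm k T e \<le> N k" "N k \<le> ?d * comp_norm k T e" if "k \<le> 6" for k
        using comp_norm_nonneg[OF T ek[OF that]] comp_norm_le[OF T ek[OF that]] Ck_norm_le_comp_norm[OF T ek[OF that]] by auto
      have comp_sq: "(comp_norm k T e)\<^sup>2 \<le> (N k)\<^sup>2" if "k \<le> 6" for k
        using comp[OF that] by (intro power_mono)
      have rho: "0 \<le> Rd_rate" "Rd_rate \<le> \<rho>"
      proof -
        show "0 \<le> Rd_rate" using U_nonneg V_nonneg unfolding Rd_rate_def by (intro add_nonneg_nonneg mult_nonneg_nonneg) auto
        show "Rd_rate \<le> \<rho>" unfolding Rd_rate_def \<rho>_def using V by (intro add_mono mult_left_mono) auto
      qed
      \<comment> \<open>The smallest choices permitted by \<open>error_estimate\<close>, except for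
        the enlarged \<open>?Cpde\<close>. As multiples of norms of the error they satisfy the
        required upper bounds.\<close>
      let ?C = "jc * N 4" and ?Ct = "tc * (N 2)\<^sup>2" and ?Cpde = "gp * comp_norm 6 T e"
      let ?Csb = "\<lambda>i. sc * comp_norm (i + 1) T e"
      let ?C2 = "C2_const (young_const lam ?D) T v u"
      have Cn: "0 \<le> ?C" "0 \<le> ?Ct" "0 \<le> ?Cpde" "\<forall>i\<in>{1..4}. 0 \<le> ?Csb i"
        using jc tc gp sc N_nonneg[of 4] comp(1) by auto
      have pos: "(\<exists>z\<in>Om T. v z - u z \<noteq> 0) \<longrightarrow> 0 < ?C \<and> 0 < ?Ct \<and> 0 < ?Cpde \<and> (\<forall>i\<in>{1..4}. 0 < ?Csb i)"
      proof
        assume "\<exists>z\<in>Om T. v z - u z \<noteq> 0"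
        then obtain z where z: "z \<in> Om T" "e z \<noteq> 0" unfolding e_def by blast
        have Np: "0 < N k" if "k \<le> 6" for k
          using Ck_bound_norm[OF e_bound[OF that] z(1)] z(2) by (meson less_le_trans zero_less_norm_iff)
        have cp: "0 < comp_norm k T e" if "k \<le> 6" for k
          using zero_less_mult_pos[OF less_le_trans[OF Np[OF that] comp(3)[OF that]]] by simp
        show "0 < ?C \<and> 0 < ?Ct \<and> 0 < ?Cpde \<and> (\<forall>i\<in>{1..4}. 0 < ?Csb i)"
          using jc tc gp sc Np[of 4] Np[of 2] cp by auto
      qed
      have u0: "0 \<le> Ck_norm k (Om T) u" if "k \<le> 6" for k
        by (rule Ck_norm_nonneg[OF Ck_bound_compact[OF compact_Om u that] Om_nonempty[OF T]])
      have g1: "?C \<le> c * (Ck_norm 4 (Om T) u + N 4)"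
        using cle(1,2) N_nonneg[of 4] u0[of 4] jc by (intro mult_mono) auto
      have g2: "Ck_norm 4 (Om T) u + N 4 \<le> c * (Ck_norm 4 (Om T) u + 16 ^ (4 * L) * (?d + 1) ^ 8 *
            (4 ^ 4 * exp 2 * real W ^ 3 * R ^ 4 * ?s 4) ^ (4 * L))"
      proof -
        let ?Y = "(4 ^ 4 * exp 2 * real W ^ 3 * R ^ 4 * ?s 4) ^ (4 * L)"
        have s4: "0 < ?s 4" by (rule activation_Ck_bound(2)[OF act]) simp
        have Y0: "0 \<le> ?Y" using Rpos s4 by simp
        have "N 4 \<le> c4 * ?Y" using bound(1)[OF c4] by (simp add: mult_ac)
        also have "\<dots> \<le> c * ?Y" using cle Y0 by (intro mult_right_mono) auto
        also have "\<dots> \<le> c * (16 ^ (4 * L) * (?d + 1) ^ 8 * ?Y)"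
        proof -
          \<comment> \<open>The extra factors of the asserted bound are at least 1 and only weaken
            it.\<close>
          have "1 * 1 \<le> (16::real) ^ (4 * L) * (?d + 1) ^ 8" by (intro mult_mono one_le_power) auto
          from mult_right_mono[OF this Y0] show ?thesis using cle(1) by (intro mult_left_mono) auto
        qed
        finally have "N 4 \<le> c * (16 ^ (4 * L) * (?d + 1) ^ 8 * ?Y)" .
        moreover have "Ck_norm 4 (Om T) u \<le> c * Ck_norm 4 (Om T) u"
          using mult_right_mono[OF cle(7) u0[of 4]] by simp
        ultimately show ?thesis by (simp add: distrib_left)
      qed
      have g3: "?Ct \<le> c * ((Ck_norm 2 (Om T) u)\<^sup>2 + (N 2)\<^sup>2)"
        using cle(1,3) tc by (intro mult_mono) auto
      have g4: "(Ck_norm 2 (Om T) u)\<^sup>2 + (N 2)\<^sup>2 \<le> c * ((Ck_norm 2 (Om T) u)\<^sup>2 +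
            (exp 2 * 2 ^ 6 * real W ^ 3 * R ^ 2 * ?s 2) ^ (2 * L))"
      proof -
        let ?Y = "(exp 2 * 2 ^ 6 * real W ^ 3 * R ^ 2 * ?s 2) ^ (2 * L)"
        have s2: "0 < ?s 2" by (rule activation_Ck_bound(2)[OF act]) simp
        have Y0: "0 \<le> ?Y" using Rpos s2 by simp
        have "(N 2)\<^sup>2 \<le> c2 * ?Y" using bound(2)[OF c2] by (simp add: mult_ac)
        also have "\<dots> \<le> c * ?Y" using cle Y0 by (intro mult_right_mono) auto
        finally have "(N 2)\<^sup>2 \<le> c * ?Y" .
        moreover have "(Ck_norm 2 (Om T) u)\<^sup>2 \<le> c * (Ck_norm 2 (Om T) u)\<^sup>2"
          using mult_right_mono[OF cle(7), of "(Ck_norm 2 (Om T) u)\<^sup>2"] by simp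
        ultimately show ?thesis by (simp add: distrib_left)
      qed
      have g5: "?Cpde\<^sup>2 \<le> gp\<^sup>2 * (comp_norm 6 T e)\<^sup>2" by (simp add: power_mult_distrib)
      have g6: "(comp_norm 6 T e)\<^sup>2 \<le> c * (exp 2 * 6 ^ 4 * real W ^ 3 * R ^ 6 * ?s 6) ^ (6 * L)"
      proof -
        let ?Y = "(exp 2 * 6 ^ 4 * real W ^ 3 * R ^ 6 * ?s 6) ^ (6 * L)"
        have Y0: "0 \<le> ?Y" using Rpos s6(2) by simp
        have "(comp_norm 6 T e)\<^sup>2 \<le> c6 * ?Y"
          using comp_sq[of 6] bound(2)[OF c6] by (simp add: mult_ac)
        also have "\<dots> \<le> c * ?Y" using cle Y0 by (intro mult_right_mono) auto
        finally show ?thesis .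
      qed
      have g7: "\<forall>i\<in>{1..4}. (?Csb i)\<^sup>2 \<le> c * (comp_norm (i + 1) T e)\<^sup>2 \<and>
            (comp_norm (i + 1) T e)\<^sup>2 \<le>
              c * (exp 2 * (real i + 1) ^ 4 * real W ^ 3 * R ^ (i + 1) * ?s (i + 1)) ^ ((i + 1) * L)"
      proof (intro ballI conjI)
        fix i :: nat assume i: "i \<in> {1..4}"
        show "(?Csb i)\<^sup>2 \<le> c * (comp_norm (i + 1) T e)\<^sup>2"
          unfolding power_mult_distrib using cle(4) by (intro mult_right_mono) auto
        let ?Y = "(exp 2 * (real i + 1) ^ 4 * real W ^ 3 * R ^ (i + 1) * ?s (i + 1)) ^ ((i + 1) * L)"
        have si: "0 < ?s (i + 1)" by (rule activation_Ck_bound(2)[OF act]) (use i in simp)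
        have Y0: "0 \<le> ?Y" using Rpos si by (intro zero_le_power mult_nonneg_nonneg) auto
        have Ya: "exp 2 * (real i + 1) ^ 4 * ?s (i + 1) * real W ^ 3 * R ^ (i + 1) =
          exp 2 * (real i + 1) ^ 4 * real W ^ 3 * R ^ (i + 1) * ?s (i + 1)" by (simp only: mult_ac)
        have "(comp_norm (i + 1) T e)\<^sup>2 \<le> (N (i + 1))\<^sup>2" by (rule comp_sq) (use i in simp)
        also have "\<dots> \<le> cb i * ?Y" using bound(2)[OF cb[OF i]] unfolding Ya .
        also have "\<dots> \<le> c * ?Y" using cle(9)[OF i] Y0 by (intro mult_right_mono) auto
        finally show "(comp_norm (i + 1) T e)\<^sup>2 \<le> c * ?Y" .
      qed
      have g8: "\<forall>S. midpoint_set kap T S \<longrightarrow>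
          (L2_on (Om T) e)\<^sup>2
            \<le> C3_const lam T ?C ?Ct ?Cpde ?Csb v u S * (T + ?C2 * T\<^sup>2 * exp (?C2 * T)) \<and>
          C3_const lam T ?C ?Ct ?Cpde ?Csb v u S * (T + ?C2 * T\<^sup>2 * exp (?C2 * T))
            \<le> (K0 + 1) * F * (E_total lam T v u S + M_t S powr (- 2 / ?d) +
                 M_int S powr (- 1 / (?d + 1)) + (\<Sum>i=1..4. M_sb i S powr (- 1 / ?d)))"
      proof (intro allI impI)
        fix S :: "'n training_set" assume S: "midpoint_set kap T S"
        let ?tot = "E_total lam T v u S + M_t S powr (- 2 / ?d) + M_int S powr (- 1 / (?d + 1)) + (\<Sum>i=1..4. M_sb i S powr (- 1 / ?d))"
        let ?C3 = "C3_const lam T ?C ?Ct ?Cpde ?Csb v u S"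
        have pde: "pde_const T kap ?D * (N 6 * Rd_rate)\<^sup>2 \<le> ?Cpde"
        proof -
          have "(N 6 * Rd_rate)\<^sup>2 = N 6 * N 6 * Rd_rate\<^sup>2" by (simp add: power2_eq_square mult_ac)
          also have "\<dots> \<le> (?d * comp_norm 6 T e) * b * \<rho>\<^sup>2"
            using comp[of 6] N6 N_nonneg[of 6] rho b0 by (intro mult_mono power_mono mult_nonneg_nonneg) auto
          finally have "pde_const T kap ?D * (N 6 * Rd_rate)\<^sup>2 \<le> pde_const T kap ?D * ((?d * comp_norm 6 T e) * b * \<rho>\<^sup>2)"
            using pc by (rule mult_left_mono)
          also have "\<dots> = (gp - 1) * comp_norm 6 T e" unfolding gp_def by (simp add: mult_ac)
          also have "\<dots> \<le> ?Cpde" using comp(1)[of 6] by (intro mult_right_mono) auto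
          finally show ?thesis .
        qed
        have est: "0 \<le> ?C3" "(L2_on (Om T) e)\<^sup>2 \<le> ?C3 * (T + ?C2 * T\<^sup>2 * exp (?C2 * T))"
          using error_estimate[OF ks kap S, of ?C ?Ct ?Cpde ?Csb] pde Cn
          unfolding jc_def tc_def sc_def by auto
        have C2: "0 \<le> ?C2" "?C2 \<le> C2b"
        proof -
          have eb: "norm (e z) \<le> b" if "z \<in> Om T" for z
            using Ck_bound_norm[OF e_bound[of 6] that] N6 by simp
          have "0 \<le> Linf_on (Om T) e" "Linf_on (Om T) e \<le> b"
            by (rule Linf_on_nonneg[OF b0 eb], assumption, rule Linf_on_le[OF b0 eb], assumption)
          then have "(Linf_on (Om T) e)\<^sup>2 \<le> b\<^sup>2" by (intro power_mono)
          then show "?C2 \<le> C2b" unfolding C2_const_def C2b_def e_def[symmetric]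
            by (intro mult_left_mono less_imp_le[OF young_const_pos]) auto
          show "0 \<le> ?C2" unfolding C2_const_def by (intro mult_nonneg_nonneg less_imp_le[OF young_const_pos]) auto
        qed
        have FF: "T + ?C2 * T\<^sup>2 * exp (?C2 * T) \<le> F"
          unfolding F_def using C2 T C2b0 by (intro add_left_mono mult_mono) auto
        have Nsq: "(N 2)\<^sup>2 \<le> b\<^sup>2" using Nb[of 2] N_nonneg[of 2] by (intro power_mono) auto
        have "?C3 \<le> K0 * ?tot"
          unfolding K0_def
        proof (rule C3_const_le[OF S ks])
          show "0 \<le> ?C" "0 \<le> ?Ct" "0 \<le> ?Cpde" using Cn by auto
          show "?C \<le> jc * b" using Nb[of 4] jc by (intro mult_left_mono) auto
          show "?Ct \<le> tc * b\<^sup>2" using Nsq tc by (intro mult_left_mono) auto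
          show "?Cpde \<le> gp * b" using comp(2)[of 6] N6 gp by (intro mult_left_mono) auto
          show "0 \<le> ?Csb i \<and> ?Csb i \<le> sc * b" if i: "i \<in> {1..4}" for i
            using Cn(4) i comp(2)[of "i + 1"] Nb[of "i + 1"] sc by (auto intro!: mult_left_mono)
          show "N 6 \<le> b" by (rule N6)
          show "N 6 * Rd_rate \<le> b * \<rho>" using N6 rho b0 by (intro mult_mono) auto
        qed
        moreover have tot0: "0 \<le> ?tot"
        proof -
          have "0 \<le> E_total lam T v u S" unfolding E_total_def
            by (intro real_sqrt_ge_zero add_nonneg_nonneg sum_nonneg) auto
          then show ?thesis by (intro add_nonneg_nonneg sum_nonneg) auto
        qed
        ultimately have "?C3 \<le> (K0 + 1) * ?tot" by (simp add: distrib_right)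
        then have "?C3 * (T + ?C2 * T\<^sup>2 * exp (?C2 * T)) \<le> (K0 + 1) * ?tot * F"
          using FF est(1) T C2 K0 tot0 by (intro mult_mono) auto
        also have "\<dots> = (K0 + 1) * F * ?tot" by (simp only: mult_ac)
        finally show "(L2_on (Om T) e)\<^sup>2 \<le> ?C3 * (T + ?C2 * T\<^sup>2 * exp (?C2 * T)) \<and>
           ?C3 * (T + ?C2 * T\<^sup>2 * exp (?C2 * T)) \<le> (K0 + 1) * F * ?tot"
          using est(2) by blast
      qed
      show ?case
        unfolding Let_def v_def[symmetric] e_def[symmetric]
        by (rule exI[of _ ?C], rule exI[of _ ?Ct], rule exI[of _ ?Cpde], rule exI[of _ ?Csb])
          (intro conjI Cn pos g1 g2 g3 g4 g5 g6 g7 g8)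
    qed
  qed
qed

end
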